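(* Let $q,w\in L^1[0,1]$ be real-valued with $w>0$ a.e. on $(0,1)$, and let $\lambda(t,r)$ be the first eigenvalue function of $(\mathbf{E}_q)$. Then $\lambda(t,r)$ is continuous on $(t,r)\in[0,1]\times[0,+\infty)$, and the corresponding eigenfunction $\Phi(x,\lambda(t,r))$ of $(\mathbf{E}^{t,r}_q)$ does not change its sign on $(0,1)$. Furthermore, $$\lambda(t,r)<\lambda(0,r)=\lambda(1,r)=\lambda(t,0)=\lambda_1,\qquad (t,r)\in(0,1)\times(0,+\infty),$$ where $\lambda_1$ is the first eigenvalue of $(\mathbf{E}_q)$.
   Context: $(\mathbf{E}_q)$ is the Dirichlet eigenvalue problem $-y''(x)+q(x)y(x)=\lambda w(x)y(x)$ on $[0,1]$, $y(0)=0=y(1)$, with spectral parameter $\lambda$. For $t\in(0,1)$ and $r\ge0$, $(\mathbf{E}^{t,r}_q)$ is the perturbed Dirichlet problem $-y''(x)+[q(x)-r\delta(x-t)]y(x)=\lambda w(x)y(x)$, $y(0)=0=y(1)$, where $\delta(\cdot-t)$ is the Dirac delta at $t$. It is understood as follows: $y$ is absolutely continuous on $[0,1]$, $y'$ exists and is absolutely continuous on each side of $t$ with one-sided limits $y'(t^\pm)$ at $t$, $-y''+qy=\lambda wy$ holds a.e. for $x\neq t$, $y'(t^-)-y'(t^+)=r\,y(t)$, and $y(0)=0=y(1)$. For $t=0$ or $t=1$ the perturbation term $-r\delta(x-t)$ has no influence because of the Dirichlet conditions, so $(\mathbf{E}^{t,r}_q)$ is $(\mathbf{E}_q)$; likewise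 $(\mathbf{E}^{t,0}_q)$ is $(\mathbf{E}_q)$. The first eigenvalue function of $(\mathbf{E}_q)$ is the function $(t,r)\mapsto\lambda(t,r)$, where $\lambda(t,r)$ is the first (smallest) eigenvalue of $(\mathbf{E}^{t,r}_q)$; $\Phi(\cdot,\lambda(t,r))$ denotes a corresponding real eigenfunction. *)

theory Defs
  imports "HOL-Analysis.Analysis"
begin

text \<open>
  The usual epsilon-delta notion, for a real function on an interval \<open>S\<close>. A set \<open>D\<close> with
  \<open>D division_of \<Union>D\<close> is precisely a finite family of nonempty compact intervals with pairwise
  disjoint interiors.
\<close>

definition abs_cont_on :: "(real \<Rightarrow> real) \<Rightarrow> real set \<Rightarrow> bool" where
  "abs_cont_on f S \<longleftrightarrow>
     (\<forall>\<epsilon>>0. \<exists>\<delta>>0. \<forall>D. D division_of \<Union>D \<and> \<Union>D \<subseteq> S \<and> (\<Sum>K\<in>D. Sup K - Inf K) < \<delta>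
        \<longrightarrow> (\<Sum>K\<in>D. \<bar>f (Sup K) - f (Inf K)\<bar>) < \<epsilon>)"

definition satisfies_eq_ae ::
  "(real \<Rightarrow> real) \<Rightarrow> (real \<Rightarrow> real) \<Rightarrow> real \<Rightarrow> (real \<Rightarrow> real) \<Rightarrow> bool" where
  "satisfies_eq_ae q w \<mu> y \<longleftrightarrow>
     (AE x in lebesgue. x \<in> {0<..<1} \<longrightarrow>
        (\<exists>d. (deriv y has_real_derivative d) (at x) \<and> - d + q x * y x = \<mu> * w x * y x))"

text \<open>
  In the next two definitions the derivative is required on open intervals only, since \<open>deriv\<close> is
  two-sided and \<open>y\<close> is unconstrained outside \<open>{0..1}\<close>. Absolute continuity on a bounded open
  interval is uniform, so \<open>deriv y\<close> extends to an absolutely continuous function on the closed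
  interval, the boundary values being the one-sided derivatives of \<open>y\<close>.
\<close>

definition dirichlet_solution ::
  "(real \<Rightarrow> real) \<Rightarrow> (real \<Rightarrow> real) \<Rightarrow> real \<Rightarrow> (real \<Rightarrow> real) \<Rightarrow> bool" where
  "dirichlet_solution q w \<mu> y \<longleftrightarrow>
     abs_cont_on y {0..1} \<and>
     y differentiable_on {0<..<1} \<and> abs_cont_on (deriv y) {0<..<1} \<and>
     satisfies_eq_ae q w \<mu> y \<and>
     y 0 = 0 \<and> y 1 = 0"

definition delta_solution ::
  "(real \<Rightarrow> real) \<Rightarrow> (real \<Rightarrow> real) \<Rightarrow> real \<Rightarrow> real \<Rightarrow> real \<Rightarrow> (real \<Rightarrow> real) \<Rightarrow> bool" where
  "delta_solution q w t r \<mu> y \<longleftrightarrow>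
     abs_cont_on y {0..1} \<and>
     y differentiable_on {0<..<t} \<and> abs_cont_on (deriv y) {0<..<t} \<and>
     y differentiable_on {t<..<1} \<and> abs_cont_on (deriv y) {t<..<1} \<and>
     (\<exists>l u. (deriv y \<longlongrightarrow> l) (at_left t) \<and> (deriv y \<longlongrightarrow> u) (at_right t) \<and> l - u = r * y t) \<and>
     satisfies_eq_ae q w \<mu> y \<and>
     y 0 = 0 \<and> y 1 = 0"

text \<open>For \<open>t\<close> at an endpoint the delta term has no influence because of the Dirichlet conditions.\<close>

definition perturbed_solution ::
  "(real \<Rightarrow> real) \<Rightarrow> (real \<Rightarrow> real) \<Rightarrow> real \<Rightarrow> real \<Rightarrow> real \<Rightarrow> (real \<Rightarrow> real) \<Rightarrow> bool" where
  "perturbed_solution q w t r \<mu> y \<longleftrightarrow>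
     (if t \<in> {0<..<1} then delta_solution q w t r \<mu> y else dirichlet_solution q w \<mu> y)"

definition nontrivial :: "(real \<Rightarrow> real) \<Rightarrow> bool" where
  "nontrivial y \<longleftrightarrow> (\<exists>x\<in>{0..1}. y x \<noteq> 0)"

definition dirichlet_eigenvalues :: "(real \<Rightarrow> real) \<Rightarrow> (real \<Rightarrow> real) \<Rightarrow> real set" where
  "dirichlet_eigenvalues q w = {\<mu>. \<exists>y. dirichlet_solution q w \<mu> y \<and> nontrivial y}"

definition perturbed_eigenfunction ::
  "(real \<Rightarrow> real) \<Rightarrow> (real \<Rightarrow> real) \<Rightarrow> real \<Rightarrow> real \<Rightarrow> real \<Rightarrow> (real \<Rightarrow> real) \<Rightarrow> bool" where
  "perturbed_eigenfunction q w t r \<mu> y \<longleftrightarrow> perturbed_solution q w t r \<mu> y \<and> nontrivial y"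

definition perturbed_eigenvalues ::
  "(real \<Rightarrow> real) \<Rightarrow> (real \<Rightarrow> real) \<Rightarrow> real \<Rightarrow> real \<Rightarrow> real set" where
  "perturbed_eigenvalues q w t r = {\<mu>. \<exists>y. perturbed_eigenfunction q w t r \<mu> y}"

text \<open>
  On \<^typ>\<open>real\<close>, \<open>LEAST\<close> is meaningful only when a least element exists; this has to be proved
  separately.
\<close>

definition first_dirichlet_eigenvalue :: "(real \<Rightarrow> real) \<Rightarrow> (real \<Rightarrow> real) \<Rightarrow> real" where
  "first_dirichlet_eigenvalue q w = (LEAST \<mu>. \<mu> \<in> dirichlet_eigenvalues q w)"

definition first_eigenvalue ::
  "(real \<Rightarrow> real) \<Rightarrow> (real \<Rightarrow> real) \<Rightarrow> real \<Rightarrow> real \<Rightarrow> real" where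
  "first_eigenvalue q w t r = (LEAST \<mu>. \<mu> \<in> perturbed_eigenvalues q w t r)"

end

theory Submission
  imports Defs
begin

text \<open>
  The idea is shooting from the left endpoint, in a form in which neither the integrable coefficients
  nor the delta term cause trouble, followed by a closed graph argument.

  Let \<open>\<sigma>(x) = \<integral>\<^sub>0\<^sup>x (q - \<lambda> w)\<close>. With \<open>z = y' - \<sigma> y\<close> the equation \<open>y'' = (q - \<lambda> w) y\<close> becomes
  \<open>y' = \<sigma> y + z\<close>, \<open>z' = - \<sigma>\<^sup>2 y - \<sigma> z\<close>, a linear system with continuous coefficients and \<open>C\<^sup>1\<close> solutions
  (\<open>quasi_system\<close>). A Picard series gives fundamental solutions \<open>\<phi>\<close>, \<open>\<theta>\<close> that are jointly continuous in
  \<open>(\<lambda>, x)\<close>. To pass between the system and the original equation, and to bring \<open>w\<close> back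
  into Sturm's identity, one uses that indefinite integrals are absolutely continuous and almost
  everywhere differentiable and that an absolutely continuous function is the integral of its derivative.

  A delta of strength \<open>r\<close> at \<open>t\<close> leaves \<open>\<phi>\<close> unchanged up to \<open>t\<close> and continues it by an explicit combination
  of \<open>\<phi>\<close> and \<open>\<theta>\<close>. The resulting function \<open>shoot \<lambda> t r\<close> depends continuously on all its arguments, the endpoint
  values of \<open>t\<close> included, and the eigenvalues are the zeros of \<open>\<lambda> \<mapsto> shoot \<lambda> t r 1\<close>
  (\<open>perturbed_eigenvalues_eq\<close>).

  The first eigenvalue is the only \<open>\<lambda>\<close> for which \<open>shoot \<lambda> t r\<close> is nonnegative on the unit interval and vanishes
  at 1. Such a \<open>\<lambda>\<close> is the largest element of the set \<open>N\<close> of all \<open>\<lambda>\<close> with \<open>shoot \<lambda> t r \<ge> 0\<close>: this set is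
  closed by continuity, nonempty because a positive supersolution exists when \<open>\<lambda>\<close> is very negative, and
  bounded above because solutions oscillate when \<open>\<lambda>\<close> is large; if the largest element did not give a zero at 1, its
  solution would be positive on \<open>(0,1]\<close>, and a slightly larger \<open>\<lambda>\<close> would still belong to \<open>N\<close>. That no zero
  of \<open>shoot \<lambda> t r 1\<close> lies below it is Sturm comparison, which also
  gives uniqueness; and a nonnegative solution cannot vanish inside, which gives the sign of the
  eigenfunctions.

  Consequently the graph of the first eigenvalue function is cut out by the closed conditions
  \<open>shoot \<lambda> t r \<ge> 0\<close> and \<open>shoot \<lambda> t r 1 = 0\<close>. The function is locally bounded, and a locally bounded function with
  closed graph is continuous. Finally, at the Dirichlet eigenvalue \<open>\<lambda>\<^sub>1\<close> one finds
  \<open>shoot \<lambda>\<^sub>1 t r 1 = r \<phi>(t)\<^sup>2 \<theta>(1)\<close> with \<open>\<theta>(1) < 0\<close>, while \<open>shoot \<lambda> t r 1 > 0\<close> for very negative \<open>\<lambda>\<close>. The intermediate value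
  theorem places an eigenvalue strictly below \<open>\<lambda>\<^sub>1\<close>.
\<close>

section \<open>Absolutely continuous functions\<close>

lemma division_real_elem:
  fixes D :: "real set set"
  assumes "D division_of \<Union>D" "\<Union>D \<subseteq> S" "K \<in> D"
  obtains u v where "u \<le> v" "K = {u..v}" "Sup K = v" "Inf K = u" "u \<in> S" "v \<in> S"
proof -
  obtain u v where "K = cbox u v" "K \<noteq> {}"
    using division_ofD(3,4)[OF assms(1,3)] by blast
  moreover have "K \<subseteq> S" using assms by blast
  ultimately show thesis by (intro that[of u v]) auto
qed

lemma abs_cont_on_subset:
  "abs_cont_on f S \<Longrightarrow> T \<subseteq> S \<Longrightarrow> abs_cont_on f T"
  unfolding abs_cont_on_def by (meson order_trans)

lemma abs_cont_onE:
  assumes "abs_cont_on f S" "e > 0"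
  obtains d where "d > 0"
    "\<And>D. D division_of \<Union>D \<Longrightarrow> \<Union>D \<subseteq> S \<Longrightarrow> (\<Sum>K\<in>D. Sup K - Inf K) < d \<Longrightarrow>
        (\<Sum>K\<in>D. \<bar>f (Sup K) - f (Inf K)\<bar>) < e"
proof -
  have "\<exists>d>0. \<forall>D. D division_of \<Union>D \<and> \<Union>D \<subseteq> S \<and> (\<Sum>K\<in>D. Sup K - Inf K) < d \<longrightarrow>
      (\<Sum>K\<in>D. \<bar>f (Sup K) - f (Inf K)\<bar>) < e"
    using assms unfolding abs_cont_on_def by blast
  then show thesis using that by blast
qed

text \<open>
  The closure properties below are instances: the increment of \<open>h\<close> over an interval is controlled by
  those of \<open>f\<close> and \<open>g\<close> over the same interval.
\<close>
lemma abs_cont_on_dominated: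
  assumes f: "abs_cont_on f S" and g: "abs_cont_on g S"
    and le: "\<And>u v. u \<in> S \<Longrightarrow> v \<in> S \<Longrightarrow> \<bar>h v - h u\<bar> \<le> C * (\<bar>f v - f u\<bar> + \<bar>g v - g u\<bar>)"
  shows "abs_cont_on h S"
  unfolding abs_cont_on_def
proof (intro allI impI)
  fix e :: real assume "e > 0"
  define B where "B = \<bar>C\<bar> + 1"
  have B: "B > 0" "C \<le> B" by (auto simp: B_def)
  have e2: "e / (2 * B) > 0" using \<open>e > 0\<close> B by simp
  obtain d1 where d1: "d1 > 0"
    "\<And>D. D division_of \<Union>D \<Longrightarrow> \<Union>D \<subseteq> S \<Longrightarrow> (\<Sum>K\<in>D. Sup K - Inf K) < d1 \<Longrightarrow>
        (\<Sum>K\<in>D. \<bar>f (Sup K) - f (Inf K)\<bar>) < e / (2 * B)"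
    using abs_cont_onE[OF f e2] by blast
  obtain d2 where d2: "d2 > 0"
    "\<And>D. D division_of \<Union>D \<Longrightarrow> \<Union>D \<subseteq> S \<Longrightarrow> (\<Sum>K\<in>D. Sup K - Inf K) < d2 \<Longrightarrow>
        (\<Sum>K\<in>D. \<bar>g (Sup K) - g (Inf K)\<bar>) < e / (2 * B)"
    using abs_cont_onE[OF g e2] by blast
  have "(\<Sum>K\<in>D. \<bar>h (Sup K) - h (Inf K)\<bar>) < e"
    if D: "D division_of \<Union>D" "\<Union>D \<subseteq> S" "(\<Sum>K\<in>D. Sup K - Inf K) < min d1 d2" for D
  proof -
    have "(\<Sum>K\<in>D. \<bar>h (Sup K) - h (Inf K)\<bar>)
        \<le> (\<Sum>K\<in>D. B * (\<bar>f (Sup K) - f (Inf K)\<bar> + \<bar>g (Sup K) - g (Inf K)\<bar>))"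
    proof (rule sum_mono)
      fix K assume "K \<in> D"
      then obtain u v where uv: "Sup K = v" "Inf K = u" "u \<in> S" "v \<in> S"
        using division_real_elem[OF D(1,2)] by metis
      have "C * (\<bar>f v - f u\<bar> + \<bar>g v - g u\<bar>) \<le> B * (\<bar>f v - f u\<bar> + \<bar>g v - g u\<bar>)"
        by (intro mult_right_mono B) auto
      then show "\<bar>h (Sup K) - h (Inf K)\<bar>
          \<le> B * (\<bar>f (Sup K) - f (Inf K)\<bar> + \<bar>g (Sup K) - g (Inf K)\<bar>)"
        using le[OF uv(3,4)] unfolding uv by linarith
    qed
    also have "\<dots> = B * ((\<Sum>K\<in>D. \<bar>f (Sup K) - f (Inf K)\<bar>) + (\<Sum>K\<in>D. \<bar>g (Sup K) - g (Inf K)\<bar>))"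
      by (simp only: sum_distrib_left distrib_left sum.distrib)
    also have "\<dots> < B * (e / (2 * B) + e / (2 * B))"
      using d1(2)[OF D(1,2)] d2(2)[OF D(1,2)] D(3) B by (intro mult_strict_left_mono) auto
    also have "\<dots> = e" using B by (simp add: field_simps)
    finally show ?thesis .
  qed
  then show "\<exists>d>0. \<forall>D. D division_of \<Union>D \<and> \<Union>D \<subseteq> S \<and> (\<Sum>K\<in>D. Sup K - Inf K) < d \<longrightarrow>
      (\<Sum>K\<in>D. \<bar>h (Sup K) - h (Inf K)\<bar>) < e"
    using d1(1) d2(1) by (intro exI[of _ "min d1 d2"]) auto
qed

lemma abs_cont_on_cong:
  assumes "\<And>x. x \<in> S \<Longrightarrow> f x = g x"
  shows "abs_cont_on f S \<longleftrightarrow> abs_cont_on g S"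
  using abs_cont_on_dominated[of f S f g 1] abs_cont_on_dominated[of g S g f 1]
  by (metis (no_types, lifting) abs_ge_zero add_increasing2 assms mult_1 order_refl)

lemma abs_cont_on_id: "abs_cont_on (\<lambda>x. x) S"
  unfolding abs_cont_on_def
proof (intro allI impI)
  fix e :: real assume "e > 0"
  have "(\<Sum>K\<in>D. \<bar>Sup K - Inf K\<bar>) = (\<Sum>K\<in>D. Sup K - Inf K)"
    if "D division_of \<Union>D" "\<Union>D \<subseteq> S" for D :: "real set set"
  proof (rule sum.cong)
    fix K assume "K \<in> D"
    then show "\<bar>Sup K - Inf K\<bar> = Sup K - Inf K"
      by (rule division_real_elem[OF that]) auto
  qed simp
  then show "\<exists>d>0. \<forall>D. D division_of \<Union>D \<and> \<Union>D \<subseteq> S \<and> (\<Sum>K\<in>D. Sup K - Inf K) < d \<longrightarrow>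
      (\<Sum>K\<in>D. \<bar>Sup K - Inf K\<bar>) < e"
    using \<open>e > 0\<close> by (intro exI[of _ e]) auto
qed

lemma abs_cont_on_Lipschitz:
  assumes "\<And>u v. u \<in> S \<Longrightarrow> v \<in> S \<Longrightarrow> \<bar>f v - f u\<bar> \<le> C * \<bar>v - u\<bar>"
  shows "abs_cont_on f S"
proof (rule abs_cont_on_dominated[OF abs_cont_on_id abs_cont_on_id, where C = "\<bar>C\<bar>"])
  fix u v assume "u \<in> S" "v \<in> S"
  then have "\<bar>f v - f u\<bar> \<le> \<bar>C\<bar> * \<bar>v - u\<bar>"
    by (meson abs_ge_self abs_ge_zero assms mult_right_mono order_trans)
  also have "\<dots> \<le> \<bar>C\<bar> * (\<bar>v - u\<bar> + \<bar>v - u\<bar>)" by (intro mult_left_mono) auto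
  finally show "\<bar>f v - f u\<bar> \<le> \<bar>C\<bar> * (\<bar>v - u\<bar> + \<bar>v - u\<bar>)" .
qed

lemma abs_cont_on_add:
  "abs_cont_on f S \<Longrightarrow> abs_cont_on g S \<Longrightarrow> abs_cont_on (\<lambda>x. f x + g x) S"
  by (rule abs_cont_on_dominated[of f S g _ 1]) (auto simp: abs_if)

lemma abs_cont_on_diff:
  "abs_cont_on f S \<Longrightarrow> abs_cont_on g S \<Longrightarrow> abs_cont_on (\<lambda>x. f x - g x) S"
  by (rule abs_cont_on_dominated[of f S g _ 1]) (auto simp: abs_if)

lemma abs_cont_on_cmult:
  "abs_cont_on f S \<Longrightarrow> abs_cont_on (\<lambda>x. c * f x) S"
  by (rule abs_cont_on_dominated[where C = "\<bar>c\<bar>"], assumption, assumption)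
     (simp add: abs_mult distrib_left flip: right_diff_distrib)

lemma abs_cont_on_imp_continuous_on:
  fixes f :: "real \<Rightarrow> real"
  assumes f: "abs_cont_on f S" and S: "is_interval S"
  shows "continuous_on S f"
proof (rule uniformly_continuous_imp_continuous, unfold uniformly_continuous_on_def, intro allI impI)
  fix e :: real assume "e > 0"
  then obtain d where d: "d > 0"
    "\<And>D. D division_of \<Union>D \<Longrightarrow> \<Union>D \<subseteq> S \<Longrightarrow> (\<Sum>K\<in>D. Sup K - Inf K) < d \<Longrightarrow>
        (\<Sum>K\<in>D. \<bar>f (Sup K) - f (Inf K)\<bar>) < e"
    using abs_cont_onE[OF f] by blast
  have le: "\<bar>f v - f u\<bar> < e" if "u \<in> S" "v \<in> S" "u \<le> v" "v - u < d" for u v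
  proof -
    have "{{u..v}} division_of \<Union>{{u..v}}"
      using that division_of_self[of u v] by simp
    moreover have "\<Union>{{u..v}} \<subseteq> S"
      using that mem_is_interval_1_I[OF S that(1,2)] by auto
    ultimately have "(\<Sum>K\<in>{{u..v}}. \<bar>f (Sup K) - f (Inf K)\<bar>) < e"
      using that by (intro d(2)) auto
    then show ?thesis using that by simp
  qed
  have "dist (f v) (f u) < e" if "u \<in> S" "v \<in> S" "dist v u < d" for u v
    using le[of u v] le[of v u] that unfolding dist_real_def
    by (cases "u \<le> v") (auto simp: abs_if split: if_splits)
  with d(1) show "\<exists>d>0. \<forall>x\<in>S. \<forall>x'\<in>S. dist x' x < d \<longrightarrow> dist (f x') (f x) < e" by blast
qed

lemma abs_cont_on_mult:
  assumes f: "abs_cont_on f {a..b}" and g: "abs_cont_on g {a..b}"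
  shows "abs_cont_on (\<lambda>x. f x * g x) {a..b}"
proof -
  have "bounded (f ` {a..b})" "bounded (g ` {a..b})"
    using abs_cont_on_imp_continuous_on[OF f] abs_cont_on_imp_continuous_on[OF g]
    by (auto intro!: compact_imp_bounded compact_continuous_image simp: is_interval_cc)
  then obtain A B where A: "\<And>x. x \<in> {a..b} \<Longrightarrow> \<bar>f x\<bar> \<le> A" and B: "\<And>x. x \<in> {a..b} \<Longrightarrow> \<bar>g x\<bar> \<le> B"
    unfolding bounded_iff real_norm_def by blast
  show ?thesis
  proof (rule abs_cont_on_dominated[OF f g, where C = "max A B"])
    fix u v assume uv: "u \<in> {a..b}" "v \<in> {a..b}"
    have "\<bar>f v * g v - f u * g u\<bar> = \<bar>g v * (f v - f u) + f u * (g v - g u)\<bar>"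
      by (simp add: algebra_simps)
    also have "\<dots> \<le> \<bar>g v\<bar> * \<bar>f v - f u\<bar> + \<bar>f u\<bar> * \<bar>g v - g u\<bar>"
      by (metis abs_mult abs_triangle_ineq)
    also have "\<dots> \<le> max A B * \<bar>f v - f u\<bar> + max A B * \<bar>g v - g u\<bar>"
      using A[OF uv(1)] B[OF uv(2)] by (intro add_mono mult_right_mono) auto
    finally show "\<bar>f v * g v - f u * g u\<bar> \<le> max A B * (\<bar>f v - f u\<bar> + \<bar>g v - g u\<bar>)"
      by (simp add: distrib_left)
  qed
qed

lemma division_length_eq_measure:
  fixes D :: "real set set"
  assumes "D division_of \<Union>D"
  shows "(\<Sum>K\<in>D. Sup K - Inf K) = measure lebesgue (\<Union>D)"
proof -
  have "(\<Sum>K\<in>D. Sup K - Inf K) = (\<Sum>K\<in>D. measure lebesgue K)"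
  proof (rule sum.cong)
    fix K assume "K \<in> D"
    then show "Sup K - Inf K = measure lebesgue K"
      by (rule division_real_elem[OF assms subset_UNIV]) auto
  qed simp
  also have "\<dots> = measure lebesgue (\<Union>D)"
    using content_division[OF assms] .
  finally show ?thesis .
qed

section \<open>The fundamental theorem of calculus\<close>

text \<open>
  The gauge integral allows a direct proof. Around a point outside \<open>N\<close> the gauge is the one given by
  differentiability, so an interval tagged there contributes an error proportional to its length.
  Around a point of \<open>N\<close> the gauge stays inside an open set \<open>U \<supseteq> N\<close> of small measure, so the intervals
  tagged in \<open>N\<close> have small total length, and absolute continuity makes the sum of the increments of \<open>f\<close> over
  them small.
\<close>
theorem fundamental_theorem_of_calculus_abs_cont:
  fixes f g :: "real \<Rightarrow> real"
  assumes "a \<le> b" and ac: "abs_cont_on f {a..b}" and N: "negligible N"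
    and der: "\<And>x. x \<in> {a..b} - N \<Longrightarrow> (f has_real_derivative g x) (at x within {a..b})"
  shows "(g has_integral (f b - f a)) {a..b}"
proof -
  define g' where "g' x = (if x \<in> N then 0 else g x)" for x
  have "(g' has_integral (f b - f a)) {a..b}"
    unfolding has_integral_real
  proof (intro allI impI)
    fix e :: real assume "e > 0"
    define e1 where "e1 = e / (2 * (b - a + 1))"
    have e1: "e1 > 0" "e1 * (b - a) < e / 2"
      using \<open>e > 0\<close> \<open>a \<le> b\<close> by (auto simp: e1_def field_simps)
    obtain dl where dl: "dl > 0"
      "\<And>D. D division_of \<Union>D \<Longrightarrow> \<Union>D \<subseteq> {a..b} \<Longrightarrow> (\<Sum>K\<in>D. Sup K - Inf K) < dl \<Longrightarrow>
          (\<Sum>K\<in>D. \<bar>f (Sup K) - f (Inf K)\<bar>) < e / 2"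
      using abs_cont_onE[OF ac half_gt_zero[OF \<open>e > 0\<close>]] by blast
    have Nl: "N \<in> sets lebesgue" using N by (simp add: negligible_iff_null_sets null_setsD2)
    obtain U where U: "open U" "N \<subseteq> U" "U - N \<in> lmeasurable" "emeasure lebesgue (U - N) < ennreal dl"
      using sets_lebesgue_outer_open[OF Nl dl(1)] by metis
    have Um: "U \<in> lmeasurable"
      using U N by (metis Un_Diff_cancel2 Un_absorb2 fmeasurable.Un negligible_imp_measurable)
    have "measure lebesgue (U - N) < dl"
      using U(3,4) dl(1) by (metis emeasure_eq_measure2 ennreal_less_iff fmeasurableD fmeasurableD2
          measure_nonneg)
    moreover have "measure lebesgue U = measure lebesgue (U - N)"
      using N by (metis Um fmeasurableD measure_Diff_null_set negligible_iff_null_sets)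
    ultimately have Ul: "measure lebesgue U < dl" by simp
    have "\<exists>d>0. (x \<in> N \<longrightarrow> ball x d \<subseteq> U) \<and>
        (x \<in> {a..b} - N \<longrightarrow> (\<forall>y\<in>{a..b}. \<bar>y - x\<bar> < d \<longrightarrow> \<bar>f y - f x - (y - x) * g x\<bar> \<le> e1 * \<bar>y - x\<bar>))" for x
    proof (cases "x \<in> N")
      case True
      then show ?thesis using U(1,2) by (auto simp: open_contains_ball subset_iff)
    next
      case False
      show ?thesis
      proof (cases "x \<in> {a..b}")
        case True
        then have "(f has_derivative (\<lambda>h. h * g x)) (at x within {a..b})"
          using der[of x] False by (simp add: has_field_derivative_def mult.commute[of _ "g x"])
        then show ?thesis
          using False e1(1) unfolding has_derivative_within_alt by auto
      qed (use False in \<open>auto intro: exI[of _ 1]\<close>)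
    qed
    then obtain d where d: "\<And>x. d x > 0" "\<And>x. x \<in> N \<Longrightarrow> ball x (d x) \<subseteq> U"
      "\<And>x y. x \<in> {a..b} \<Longrightarrow> x \<notin> N \<Longrightarrow> y \<in> {a..b} \<Longrightarrow> \<bar>y - x\<bar> < d x \<Longrightarrow>
          \<bar>f y - f x - (y - x) * g x\<bar> \<le> e1 * \<bar>y - x\<bar>"
      by (metis DiffI)
    show "\<exists>\<gamma>. gauge \<gamma> \<and> (\<forall>p. p tagged_division_of {a..b} \<and> \<gamma> fine p \<longrightarrow>
        norm ((\<Sum>(x, k)\<in>p. measure lborel k *\<^sub>R g' x) - (f b - f a)) < e)"
    proof (intro exI[of _ "\<lambda>x. ball x (d x)"] conjI allI impI)
      show "gauge (\<lambda>x. ball x (d x))" using d(1) by (rule gauge_ball_dependent[OF allI])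
    next
      fix p assume "p tagged_division_of {a..b} \<and> (\<lambda>x. ball x (d x)) fine p"
      then have p: "p tagged_division_of {a..b}" and fine: "(\<lambda>x. ball x (d x)) fine p" by auto
      define h where "h = (\<lambda>(x, K). measure lborel K * g' x - (f (Sup K) - f (Inf K)))"
      \<comment> \<open>Passing from sums over tagged intervals to sums over intervals requires a function that
        vanishes on the empty interval too, where the values of \<open>Sup\<close> and \<open>Inf\<close> are unspecified.\<close>
      define var where "var K = (if K = {} then 0 else \<bar>f (Sup K) - f (Inf K)\<bar>)" for K
      define pN where "pN = {xK \<in> p. fst xK \<in> N}"
      define D where "D = snd ` pN"
      have fp: "finite p" using p by blast
      have elem: "\<exists>u v. u \<le> v \<and> K = {u..v} \<and> x \<in> {u..v} \<and> {u..v} \<subseteq> {a..b} \<and> {u..v} \<subseteq> ball x (d x)"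
        if xK: "(x, K) \<in> p" for x K
      proof -
        obtain u v where uv: "K = {u..v}"
          using tagged_division_ofD(4)[OF p xK] by auto
        moreover have "x \<in> K" "K \<subseteq> {a..b}"
          using tagged_division_ofD(2,3)[OF p xK] by auto
        moreover have "K \<subseteq> ball x (d x)" using fineD[OF fine xK] .
        ultimately show ?thesis by (intro exI[of _ u] exI[of _ v]) auto
      qed
      have "(\<Sum>(x, k)\<in>p. measure lborel k *\<^sub>R g' x) - (f b - f a)
          = (\<Sum>(x, k)\<in>p. measure lborel k *\<^sub>R g' x) - (\<Sum>(x, K)\<in>p. f (Sup K) - f (Inf K))"
        using additive_tagged_division_1[OF \<open>a \<le> b\<close> p, of f] by simp
      also have "\<dots> = sum h p"
        by (simp add: h_def sum_subtractf case_prod_unfold)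
      also have "\<dots> = sum h pN + sum h (p - pN)"
        using sum.subset_diff[of pN p h] fp unfolding pN_def by (auto simp: add.commute)
      finally have eq: "(\<Sum>(x, k)\<in>p. measure lborel k *\<^sub>R g' x) - (f b - f a) = sum h pN + sum h (p - pN)" .
      have pN: "pN tagged_partial_division_of {a..b}"
        using p unfolding pN_def tagged_division_of_def
        by (auto intro: tagged_partial_division_subset)
      have Ddiv: "D division_of \<Union>D"
        unfolding D_def using pN by (rule partial_division_of_tagged_division)
      have Dsub: "\<Union>D \<subseteq> {a..b}" "\<Union>D \<subseteq> U"
        using elem d(2) unfolding D_def pN_def by fastforce+
      have "(\<Sum>K\<in>D. Sup K - Inf K) = measure lebesgue (\<Union>D)"
        by (rule division_length_eq_measure[OF Ddiv])
      also have "\<dots> \<le> measure lebesgue U"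
        using Dsub Um fmeasurableD[OF lmeasurable_division[OF Ddiv]]
        by (intro measure_mono_fmeasurable)
      finally have Dl: "(\<Sum>K\<in>D. Sup K - Inf K) < dl" using Ul by simp
      have "\<bar>sum h pN\<bar> \<le> (\<Sum>xK\<in>pN. \<bar>h xK\<bar>)" by (rule sum_abs)
      also have "\<dots> = (\<Sum>(x, K)\<in>pN. var K)"
        using elem by (intro sum.cong) (fastforce simp: h_def g'_def pN_def var_def)+
      also have "\<dots> = sum var D"
        unfolding D_def
      proof (rule sum.over_tagged_division_lemma[OF tagged_partial_division_of_Union_self[OF pN]])
        fix u v :: real assume "box u v = {}"
        then have "v \<le> u" by simp
        then show "var (cbox u v) = 0"
          by (cases "u = v") (auto simp: var_def)
      qed
      also have "\<dots> = (\<Sum>K\<in>D. \<bar>f (Sup K) - f (Inf K)\<bar>)"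
        using division_ofD(3)[OF Ddiv] by (intro sum.cong) (auto simp: var_def)
      also have "\<dots> < e / 2" using dl(2)[OF Ddiv Dsub(1) Dl] .
      finally have 1: "\<bar>sum h pN\<bar> < e / 2" .
      have "\<bar>sum h (p - pN)\<bar> \<le> (\<Sum>xK\<in>p - pN. \<bar>h xK\<bar>)" by (rule sum_abs)
      also have "\<dots> \<le> (\<Sum>(x, K)\<in>p - pN. e1 * (Sup K - Inf K))"
      proof (rule sum_mono, clarify)
        fix x K assume xK: "(x, K) \<in> p" "(x, K) \<notin> pN"
        obtain u v where uv: "u \<le> v" "K = {u..v}" "x \<in> {u..v}" "{u..v} \<subseteq> {a..b}" "{u..v} \<subseteq> ball x (d x)"
          using elem[OF xK(1)] by blast
        have x: "x \<in> {a..b}" "x \<notin> N" using uv xK by (auto simp: pN_def)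
        have "\<bar>f u - f x - (u - x) * g x\<bar> \<le> e1 * \<bar>u - x\<bar>" "\<bar>f v - f x - (v - x) * g x\<bar> \<le> e1 * \<bar>v - x\<bar>"
          using subsetD[OF uv(4), of u] subsetD[OF uv(4), of v] subsetD[OF uv(5), of u]
            subsetD[OF uv(5), of v] uv(1) d(3)[OF x]
          by (auto simp: dist_real_def abs_minus_commute)
        then have "\<bar>(v - u) * g x - (f v - f u)\<bar> \<le> e1 * \<bar>u - x\<bar> + e1 * \<bar>v - x\<bar>"
          by (simp add: algebra_simps)
        also have "\<dots> = e1 * (v - u)" using uv(3) by (simp add: algebra_simps)
        finally show "\<bar>h (x, K)\<bar> \<le> e1 * (Sup K - Inf K)"
          using uv(1,2) x(2) by (simp add: h_def g'_def)
      qed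
      also have "\<dots> \<le> (\<Sum>(x, K)\<in>p. e1 * (Sup K - Inf K))"
      proof (rule sum_mono2[OF fp])
        fix xK assume "xK \<in> p - (p - pN)"
        then show "0 \<le> (case xK of (x, K) \<Rightarrow> e1 * (Sup K - Inf K))"
          using elem e1(1) by (cases xK) fastforce
      qed auto
      also have "\<dots> = e1 * (b - a)"
        using additive_tagged_division_1[OF \<open>a \<le> b\<close> p, of "\<lambda>x. x"]
        by (simp add: case_prod_unfold flip: sum_distrib_left)
      finally have "\<bar>sum h (p - pN)\<bar> < e / 2" using e1(2) by simp
      with 1 show "norm ((\<Sum>(x, k)\<in>p. measure lborel k *\<^sub>R g' x) - (f b - f a)) < e"
        unfolding eq by simp
    qed
  qed
  then show ?thesis
    by (rule has_integral_spike[OF N, rotated]) (simp add: g'_def)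
qed

section \<open>Indefinite integrals\<close>

text \<open>
  Truncation at height \<open>n\<close> splits \<open>\<bar>f\<bar>\<close> into a part bounded by \<open>n\<close>, whose integral over a set is at most \<open>n\<close> times its
  length, and a remainder whose integral over the whole interval is small for large \<open>n\<close>.
\<close>
lemma abs_cont_on_indefinite_integral:
  fixes f :: "real \<Rightarrow> real"
  assumes f: "f absolutely_integrable_on {a..b}"
  shows "abs_cont_on (\<lambda>x. integral {a..x} f) {a..b}"
  unfolding abs_cont_on_def
proof (intro allI impI)
  fix e :: real assume "e > 0"
  have fi: "f integrable_on {a..b}" and afi: "(\<lambda>x. \<bar>f x\<bar>) integrable_on {a..b}"
    using f by (auto simp: absolutely_integrable_on_def)
  define m where "m n x = min \<bar>f x\<bar> (real n)" for n x
  have mi: "m n integrable_on {a..b}" for n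
  proof -
    have "(\<lambda>x. min \<bar>f x\<bar> (real n)) absolutely_integrable_on {a..b}"
      using absolutely_integrable_norm[OF f]
      by (intro absolutely_integrable_min_1) (auto simp: o_def)
    then show ?thesis by (simp add: absolutely_integrable_on_def m_def[abs_def])
  qed
  have "(\<lambda>n. integral {a..b} (m n)) \<longlonglongrightarrow> integral {a..b} (\<lambda>x. \<bar>f x\<bar>)"
  proof (rule dominated_convergence(2)[OF mi afi])
    fix x assume "x \<in> {a..b}"
    have "\<forall>\<^sub>F n in sequentially. m n x = \<bar>f x\<bar>"
      using eventually_ge_at_top[of "nat \<lceil>\<bar>f x\<bar>\<rceil>"]
      by eventually_elim (auto simp: m_def min_def nat_le_iff ceiling_le_iff)
    then show "(\<lambda>n. m n x) \<longlonglongrightarrow> \<bar>f x\<bar>" by (rule tendsto_eventually)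
  qed (auto simp: m_def)
  then obtain n where "dist (integral {a..b} (m n)) (integral {a..b} (\<lambda>x. \<bar>f x\<bar>)) < e / 2"
    using \<open>e > 0\<close> by (metis half_gt_zero lim_sequentially order_refl)
  then have n: "integral {a..b} (\<lambda>x. \<bar>f x\<bar> - m n x) < e / 2"
    using integral_diff[OF afi mi] by (simp add: dist_real_def abs_if split: if_splits)
  define r where "r x = \<bar>f x\<bar> - m n x" for x
  have ri: "r integrable_on {a..b}" unfolding r_def[abs_def] by (intro integrable_diff afi mi)
  have r0: "r x \<ge> 0" for x by (simp add: r_def m_def)
  have "(\<Sum>K\<in>D. \<bar>integral {a..Sup K} f - integral {a..Inf K} f\<bar>) < e"
    if D: "D division_of \<Union>D" "\<Union>D \<subseteq> {a..b}" "(\<Sum>K\<in>D. Sup K - Inf K) < e / (2 * (real n + 1))" for D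
  proof -
    have "(\<Sum>K\<in>D. \<bar>integral {a..Sup K} f - integral {a..Inf K} f\<bar>)
        \<le> (\<Sum>K\<in>D. integral K r + real n * (Sup K - Inf K))"
    proof (rule sum_mono)
      fix K assume "K \<in> D"
      then obtain u v where uv: "u \<le> v" "K = {u..v}" "Sup K = v" "Inf K = u" "u \<in> {a..b}" "v \<in> {a..b}"
        using division_real_elem[OF D(1,2)] by metis
      have sub: "{u..v} \<subseteq> {a..b}" using uv by auto
      have fi': "f integrable_on {u..v}" and afi': "(\<lambda>x. \<bar>f x\<bar>) integrable_on {u..v}"
        and ri': "r integrable_on {u..v}"
        using fi afi ri sub by (auto intro: integrable_subinterval_real)
      have "integral {a..u} f + integral {u..v} f = integral {a..v} f"
        using uv fi by (intro Henstock_Kurzweil_Integration.integral_combine)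
          (auto intro: integrable_subinterval_real)
      then have "\<bar>integral {a..v} f - integral {a..u} f\<bar> = \<bar>integral {u..v} f\<bar>" by simp
      also have "\<dots> \<le> integral {u..v} (\<lambda>x. r x + real n)"
      proof -
        have "norm (integral {u..v} f) \<le> integral {u..v} (\<lambda>x. r x + real n)"
          by (rule integral_norm_bound_integral[OF fi' integrable_add[OF ri' integrable_const_ivl]])
            (auto simp: r_def m_def)
        then show ?thesis by simp
      qed
      also have "\<dots> = integral {u..v} r + real n * (v - u)"
        using ri' uv(1) by (subst integral_add) auto
      finally show "\<bar>integral {a..Sup K} f - integral {a..Inf K} f\<bar>
          \<le> integral K r + real n * (Sup K - Inf K)"
        using uv by simp
    qed
    also have "\<dots> = integral (\<Union>D) r + real n * (\<Sum>K\<in>D. Sup K - Inf K)"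
      using integral_combine_division_topdown[OF integrable_on_subdivision[OF D(1) ri D(2)] D(1)]
      by (simp add: sum.distrib sum_distrib_left)
    also have "integral (\<Union>D) r \<le> integral {a..b} r"
      using integrable_on_subdivision[OF D(1) ri D(2)] D(2) ri r0 by (intro integral_subset_le) auto
    also have "integral {a..b} r < e / 2" using n unfolding r_def .
    also have "real n * (\<Sum>K\<in>D. Sup K - Inf K) \<le> real n * (e / (2 * (real n + 1)))"
      using D(3) by (intro mult_left_mono) auto
    also have "\<dots> \<le> e / 2" using \<open>e > 0\<close> by (simp add: field_simps)
    finally show ?thesis by simp
  qed
  then show "\<exists>d>0. \<forall>D. D division_of \<Union>D \<and> \<Union>D \<subseteq> {a..b} \<and> (\<Sum>K\<in>D. Sup K - Inf K) < d \<longrightarrow>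
      (\<Sum>K\<in>D. \<bar>integral {a..Sup K} f - integral {a..Inf K} f\<bar>) < e"
    using \<open>e > 0\<close> by (intro exI[of _ "e / (2 * (real n + 1))"]) auto
qed

text \<open>
  A one-sided form of Lebesgue's differentiation theorem; reflection then supplies the other side.
\<close>
lemma integral_has_right_derivative_ae:
  fixes f :: "real \<Rightarrow> real"
  assumes "f integrable_on {a..b}"
  obtains N where "negligible N"
    "\<And>x e. x \<in> {a<..<b} - N \<Longrightarrow> e > 0 \<Longrightarrow> \<exists>d>0. \<forall>y. x < y \<and> y < x + d \<longrightarrow>
        \<bar>integral {x..y} f - (y - x) * f x\<bar> \<le> e * (y - x)"
proof -
  define g where "g x = (if x \<in> {a..b} then f x else 0)" for x
  have "g integrable_on UNIV"
    using assms unfolding g_def[abs_def] by (simp only: integrable_restrict_UNIV)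
  then have "g integrable_on cbox u v" for u v
    by (rule integrable_on_subcbox) simp
  then obtain N where N: "negligible N" "\<And>x e. \<lbrakk>x \<notin> N; 0 < e\<rbrakk> \<Longrightarrow>
      \<exists>d>0. \<forall>h. 0 < h \<and> h < d \<longrightarrow>
        norm (integral (cbox x (x + h *\<^sub>R One)) g /\<^sub>R h ^ DIM(real) - g x) < e"
    by (rule integrable_ccontinuous_explicit) blast
  show thesis
  proof (rule that[OF N(1)])
    fix x e :: real assume x: "x \<in> {a<..<b} - N" and "e > 0"
    then obtain d where d: "d > 0" "\<And>h. 0 < h \<Longrightarrow> h < d \<Longrightarrow>
        \<bar>integral {x..x + h} g / h - g x\<bar> < e"
      using N(2)[of x e] by (auto simp: divide_inverse mult.commute)
    have "\<bar>integral {x..y} f - (y - x) * f x\<bar> \<le> e * (y - x)"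
      if y: "x < y" "y < x + min d (b - x)" for y
    proof -
      have "integral {x..y} g = integral {x..y} f"
        using x y by (intro integral_cong) (auto simp: g_def)
      moreover have "g x = f x" using x by (simp add: g_def)
      ultimately have "\<bar>integral {x..y} f / (y - x) - f x\<bar> < e"
        using d(2)[of "y - x"] y by simp
      then have "(y - x) * \<bar>integral {x..y} f / (y - x) - f x\<bar> \<le> e * (y - x)"
        using y by (simp add: mult.commute)
      moreover have "(y - x) * \<bar>integral {x..y} f / (y - x) - f x\<bar>
          = \<bar>(y - x) * (integral {x..y} f / (y - x) - f x)\<bar>"
        using y by (simp add: abs_mult)
      moreover have "(y - x) * (integral {x..y} f / (y - x) - f x) = integral {x..y} f - (y - x) * f x"
        using y by (simp add: field_simps)
      ultimately show ?thesis by simp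
    qed
    then show "\<exists>d>0. \<forall>y. x < y \<and> y < x + d \<longrightarrow> \<bar>integral {x..y} f - (y - x) * f x\<bar> \<le> e * (y - x)"
      using d(1) x by (intro exI[of _ "min d (b - x)"]) auto
  qed
qed

theorem integral_has_real_derivative_ae:
  fixes f :: "real \<Rightarrow> real"
  assumes f: "f integrable_on {a..b}"
  obtains N where "negligible N"
    "\<And>x. x \<in> {a<..<b} - N \<Longrightarrow> ((\<lambda>x. integral {a..x} f) has_real_derivative f x) (at x)"
proof -
  obtain N1 where N1: "negligible N1"
    "\<And>x e. x \<in> {a<..<b} - N1 \<Longrightarrow> e > 0 \<Longrightarrow> \<exists>d>0. \<forall>y. x < y \<and> y < x + d \<longrightarrow>
        \<bar>integral {x..y} f - (y - x) * f x\<bar> \<le> e * (y - x)"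
    using integral_has_right_derivative_ae[OF f] by blast
  have "(\<lambda>x. f (- x)) integrable_on {- b..- a}" using f by (simp only: Henstock_Kurzweil_Integration.integrable_reflect_real)
  then obtain N2 where N2: "negligible N2"
    "\<And>x e. x \<in> {- b<..<- a} - N2 \<Longrightarrow> e > 0 \<Longrightarrow> \<exists>d>0. \<forall>y. x < y \<and> y < x + d \<longrightarrow>
        \<bar>integral {x..y} (\<lambda>x. f (- x)) - (y - x) * f (- x)\<bar> \<le> e * (y - x)"
    using integral_has_right_derivative_ae by blast
  show thesis
  proof (rule that[of "N1 \<union> uminus ` N2"])
    show "negligible (N1 \<union> uminus ` N2)"
      using N1(1) N2(1)
      by (intro negligible_Un negligible_differentiable_image_negligible derivative_intros) auto
  next
    fix x assume x: "x \<in> {a<..<b} - (N1 \<union> uminus ` N2)"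
    have "- x \<notin> N2" using x by (metis DiffE UnCI image_eqI minus_minus)
    show "((\<lambda>x. integral {a..x} f) has_real_derivative f x) (at x)"
      unfolding has_field_derivative_def has_derivative_within_alt
    proof (intro conjI allI impI)
      show "bounded_linear ((*) (f x))" by (rule bounded_linear_mult_right)
    next
      fix e :: real assume "e > 0"
      obtain d1 where d1: "d1 > 0" "\<And>y. x < y \<Longrightarrow> y < x + d1 \<Longrightarrow>
          \<bar>integral {x..y} f - (y - x) * f x\<bar> \<le> e * (y - x)"
        using N1(2)[of x e] x \<open>e > 0\<close> by blast
      obtain d2 where d2: "d2 > 0" "\<And>y. - x < y \<Longrightarrow> y < - x + d2 \<Longrightarrow>
          \<bar>integral {- x..y} (\<lambda>x. f (- x)) - (y - - x) * f x\<bar> \<le> e * (y - - x)"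
        using N2(2)[of "- x" e] x \<open>- x \<notin> N2\<close> \<open>e > 0\<close> by auto
      define d where "d = Min {d1, d2, b - x, x - a}"
      have d: "d > 0" "d \<le> d1" "d \<le> d2" "d \<le> b - x" "d \<le> x - a"
        using x d1(1) d2(1) unfolding d_def by auto
      have split: "integral {a..v} f - integral {a..u} f = integral {u..v} f"
        if "a \<le> u" "u \<le> v" "v \<le> b" for u v
      proof -
        have "integral {a..u} f + integral {u..v} f = integral {a..v} f"
          using that f by (intro Henstock_Kurzweil_Integration.integral_combine)
            (auto intro: integrable_subinterval_real)
        then show ?thesis by simp
      qed
      have "\<bar>integral {a..y} f - integral {a..x} f - f x * (y - x)\<bar> \<le> e * \<bar>y - x\<bar>"
        if y: "\<bar>y - x\<bar> < d" for y
      proof (rule linorder_cases[of x y])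
        assume "x < y"
        then show ?thesis
          using d1(2)[of y] split[of x y] y d by (simp add: mult.commute)
      next
        assume "y < x"
        have "integral {- x..- y} (\<lambda>x. f (- x)) = integral {y..x} f"
          by (rule Henstock_Kurzweil_Integration.integral_reflect_real)
        moreover have "integral {a..x} f - integral {a..y} f = integral {y..x} f"
          using split[of y x] y d \<open>y < x\<close> by auto
        ultimately have "\<bar>integral {a..x} f - integral {a..y} f - (x - y) * f x\<bar> \<le> e * (x - y)"
          using d2(2)[of "- y"] y d \<open>y < x\<close> by auto
        moreover have "integral {a..y} f - integral {a..x} f - f x * (y - x)
            = - (integral {a..x} f - integral {a..y} f - (x - y) * f x)"
          by (simp add: algebra_simps)
        ultimately show ?thesis using \<open>y < x\<close> by (simp only: abs_minus_cancel) auto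
      qed auto
      then show "\<exists>d>0. \<forall>y\<in>UNIV. norm (y - x) < d \<longrightarrow>
          norm (integral {a..y} f - integral {a..x} f - f x * (y - x)) \<le> e * norm (y - x)"
        using d(1) by auto
    qed
  qed
qed

lemma C1_Lipschitz:
  fixes g :: "real \<Rightarrow> real"
  assumes g: "\<And>x. x \<in> {a..b} \<Longrightarrow> (g has_real_derivative g' x) (at x within {a..b})"
    and g': "continuous_on {a..b} g'"
  obtains C where "\<And>u v. u \<in> {a..b} \<Longrightarrow> v \<in> {a..b} \<Longrightarrow> \<bar>g v - g u\<bar> \<le> C * \<bar>v - u\<bar>"
proof -
  have "bounded (g' ` {a..b})"
    by (intro compact_imp_bounded compact_continuous_image g') auto
  then obtain C where C: "\<And>x. x \<in> {a..b} \<Longrightarrow> norm (g' x) \<le> C"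
    unfolding bounded_iff by blast
  show thesis
    using field_differentiable_bound[OF convex_real_interval(5) g C] by (intro that[of C]) simp
qed

lemma abs_cont_on_C1:
  fixes g :: "real \<Rightarrow> real"
  assumes g: "\<And>x. x \<in> {a..b} \<Longrightarrow> (g has_real_derivative g' x) (at x within {a..b})"
    and g': "continuous_on {a..b} g'"
  shows "abs_cont_on g {a..b}"
proof -
  obtain C where "\<And>u v. u \<in> {a..b} \<Longrightarrow> v \<in> {a..b} \<Longrightarrow> \<bar>g v - g u\<bar> \<le> C * \<bar>v - u\<bar>"
    using C1_Lipschitz[OF g g'] by blast
  then show ?thesis by (rule abs_cont_on_Lipschitz)
qed

text \<open>
  This is how the integrable coefficients \<open>q\<close> and \<open>w\<close> enter computations in which only their
  antiderivatives occur.
\<close>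
lemma integration_by_parts_abs_cont:
  fixes f g :: "real \<Rightarrow> real"
  assumes f: "f absolutely_integrable_on {0..1}" and ab: "0 \<le> a" "a \<le> b" "b \<le> 1"
    and F: "\<And>x. x \<in> {a..b} \<Longrightarrow> F x = c + integral {0..x} f"
    and g: "\<And>x. x \<in> {a..b} \<Longrightarrow> (g has_real_derivative g' x) (at x within {a..b})"
    and g': "continuous_on {a..b} g'"
  shows "((\<lambda>x. f x * g x + F x * g' x) has_integral F b * g b - F a * g a) {a..b}"
proof -
  have sub: "{a..b} \<subseteq> {0..1}" using ab by auto
  have Fac: "abs_cont_on (\<lambda>x. integral {0..x} f) {a..b}"
    using abs_cont_on_indefinite_integral[OF f] sub by (rule abs_cont_on_subset)
  have "abs_cont_on F {a..b}"
    by (rule abs_cont_on_dominated[OF Fac Fac, where C = 1]) (auto simp: F)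
  then have ac: "abs_cont_on (\<lambda>x. F x * g x) {a..b}"
    by (intro abs_cont_on_mult abs_cont_on_C1[OF g g'])
  have "f integrable_on {0..1}" using f by (simp add: absolutely_integrable_on_def)
  then obtain N where N: "negligible N"
    "\<And>x. x \<in> {0<..<1} - N \<Longrightarrow> ((\<lambda>x. integral {0..x} f) has_real_derivative f x) (at x)"
    using integral_has_real_derivative_ae by blast
  show ?thesis
  proof (rule fundamental_theorem_of_calculus_abs_cont[OF ab(2) ac])
    show "negligible (N \<union> {a, b})" using N(1) by (intro negligible_Un) auto
    fix x assume x: "x \<in> {a..b} - (N \<union> {a, b})"
    then have "((\<lambda>x. c + integral {0..x} f) has_real_derivative f x) (at x within {a..b})"
      using DERIV_add[OF DERIV_const has_field_derivative_at_within[OF N(2)], of x] ab by auto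
    then have "(F has_real_derivative f x) (at x within {a..b})"
      by (rule has_field_derivative_transform_within[OF _ zero_less_one]) (use x F in auto)
    from DERIV_mult[OF this g] x
    show "((\<lambda>x. F x * g x) has_real_derivative f x * g x + F x * g' x) (at x within {a..b})"
      by (simp add: add.commute mult.commute)
  qed
qed

section \<open>Linear differential equations depending on a parameter\<close>

lemma continuous_on_strips:
  fixes F :: "real \<times> real \<Rightarrow> 'b::topological_space"
  assumes "\<And>L. continuous_on ({-L..L} \<times> S) F"
  shows "continuous_on (UNIV \<times> S) F"
  unfolding continuous_on_eq_continuous_within
proof
  fix p :: "real \<times> real" assume p: "p \<in> UNIV \<times> S"
  define L where "L = \<bar>fst p\<bar> + 1"
  have "p \<in> {-L..L} \<times> S" using p by (auto simp: L_def mem_Times_iff)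
  then have "continuous (at p within {-L..L} \<times> S) F"
    using assms[of L] by (simp only: continuous_on_eq_continuous_within)
  moreover have "at p within {-L..L} \<times> S = at p within UNIV \<times> S"
  proof (rule at_within_nhd[of _ "{-L<..<L} \<times> UNIV"])
    show "open ({-L<..<L} \<times> (UNIV :: real set))" by (intro open_Times) auto
  qed (auto simp: L_def mem_Times_iff)
  ultimately show "continuous (at p within UNIV \<times> S) F" by (simp add: continuous_within)
qed

text \<open>
  The substitution \<open>\<integral>\<^sub>0\<^sup>x g(s) ds = x \<integral>\<^sub>0\<^sup>1 g(x s) ds\<close> turns the variable endpoint into a further parameter of an
  integral over a fixed interval.
\<close>
lemma continuous_on_indefinite_integral_param:
  fixes g :: "real \<Rightarrow> real \<Rightarrow> 'b::euclidean_space"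
  assumes g: "continuous_on (UNIV \<times> {0..1}) (\<lambda>(l, x). g l x)"
  shows "continuous_on (UNIV \<times> {0..1}) (\<lambda>(l, x). integral {0..x} (g l))"
proof -
  have "continuous_on ((UNIV \<times> {0..1}) \<times> {0..1}) (\<lambda>((l, x), s). g l (x * s))"
  proof -
    have "continuous_on ((UNIV \<times> {0..1}) \<times> {0..1}) (\<lambda>p. (\<lambda>(l, x). g l x) (fst (fst p), snd (fst p) * snd p))"
      by (rule continuous_on_compose2[OF g])
        (auto intro!: continuous_intros simp: mult_le_one)
    then show ?thesis by (simp add: case_prod_unfold)
  qed
  then have "continuous_on (UNIV \<times> {0..1}) (\<lambda>p. integral (cbox 0 1) (\<lambda>s. g (fst p) (snd p * s)))"
    by (intro integral_continuous_on_param) (simp add: case_prod_unfold)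
  then have "continuous_on (UNIV \<times> {0..1}) (\<lambda>p. snd p *\<^sub>R integral {0..1} (\<lambda>s. g (fst p) (snd p * s)))"
    by (intro continuous_intros) auto
  moreover have "integral {0..x} (g l) = x *\<^sub>R integral {0..1} (\<lambda>s. g l (x * s))" if "x \<in> {0..1}" for l x
  proof (cases "x = 0")
    case False
    then have x: "x > 0" using that by auto
    have "(\<lambda>s. s / x) ` {0..x} = {0..1}"
      using x by (simp add: image_divide_atLeastAtMost)
    then show ?thesis
      using integral_stretch_real[of x 0 x "g l"] x by simp
  qed simp
  ultimately show ?thesis
    by (subst continuous_on_cong[OF refl]) (auto simp: case_prod_unfold)
qed

text \<open>
  The solution is the sum of the Picard iterates \<open>T n\<close>. They satisfy \<open>\<parallel>T n l x\<parallel> \<le> \<parallel>v0\<parallel> (C x)\<^sup>n / n!\<close> with a constant \<open>C\<close>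
  that is uniform for \<open>l\<close> in a bounded set, so the series converges uniformly there and inherits the
  joint continuity of its terms.
\<close>
theorem linear_ode_parametric:
  fixes A :: "real \<Rightarrow> real \<Rightarrow> 'b::euclidean_space \<Rightarrow> 'b" and v0 :: 'b
  assumes lin: "\<And>l x. x \<in> {0..1} \<Longrightarrow> linear (A l x)"
    and cont: "continuous_on (UNIV \<times> {0..1} \<times> UNIV) (\<lambda>(l, x, v). A l x v)"
    and bd: "\<And>L. \<exists>C. \<forall>l\<in>{-L..L}. \<forall>x\<in>{0..1}. \<forall>v. norm (A l x v) \<le> C * norm v"
  obtains X where "\<And>l. X l 0 = v0"
    and "\<And>l x. x \<in> {0..1} \<Longrightarrow> (X l has_vector_derivative A l x (X l x)) (at x within {0..1})"
    and "continuous_on (UNIV \<times> {0..1}) (\<lambda>(l, x). X l x)"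
proof -
  define T where "T = rec_nat (\<lambda>l x. v0) (\<lambda>n f l x. integral {0..x} (\<lambda>s. A l s (f l s)))"
  have T0: "T 0 l x = v0" and TS: "T (Suc n) l x = integral {0..x} (\<lambda>s. A l s (T n l s))" for n l x
    by (simp_all add: T_def)
  have A_cont: "continuous_on (UNIV \<times> {0..1}) (\<lambda>(l, x). A l x (f l x))"
    if "continuous_on (UNIV \<times> {0..1}) (\<lambda>(l, x). f l x)" for f
  proof -
    have "continuous_on (UNIV \<times> {0..1}) (\<lambda>p. (\<lambda>(l, x, v). A l x v) (fst p, snd p, (\<lambda>(l, x). f l x) p))"
      by (rule continuous_on_compose2[OF cont]) (auto intro!: continuous_intros that)
    then show ?thesis by (simp add: case_prod_unfold)
  qed
  have T_cont: "continuous_on (UNIV \<times> {0..1}) (\<lambda>(l, x). T n l x)" for n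
  proof (induction n)
    case 0
    then show ?case by (simp add: T0 case_prod_unfold)
  next
    case (Suc n)
    then show ?case
      unfolding TS by (intro continuous_on_indefinite_integral_param A_cont)
  qed
  have slice: "continuous_on {0..x} (f l)"
    if "continuous_on (UNIV \<times> {0..1}) (\<lambda>(l, x). f l x)" "x \<in> {0..1}" for f l and x :: real
  proof -
    have "continuous_on {0..x} (\<lambda>s. (\<lambda>(l, x). f l x) (l, s))"
      by (rule continuous_on_compose2[OF that(1)]) (use that(2) in \<open>auto intro!: continuous_intros\<close>)
    then show ?thesis by simp
  qed
  define X where "X l x = (\<Sum>n. T n l x)" for l x
  have bound: "norm (T n l x) \<le> norm v0 * (C * x) ^ n / fact n"
    if C: "C \<ge> 0" "\<And>x v. x \<in> {0..1} \<Longrightarrow> norm (A l x v) \<le> C * norm v" and x: "x \<in> {0..1}" for C n l x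
    using x
  proof (induction n arbitrary: x)
    case 0
    then show ?case by (simp add: T0)
  next
    case (Suc n)
    have "((\<lambda>s. norm v0 * C ^ Suc n * s ^ n / fact n) has_integral
        norm v0 * C ^ Suc n * x ^ Suc n / fact (Suc n) - norm v0 * C ^ Suc n * 0 ^ Suc n / fact (Suc n)) {0..x}"
    proof (rule fundamental_theorem_of_calculus)
      fix s
      have "((\<lambda>s. norm v0 * C ^ Suc n * s ^ Suc n / fact (Suc n)) has_real_derivative
          norm v0 * C ^ Suc n * (real (Suc n) * s ^ n) / fact (Suc n)) (at s within {0..x})"
        by (rule DERIV_cdivide[OF DERIV_cmult[OF DERIV_pow[of "Suc n", unfolded diff_Suc_Suc diff_zero]]])
      moreover have "norm v0 * C ^ Suc n * (real (Suc n) * s ^ n) / fact (Suc n)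
          = norm v0 * C ^ Suc n * s ^ n / fact n"
        by (simp add: divide_simps del: of_nat_Suc)
      ultimately show "((\<lambda>s. norm v0 * C ^ Suc n * s ^ Suc n / fact (Suc n)) has_vector_derivative
          norm v0 * C ^ Suc n * s ^ n / fact n) (at s within {0..x})"
        by (simp only: has_real_derivative_iff_has_vector_derivative)
    qed (use Suc.prems in auto)
    then have int: "((\<lambda>s. norm v0 * C ^ Suc n * s ^ n / fact n) has_integral
        norm v0 * (C * x) ^ Suc n / fact (Suc n)) {0..x}"
      by (simp add: power_mult_distrib mult.assoc mult.left_commute)
    have "norm (T (Suc n) l x) \<le> integral {0..x} (\<lambda>s. norm v0 * C ^ Suc n * s ^ n / fact n)"
      unfolding TS
    proof (rule integral_norm_bound_integral)
      show "(\<lambda>s. A l s (T n l s)) integrable_on {0..x}"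
        using slice[OF A_cont[OF T_cont[of n]] Suc.prems, of l] by (simp add: integrable_continuous_real)
      show "(\<lambda>s. norm v0 * C ^ Suc n * s ^ n / fact n) integrable_on {0..x}"
        using int by blast
    next
      fix s assume s: "s \<in> {0..x}"
      then have s1: "s \<in> {0..1}" using Suc.prems by auto
      have "norm (A l s (T n l s)) \<le> C * norm (T n l s)" using C(2)[OF s1] .
      also have "\<dots> \<le> C * (norm v0 * (C * s) ^ n / fact n)"
        using Suc.IH[OF s1] C(1) by (rule mult_left_mono)
      also have "\<dots> = norm v0 * C ^ Suc n * s ^ n / fact n"
        by (simp add: power_mult_distrib)
      finally show "norm (A l s (T n l s)) \<le> norm v0 * C ^ Suc n * s ^ n / fact n" .
    qed
    also have "\<dots> = norm v0 * (C * x) ^ Suc n / fact (Suc n)" using int by blast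
    finally show ?case .
  qed
  have bdC: "\<exists>C\<ge>0. \<forall>l\<in>{-L..L}. \<forall>x\<in>{0..1}. \<forall>v. norm (A l x v) \<le> C * norm v" for L
  proof -
    obtain C where C: "\<forall>l\<in>{-L..L}. \<forall>x\<in>{0..1}. \<forall>v. norm (A l x v) \<le> C * norm v" using bd by blast
    have "C * norm v \<le> \<bar>C\<bar> * norm v" for v :: 'b by (intro mult_right_mono) auto
    with C show ?thesis by (meson abs_ge_zero order_trans)
  qed
  have ulim: "uniform_limit ({-L..L} \<times> {0..1}) (\<lambda>n p. \<Sum>i<n. (\<lambda>(l, x). T i l x) p) (\<lambda>(l, x). X l x) sequentially" for L
  proof -
    obtain C where C: "C \<ge> 0" "\<forall>l\<in>{-L..L}. \<forall>x\<in>{0..1}. \<forall>v. norm (A l x v) \<le> C * norm v"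
      using bdC by blast
    have "uniform_limit ({-L..L} \<times> {0..1}) (\<lambda>n p. \<Sum>i<n. (\<lambda>(l, x). T i l x) p)
        (\<lambda>p. \<Sum>i. (\<lambda>(l, x). T i l x) p) sequentially"
    proof (rule Weierstrass_m_test)
      fix n and p :: "real \<times> real" assume p: "p \<in> {-L..L} \<times> {0..1}"
      obtain l x where lx: "p = (l, x)" "l \<in> {-L..L}" "x \<in> {0..1}" using p by auto
      have "norm (T n l x) \<le> norm v0 * (C * x) ^ n / fact n"
        using bound[OF C(1) _ lx(3)] C(2) lx(2) by blast
      also have "\<dots> \<le> norm v0 * C ^ n / fact n"
        using C(1) lx(3) by (intro divide_right_mono mult_left_mono power_mono) (auto simp: mult_left_le)
      finally show "norm ((\<lambda>(l, x). T n l x) p) \<le> norm v0 * (C ^ n / fact n)" by (simp add: lx)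
    next
      have "summable (\<lambda>n. C ^ n / fact n)"
        using summable_exp[of C] by (simp add: divide_inverse mult.commute)
      then show "summable (\<lambda>n. norm v0 * (C ^ n / fact n))" by (rule summable_mult)
    qed
    then show ?thesis by (simp add: X_def case_prod_unfold)
  qed
  have S_cont: "continuous_on (UNIV \<times> {0..1}) (\<lambda>(l, x). \<Sum>i<n. T i l x)" for n
    using T_cont by (auto simp: case_prod_unfold intro!: continuous_intros)
  have X_cont: "continuous_on (UNIV \<times> {0..1}) (\<lambda>(l, x). X l x)"
  proof (rule continuous_on_strips)
    fix L
    have "continuous_on ({-L..L} \<times> {0..1}) (\<lambda>p. \<Sum>i<n. (\<lambda>(l, x). T i l x) p)" for n
      using T_cont by (intro continuous_intros) (blast intro: continuous_on_subset)
    then show "continuous_on ({-L..L} \<times> {0..1}) (\<lambda>(l, x). X l x)"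
      by (intro uniform_limit_theorem[OF _ ulim]) auto
  qed
  have ulim1: "uniform_limit {0..1} (\<lambda>n x. \<Sum>i<n. T i l x) (X l) sequentially" for l
  proof -
    have "uniform_limit {0..1} (\<lambda>n x. (\<lambda>p. \<Sum>i<n. (\<lambda>(l, x). T i l x) p) (l, x))
        (\<lambda>x. (\<lambda>(l, x). X l x) (l, x)) sequentially"
      by (rule uniform_limit_compose'[OF ulim[of "\<bar>l\<bar>"]]) auto
    then show ?thesis by simp
  qed
  have X_eq: "X l x = v0 + integral {0..x} (\<lambda>s. A l s (X l s))" if x: "x \<in> {0..1}" for l x
  proof -
    have l: "l \<in> {- \<bar>l\<bar>..\<bar>l\<bar>}" by auto
    obtain C where C: "C \<ge> 0" "\<And>x v. x \<in> {0..1} \<Longrightarrow> norm (A l x v) \<le> C * norm v"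
      using bdC[of "\<bar>l\<bar>"] l by blast
    have step: "(\<Sum>i<Suc n. T i l x) = v0 + integral {0..x} (\<lambda>s. A l s (\<Sum>i<n. T i l s))" for n
    proof -
      have "integral {0..x} (\<lambda>s. A l s (\<Sum>i<n. T i l s)) = integral {0..x} (\<lambda>s. \<Sum>i<n. A l s (T i l s))"
        using lin x by (intro integral_cong) (auto simp: linear_sum)
      also have "\<dots> = (\<Sum>i<n. integral {0..x} (\<lambda>s. A l s (T i l s)))"
        using slice[OF A_cont[OF T_cont] x] by (intro integral_sum) (auto intro: integrable_continuous_real)
      also have "\<dots> = (\<Sum>i<n. T (Suc i) l x)" by (simp add: TS)
      finally show ?thesis by (simp only: sum.lessThan_Suc_shift T0)
    qed
    have "uniform_limit {0..x} (\<lambda>n s. A l s (\<Sum>i<n. T i l s)) (\<lambda>s. A l s (X l s)) sequentially"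
    proof (rule uniform_limitI)
      fix e :: real assume "e > 0"
      then have "e / (C + 1) > 0" using C(1) by simp
      then have "\<forall>\<^sub>F n in sequentially. \<forall>s\<in>{0..1}. dist (\<Sum>i<n. T i l s) (X l s) < e / (C + 1)"
        using ulim1[of l] unfolding uniform_limit_iff by blast
      then show "\<forall>\<^sub>F n in sequentially. \<forall>s\<in>{0..x}. dist (A l s (\<Sum>i<n. T i l s)) (A l s (X l s)) < e"
      proof eventually_elim
        case (elim n)
        show ?case
        proof
          fix s assume "s \<in> {0..x}"
          then have s: "s \<in> {0..1}" using x by auto
          have "dist (A l s (\<Sum>i<n. T i l s)) (A l s (X l s)) = norm (A l s ((\<Sum>i<n. T i l s) - X l s))"
            using linear_diff[OF lin[OF s]] by (simp add: dist_norm)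
          also have "\<dots> \<le> C * norm ((\<Sum>i<n. T i l s) - X l s)" by (rule C(2)[OF s])
          also have "\<dots> \<le> C * (e / (C + 1))"
            using elim s C(1) by (intro mult_left_mono) (auto simp: dist_norm less_imp_le)
          also have "\<dots> < e" using \<open>e > 0\<close> C(1) by (simp add: field_simps)
          finally show "dist (A l s (\<Sum>i<n. T i l s)) (A l s (X l s)) < e" .
        qed
      qed
    qed
    moreover have "continuous_on {0..x} (\<lambda>s. A l s (\<Sum>i<n. T i l s))" for n
      using slice[OF A_cont[OF S_cont] x] .
    ultimately obtain I J where IJ: "\<And>n. ((\<lambda>s. A l s (\<Sum>i<n. T i l s)) has_integral I n) {0..x}"
      "((\<lambda>s. A l s (X l s)) has_integral J) {0..x}" "I \<longlonglongrightarrow> J"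
      by (rule uniform_limit_integral) auto
    have "(\<lambda>n. \<Sum>i<n. T i l x) \<longlonglongrightarrow> X l x"
      using tendsto_uniform_limitI[OF ulim1 x] .
    then have "(\<lambda>n. \<Sum>i<Suc n. T i l x) \<longlonglongrightarrow> X l x" by (rule LIMSEQ_Suc)
    moreover have "(\<lambda>n. \<Sum>i<Suc n. T i l x) \<longlonglongrightarrow> v0 + J"
      unfolding step integral_unique[OF IJ(1)] by (intro tendsto_intros IJ(3))
    ultimately show ?thesis using IJ(2) LIMSEQ_unique by (metis integral_unique)
  qed
  show thesis
  proof (rule that[of X])
    show "X l 0 = v0" for l using X_eq[of 0 l] by simp
    show "continuous_on (UNIV \<times> {0..1}) (\<lambda>(l, x). X l x)" by (rule X_cont)
    fix l x :: real assume x: "x \<in> {0..1}"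
    have one: "(1 :: real) \<in> {0..1}" by simp
    have "((\<lambda>u. v0 + integral {0..u} (\<lambda>s. A l s (X l s))) has_vector_derivative 0 + A l x (X l x)) (at x within {0..1})"
      using slice[OF A_cont[OF X_cont] one, of l] x
      by (intro has_vector_derivative_add has_vector_derivative_const integral_has_vector_derivative) auto
    then show "(X l has_vector_derivative A l x (X l x)) (at x within {0..1})"
      using X_eq x by (auto intro: has_vector_derivative_transform[OF x])
  qed
qed

section \<open>The regularized system\<close>

text \<open>
  If \<open>s' = V\<close>, then \<open>y\<close> solves \<open>y'' = V y\<close> exactly when \<open>y\<close> and \<open>z = y' - s y\<close> solve this system, in which \<open>V\<close> itself
  no longer occurs. The function \<open>z\<close> is the quasi-derivative of \<open>y\<close>.
\<close>
definition quasi_system :: "(real \<Rightarrow> real) \<Rightarrow> real set \<Rightarrow> (real \<Rightarrow> real) \<Rightarrow> (real \<Rightarrow> real) \<Rightarrow> bool" where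
  "quasi_system s I y z \<longleftrightarrow> (\<forall>x\<in>I. (y has_real_derivative s x * y x + z x) (at x within I) \<and>
     (z has_real_derivative - (s x)\<^sup>2 * y x - s x * z x) (at x within I))"

lemma quasi_system_exists:
  fixes s :: "real \<Rightarrow> real \<Rightarrow> real"
  assumes s: "continuous_on (UNIV \<times> {0..1}) (\<lambda>(l, x). s l x)"
  obtains y z where "\<And>l. y l 0 = c" "\<And>l. z l 0 = d" "\<And>l. quasi_system (s l) {0..1} (y l) (z l)"
    "continuous_on (UNIV \<times> {0..1}) (\<lambda>(l, x). y l x)"
    "continuous_on (UNIV \<times> {0..1}) (\<lambda>(l, x). z l x)"
proof -
  define A :: "real \<Rightarrow> real \<Rightarrow> real \<times> real \<Rightarrow> real \<times> real"
    where "A l x v = (s l x * fst v + snd v, - (s l x)\<^sup>2 * fst v - s l x * snd v)" for l x v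
  obtain X where X: "\<And>l. X l 0 = (c, d)"
    "\<And>l x. x \<in> {0..1} \<Longrightarrow> (X l has_vector_derivative A l x (X l x)) (at x within {0..1})"
    "continuous_on (UNIV \<times> {0..1}) (\<lambda>(l, x). X l x)"
  proof (rule linear_ode_parametric[of A "(c, d)"])
    show "linear (A l x)" for l x
      by (auto simp: linear_iff A_def algebra_simps)
    have s': "continuous_on (UNIV \<times> {0..1} \<times> UNIV) (\<lambda>p :: real \<times> real \<times> real \<times> real. (\<lambda>(l, x). s l x) (fst p, fst (snd p)))"
      by (rule continuous_on_compose2[OF s]) (auto intro!: continuous_intros)
    then show "continuous_on (UNIV \<times> {0..1} \<times> UNIV) (\<lambda>(l, x, v). A l x v)"
      unfolding A_def case_prod_unfold by (intro continuous_intros) (simp_all add: case_prod_unfold)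
  next
    fix L
    have "bounded ((\<lambda>(l, x). s l x) ` ({-L..L} \<times> {0..1}))"
      by (intro compact_imp_bounded compact_continuous_image compact_Times continuous_on_subset[OF s]) auto
    then obtain B where "\<And>p. p \<in> (\<lambda>(l, x). s l x) ` ({-L..L} \<times> {0..1}) \<Longrightarrow> norm p \<le> B"
      unfolding bounded_iff by blast
    then have "norm (case p of (l, x) \<Rightarrow> s l x) \<le> B" if "p \<in> {-L..L} \<times> {0..1}" for p
      using that by blast
    then have B: "\<bar>s l x\<bar> \<le> B" if "l \<in> {-L..L}" "x \<in> {0..1}" for l x
      using that by fastforce
    have "norm (A l x v) \<le> (1 + \<bar>B\<bar>)\<^sup>2 * norm v" if "l \<in> {-L..L}" "x \<in> {0..1}" for l x v
    proof -
      define m where "m = \<bar>s l x\<bar>"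
      have m: "0 \<le> m" "m \<le> \<bar>B\<bar>" using B[OF that] by (auto simp: m_def)
      have v: "\<bar>fst v\<bar> \<le> norm v" "\<bar>snd v\<bar> \<le> norm v"
        using norm_fst_le[of v] norm_snd_le[of v] by (auto simp: norm_prod_def real_sqrt_abs2)
      have "norm (A l x v) \<le> \<bar>s l x * fst v + snd v\<bar> + \<bar>- (s l x)\<^sup>2 * fst v - s l x * snd v\<bar>"
        unfolding A_def by (metis norm_Pair_le real_norm_def)
      also have "\<dots> \<le> (m * \<bar>fst v\<bar> + \<bar>snd v\<bar>) + (m\<^sup>2 * \<bar>fst v\<bar> + m * \<bar>snd v\<bar>)"
        by (intro add_mono order_trans[OF abs_triangle_ineq] order_trans[OF abs_triangle_ineq4])
          (auto simp: m_def abs_mult)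
      also have "\<dots> \<le> (m * norm v + norm v) + (m\<^sup>2 * norm v + m * norm v)"
        using v m(1) by (intro add_mono mult_left_mono) auto
      also have "\<dots> = (1 + m)\<^sup>2 * norm v" by (simp add: power2_eq_square algebra_simps)
      also have "\<dots> \<le> (1 + \<bar>B\<bar>)\<^sup>2 * norm v" using m by (intro mult_right_mono power_mono) auto
      finally show ?thesis .
    qed
    then show "\<exists>C. \<forall>l\<in>{-L..L}. \<forall>x\<in>{0..1}. \<forall>v. norm (A l x v) \<le> C * norm v" by blast
  qed blast
  show thesis
  proof (rule that[of "\<lambda>l x. fst (X l x)" "\<lambda>l x. snd (X l x)"])
    show "quasi_system (s l) {0..1} (\<lambda>x. fst (X l x)) (\<lambda>x. snd (X l x))" for l
      unfolding quasi_system_def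
      using bounded_linear.has_vector_derivative[OF bounded_linear_fst X(2)[of _ l]]
        bounded_linear.has_vector_derivative[OF bounded_linear_snd X(2)[of _ l]]
      by (simp add: A_def has_real_derivative_iff_has_vector_derivative)
    show "continuous_on (UNIV \<times> {0..1}) (\<lambda>(l, x). fst (X l x))"
      using continuous_on_fst[OF X(3)] by (simp add: case_prod_unfold)
    show "continuous_on (UNIV \<times> {0..1}) (\<lambda>(l, x). snd (X l x))"
      using continuous_on_snd[OF X(3)] by (simp add: case_prod_unfold)
  qed (simp_all add: X(1))
qed

lemma quasi_systemD:
  assumes "quasi_system s I y z" "x \<in> I"
  shows "(y has_real_derivative s x * y x + z x) (at x within I)"
    "(z has_real_derivative - (s x)\<^sup>2 * y x - s x * z x) (at x within I)"
  using assms by (auto simp: quasi_system_def)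

lemma quasi_system_subset:
  "quasi_system s I y z \<Longrightarrow> J \<subseteq> I \<Longrightarrow> quasi_system s J y z"
  unfolding quasi_system_def by (meson has_field_derivative_subset subsetD)

lemma quasi_system_cong:
  assumes yz: "quasi_system s I y z" and eq: "\<And>x. x \<in> I \<Longrightarrow> y' x = y x" "\<And>x. x \<in> I \<Longrightarrow> z' x = z x"
  shows "quasi_system s I y' z'"
  unfolding quasi_system_def
proof (intro ballI conjI)
  fix x assume x: "x \<in> I"
  show "(y' has_real_derivative s x * y' x + z' x) (at x within I)"
    unfolding eq(1)[OF x] eq(2)[OF x]
    by (rule has_field_derivative_transform_within[OF quasi_systemD(1)[OF yz x] zero_less_one x]) (simp add: eq)
  show "(z' has_real_derivative - (s x)\<^sup>2 * y' x - s x * z' x) (at x within I)"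
    unfolding eq(1)[OF x] eq(2)[OF x]
    by (rule has_field_derivative_transform_within[OF quasi_systemD(2)[OF yz x] zero_less_one x]) (simp add: eq)
qed

lemma quasi_system_lincomb:
  assumes "quasi_system s I y z" "quasi_system s I u v"
  shows "quasi_system s I (\<lambda>x. c * y x + d * u x) (\<lambda>x. c * z x + d * v x)"
  unfolding quasi_system_def
proof (intro ballI conjI)
  fix x assume x: "x \<in> I"
  note [derivative_intros] = quasi_systemD[OF assms(1) x] quasi_systemD[OF assms(2) x]
  show "((\<lambda>x. c * y x + d * u x) has_real_derivative s x * (c * y x + d * u x) + (c * z x + d * v x)) (at x within I)"
    by (auto intro!: derivative_eq_intros simp: algebra_simps)
  show "((\<lambda>x. c * z x + d * v x) has_real_derivative
      - (s x)\<^sup>2 * (c * y x + d * u x) - s x * (c * z x + d * v x)) (at x within I)"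
    by (auto intro!: derivative_eq_intros simp: algebra_simps)
qed

lemma quasi_system_continuous_on:
  assumes "quasi_system s I y z"
  shows "continuous_on I y" "continuous_on I z"
  using DERIV_continuous_on[OF quasi_systemD(1)[OF assms]]
    DERIV_continuous_on[OF quasi_systemD(2)[OF assms]] by simp_all

text \<open>
  The system has trace zero, so the Wronskian is constant. Constancy replaces a uniqueness theorem
  below: it expresses every solution explicitly through two given independent ones.
\<close>
lemma quasi_system_wronskian_constant:
  assumes "quasi_system s I y z" "quasi_system s I u v" "convex I" "x \<in> I" "x' \<in> I"
  shows "y x * v x - z x * u x = y x' * v x' - z x' * u x'"
proof -
  have "((\<lambda>x. y x * v x - z x * u x) has_real_derivative 0) (at x within I)" if x: "x \<in> I" for x
  proof -
    note [derivative_intros] = quasi_systemD[OF assms(1) x] quasi_systemD[OF assms(2) x]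
    show ?thesis
      by (auto intro!: derivative_eq_intros simp: algebra_simps power2_eq_square)
  qed
  then have "\<exists>c. \<forall>x\<in>I. y x * v x - z x * u x = c"
    by (rule has_field_derivative_zero_constant[OF assms(3)])
  with assms(4,5) show ?thesis by auto
qed

section \<open>Sturm's identity and oscillation\<close>

text \<open>
  The weight is taken positive everywhere. A weight that is positive almost everywhere can be
  modified on a null set, and outside the interval, without changing the eigenvalue problems.
\<close>
locale sturm_liouville =
  fixes q w :: "real \<Rightarrow> real"
  assumes q: "q absolutely_integrable_on {0..1}" and w: "w absolutely_integrable_on {0..1}"
    and w_pos: "\<And>x. w x > 0"
begin

definition Q :: "real \<Rightarrow> real" where "Q x = integral {0..x} q"
definition W :: "real \<Rightarrow> real" where "W x = integral {0..x} w"
definition sigma :: "real \<Rightarrow> real \<Rightarrow> real" where "sigma l x = Q x - l * W x"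

lemma q_integrable: "q integrable_on {0..1}" and w_integrable: "w integrable_on {0..1}"
  using q w by (auto simp: absolutely_integrable_on_def)

lemma Q_cont: "continuous_on {0..1} Q" and W_cont: "continuous_on {0..1} W"
  unfolding Q_def[abs_def] W_def[abs_def]
  by (intro indefinite_integral_continuous_1 q_integrable w_integrable)+

lemma Q_0 [simp]: "Q 0 = 0" and W_0 [simp]: "W 0 = 0" and sigma_0 [simp]: "sigma l 0 = 0"
  by (simp_all add: Q_def W_def sigma_def)

lemma sigma_cont: "continuous_on (UNIV \<times> {0..1}) (\<lambda>(l, x). sigma l x)"
proof -
  have "continuous_on (UNIV \<times> {0..1}) (\<lambda>p :: real \<times> real. Q (snd p))"
    "continuous_on (UNIV \<times> {0..1}) (\<lambda>p :: real \<times> real. W (snd p))"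
    by (rule continuous_on_compose2[OF Q_cont] continuous_on_compose2[OF W_cont];
        auto intro!: continuous_intros)+
  then show ?thesis
    unfolding sigma_def case_prod_unfold by (intro continuous_intros)
qed

lemma sigma_cont_interval: "{a..b} \<subseteq> {0..1} \<Longrightarrow> continuous_on {a..b} (sigma l)"
  unfolding sigma_def[abs_def] using Q_cont W_cont
  by (intro continuous_intros) (auto intro: continuous_on_subset)

lemma integral_w_pos:
  assumes "0 \<le> u" "u < v" "v \<le> 1"
  shows "integral {u..v} w > 0"
proof -
  have wa: "w absolutely_integrable_on {u..v}"
    using w assms by (auto intro: absolutely_integrable_on_subinterval)
  define g where "g x = indicator {u..v} x * w x" for x
  have g: "integrable lebesgue g"
    using wa unfolding set_integrable_def g_def[abs_def] by simp
  have "integral {u..v} w = integral\<^sup>L lebesgue g"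
    using set_lebesgue_integral_eq_integral(2)[OF wa]
    by (simp add: set_lebesgue_integral_def g_def[abs_def])
  moreover have g0: "AE x in lebesgue. 0 \<le> g x"
    using w_pos by (auto simp: g_def less_imp_le)
  moreover have "integral\<^sup>L lebesgue g \<noteq> 0"
  proof
    assume "integral\<^sup>L lebesgue g = 0"
    then have "AE x in lebesgue. g x = 0"
      using integral_nonneg_eq_0_iff_AE[OF g g0] by simp
    then have "AE x in lebesgue. x \<notin> {u..v}"
      by eventually_elim (use w_pos in \<open>auto simp: g_def indicator_def less_le split: if_splits\<close>)
    then have "emeasure lebesgue {u..v} = 0"
      by (subst (asm) AE_iff_measurable[of "{u..v}"]) auto
    then show False using assms by simp
  qed
  moreover have "integral\<^sup>L lebesgue g \<ge> 0" using g0 by (rule integral_nonneg_AE)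
  ultimately show ?thesis by linarith
qed

lemma w_times_integrable:
  assumes "{a..b} \<subseteq> {0..1}" "continuous_on {a..b} g"
  shows "(\<lambda>x. w x * g x) integrable_on {a..b}"
proof -
  have "w absolutely_integrable_on {a..b}"
    using w assms(1) by (rule absolutely_integrable_on_subinterval)
  moreover have "g \<in> borel_measurable (lebesgue_on {a..b})" "bounded (g ` {a..b})"
    using assms(2) by (auto intro!: continuous_imp_measurable_on_sets_lebesgue
        compact_imp_bounded compact_continuous_image)
  ultimately have "(\<lambda>x. g x * w x) absolutely_integrable_on {a..b}"
    by (intro absolutely_integrable_bounded_measurable_product_real) auto
  then show ?thesis by (simp add: absolutely_integrable_on_def mult.commute)
qed

lemma integral_w_times_pos:
  assumes ab: "{a..b} \<subseteq> {0..1}" and "continuous_on {a..b} g" and g0: "\<And>x. x \<in> {a..b} \<Longrightarrow> g x \<ge> 0"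
    and gp: "\<And>x. x \<in> {a<..<b} \<Longrightarrow> g x > 0" and "a < b"
  shows "integral {a..b} (\<lambda>x. w x * g x) > 0"
proof -
  define u v where "u = (2 * a + b) / 3" and "v = (a + 2 * b) / 3"
  have uv: "a < u" "u < v" "v < b" using \<open>a < b\<close> by (auto simp: u_def v_def)
  have sub: "{u..v} \<subseteq> {a..b}" "{u..v} \<subseteq> {0..1}" using uv ab by auto
  have "continuous_on {u..v} g" using assms(2) sub(1) by (rule continuous_on_subset)
  then obtain x0 where x0: "x0 \<in> {u..v}" "\<And>x. x \<in> {u..v} \<Longrightarrow> g x0 \<le> g x"
    using continuous_attains_inf[of "{u..v}" g] uv by auto
  have int: "(\<lambda>x. w x * g x) integrable_on {a..b}" "(\<lambda>x. w x * g x) integrable_on {u..v}"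
    using w_times_integrable assms(2) ab sub \<open>continuous_on {u..v} g\<close> by blast+
  have wi: "w integrable_on {u..v}" using w_integrable sub(2) by (rule integrable_on_subinterval)
  have "0 < g x0 * integral {u..v} w"
    using x0 gp[of x0] uv sub by (intro mult_pos_pos integral_w_pos) auto
  also have "\<dots> = integral {u..v} (\<lambda>x. w x * g x0)" by (simp add: mult.commute)
  also have "\<dots> \<le> integral {u..v} (\<lambda>x. w x * g x)"
    using wi int(2) x0(2) w_pos
    by (intro integral_le integrable_on_mult_left) (auto simp: mult_left_mono less_imp_le)
  also have "\<dots> \<le> integral {a..b} (\<lambda>x. w x * g x)"
    using int sub(1) g0 w_pos by (intro integral_subset_le) (auto simp: less_imp_le)
  finally show ?thesis .
qed

text \<open>
  For solutions with parameters \<open>l\<close> and \<open>m\<close> the classical Wronskian \<open>u v' - v u'\<close> has derivative \<open>(l - m) w u v\<close>. In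
  terms of the quasi-derivatives \<open>u' - \<sigma>\<^sub>l u\<close> and \<open>v' - \<sigma>\<^sub>m v\<close> it reads \<open>u v2 - v u2 + (l - m) W u v\<close>,
  since \<open>\<sigma>\<^sub>m - \<sigma>\<^sub>l = (l - m) W\<close>.
\<close>
lemma sturm_identity:
  assumes u: "quasi_system (sigma l) {a..b} u u2" and v: "quasi_system (sigma m) {a..b} v v2"
    and ab: "0 \<le> a" "a \<le> b" "b \<le> 1"
  defines "wr \<equiv> \<lambda>x. u x * v2 x - v x * u2 x + (l - m) * W x * u x * v x"
  shows "((\<lambda>x. (l - m) * (w x * (u x * v x))) has_integral wr b - wr a) {a..b}"
proof -
  have sub: "{a..b} \<subseteq> {0..1}" using ab by auto
  define g' where "g' x = (sigma l x * u x + u2 x) * v x + u x * (sigma m x * v x + v2 x)" for x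
  note cont = quasi_system_continuous_on[OF u] quasi_system_continuous_on[OF v]
    sigma_cont_interval[OF sub] continuous_on_subset[OF W_cont sub]
  have "((\<lambda>x. w x * (u x * v x) + W x * g' x) has_integral W b * (u b * v b) - W a * (u a * v a)) {a..b}"
  proof (rule integration_by_parts_abs_cont[OF w ab, where c = 0])
    fix x assume x: "x \<in> {a..b}"
    show "((\<lambda>x. u x * v x) has_real_derivative g' x) (at x within {a..b})"
      using DERIV_mult[OF quasi_systemD(1)[OF u x] quasi_systemD(1)[OF v x]]
      by (simp add: g'_def algebra_simps)
  qed (auto simp: W_def g'_def[abs_def] intro!: continuous_intros cont)
  from has_integral_mult_right[OF this, of "l - m"]
  have 1: "((\<lambda>x. (l - m) * (w x * (u x * v x) + W x * g' x)) has_integral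
      (l - m) * (W b * (u b * v b) - W a * (u a * v a))) {a..b}" .
  have 2: "((\<lambda>x. (m - l) * W x * g' x) has_integral
      (u b * v2 b - v b * u2 b) - (u a * v2 a - v a * u2 a)) {a..b}"
  proof (rule fundamental_theorem_of_calculus[OF ab(2)])
    fix x assume x: "x \<in> {a..b}"
    note [derivative_intros] = quasi_systemD[OF u x] quasi_systemD[OF v x]
    have "((\<lambda>x. u x * v2 x - v x * u2 x) has_real_derivative (sigma l x - sigma m x) * g' x) (at x within {a..b})"
      by (auto intro!: derivative_eq_intros simp: g'_def algebra_simps power2_eq_square)
    moreover have "sigma l x - sigma m x = (m - l) * W x" by (simp add: sigma_def algebra_simps)
    ultimately show "((\<lambda>x. u x * v2 x - v x * u2 x) has_vector_derivative (m - l) * W x * g' x) (at x within {a..b})"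
      by (simp add: has_real_derivative_iff_has_vector_derivative)
  qed
  show ?thesis
    by (rule has_integral_eq_rhs[OF has_integral_eq[OF _ has_integral_add[OF 1 2]]])
      (simp_all add: wr_def algebra_simps)
qed

text \<open>
  For a positive solution \<open>y\<close> the quotient \<open>v = z / y\<close> satisfies the Riccati equation \<open>v' = - (\<sigma> + v)\<^sup>2\<close>.
  Integrating \<open>(f\<^sup>2 v)'\<close> for a test function \<open>f\<close> that vanishes at both endpoints and completing the square gives
  \<open>0 \<le> \<integral> (f'\<^sup>2 - 2 f f' \<sigma>)\<close>. By parts this is \<open>l \<integral> w f\<^sup>2 \<le> \<integral> (f'\<^sup>2 - 2 f f' Q)\<close>, which bounds \<open>l\<close>
  independently of the solution.
\<close>
lemma oscillation:
  assumes ab: "0 \<le> a" "a < b" "b \<le> 1"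
  obtains L where "\<And>l y z. quasi_system (sigma l) {a..b} y z \<Longrightarrow> (\<And>x. x \<in> {a..b} \<Longrightarrow> y x > 0) \<Longrightarrow> l \<le> L"
proof -
  have sub: "{a..b} \<subseteq> {0..1}" using ab by auto
  define f where "f x = (x - a) * (b - x)" for x
  define f' where "f' x = a + b - 2 * x" for x
  have f: "(f has_real_derivative f' x) (at x within S)" for x S
    unfolding f_def f'_def by (auto intro!: derivative_eq_intros)
  have fc: "continuous_on S f" "continuous_on S f'" for S
    unfolding f_def f'_def by (intro continuous_intros)+
  note WQ = continuous_on_subset[OF W_cont sub] continuous_on_subset[OF Q_cont sub]
  define k where "k = integral {a..b} (\<lambda>x. w x * (f x)\<^sup>2)"
  define E where "E = integral {a..b} (\<lambda>x. (f' x)\<^sup>2 - 2 * f x * f' x * Q x)"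
  have k: "k > 0" unfolding k_def
    by (rule integral_w_times_pos[OF sub]) (auto intro!: continuous_intros fc ab simp: f_def)
  have "((\<lambda>x. w x * (f x)\<^sup>2 + W x * (2 * f x * f' x)) has_integral W b * (f b)\<^sup>2 - W a * (f a)\<^sup>2) {a..b}"
  proof (rule integration_by_parts_abs_cont[OF w ab(1) less_imp_le[OF ab(2)] ab(3), where c = 0])
    show "((\<lambda>x. (f x)\<^sup>2) has_real_derivative 2 * f x * f' x) (at x within {a..b})" for x
      by (auto intro!: derivative_eq_intros f)
  qed (auto simp: W_def intro!: continuous_intros fc)
  then have i0: "((\<lambda>x. w x * (f x)\<^sup>2 + W x * (2 * f x * f' x)) has_integral 0) {a..b}"
    by (simp add: f_def)
  have "(\<lambda>x. w x * (f x)\<^sup>2) integrable_on {a..b}"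
    by (rule w_times_integrable[OF sub]) (intro continuous_intros fc)
  from has_integral_diff[OF i0 integrable_integral[OF this]]
  have iW: "((\<lambda>x. W x * (2 * f x * f' x)) has_integral - k) {a..b}"
    by (simp add: k_def)
  have "l \<le> E / k" if yz: "quasi_system (sigma l) {a..b} y z" and pos: "\<And>x. x \<in> {a..b} \<Longrightarrow> y x > 0" for l y z
  proof -
    define v where "v x = z x / y x" for x
    have "((\<lambda>x. 2 * f x * f' x * v x - (f x)\<^sup>2 * (sigma l x + v x)\<^sup>2) has_integral
        (f b)\<^sup>2 * v b - (f a)\<^sup>2 * v a) {a..b}"
    proof (rule fundamental_theorem_of_calculus)
      fix x assume x: "x \<in> {a..b}"
      note D [derivative_intros] = quasi_systemD[OF yz x] f
      have "y x \<noteq> 0" using pos[OF x] by simp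
      then have "(v has_real_derivative - (sigma l x + v x)\<^sup>2) (at x within {a..b})"
        unfolding v_def
        by (auto intro!: derivative_eq_intros simp: field_simps power2_eq_square)
      note [derivative_intros] = this
      have "((\<lambda>x. (f x)\<^sup>2 * v x) has_real_derivative 2 * f x * f' x * v x - (f x)\<^sup>2 * (sigma l x + v x)\<^sup>2) (at x within {a..b})"
        by (auto intro!: derivative_eq_intros simp: algebra_simps)
      then show "((\<lambda>x. (f x)\<^sup>2 * v x) has_vector_derivative 2 * f x * f' x * v x - (f x)\<^sup>2 * (sigma l x + v x)\<^sup>2) (at x within {a..b})"
        by (simp add: has_real_derivative_iff_has_vector_derivative)
    qed (use ab in simp)
    then have 1: "((\<lambda>x. 2 * f x * f' x * v x - (f x)\<^sup>2 * (sigma l x + v x)\<^sup>2) has_integral 0) {a..b}"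
      by (simp add: f_def)
    have "(\<lambda>x. (f' x)\<^sup>2 - 2 * f x * f' x * Q x) integrable_on {a..b}"
      by (intro integrable_continuous_real continuous_intros fc WQ)
    then have "((\<lambda>x. (f' x)\<^sup>2 - 2 * f x * f' x * Q x) has_integral E) {a..b}"
      unfolding E_def by (rule integrable_integral)
    from has_integral_add[OF this has_integral_mult_right[OF iW, of l]]
    have 2: "((\<lambda>x. (f' x)\<^sup>2 - 2 * f x * f' x * Q x + l * (W x * (2 * f x * f' x))) has_integral E + l * - k) {a..b}" .
    have "0 \<le> E + l * - k"
    proof (rule has_integral_le[OF 1 2])
      fix x
      have "0 \<le> (f' x - f x * (sigma l x + v x))\<^sup>2" by simp
      then show "2 * f x * f' x * v x - (f x)\<^sup>2 * (sigma l x + v x)\<^sup>2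
          \<le> (f' x)\<^sup>2 - 2 * f x * f' x * Q x + l * (W x * (2 * f x * f' x))"
        by (simp add: power2_eq_square algebra_simps sigma_def)
    qed
    then show ?thesis using k by (simp add: field_simps)
  qed
  then show thesis using that by blast
qed

section \<open>Positivity for very negative eigenparameters\<close>

text \<open>
  The amount by which the potential \<open>q - l w\<close> falls short of the constant \<open>K\<close>. After adding it the potential is
  bounded below by \<open>K\<close>.
\<close>
definition defect :: "real \<Rightarrow> real \<Rightarrow> real \<Rightarrow> real" where
  "defect K l x = max 0 (K + l * w x - q x)"

lemma defect_abs_integrable: "defect K l absolutely_integrable_on {0..1}"
proof -
  have "(\<lambda>x. K + l * w x - q x) absolutely_integrable_on {0..1}"
    using q w by (intro set_integral_diff set_integral_add absolutely_integrable_scaleR_left) auto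
  then have "(\<lambda>x. max 0 (K + l * w x - q x)) absolutely_integrable_on {0..1}"
    by (intro absolutely_integrable_max_1) auto
  then show ?thesis by (simp add: defect_def[abs_def])
qed

lemma defect_integrable: "defect K l integrable_on {0..1}"
  using defect_abs_integrable by (simp add: absolutely_integrable_on_def)

text \<open>
  As \<open>l \<rightarrow> - \<infinity>\<close> the potential \<open>q - l w\<close> tends to infinity pointwise because \<open>w > 0\<close>, so the defect tends to zero;
  it is dominated by \<open>\<bar>K\<bar> + \<bar>q\<bar>\<close>.
\<close>
lemma defect_small:
  obtains M where "\<And>l. l \<le> M \<Longrightarrow> integral {0..1} (defect K l) \<le> 1"
proof -
  have "(\<lambda>n. integral {0..1} (defect K (- real n))) \<longlonglongrightarrow> integral {0..1} (\<lambda>x :: real. 0)"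
  proof (rule dominated_convergence(2)[where f = "\<lambda>n. defect K (- real n)" and h = "\<lambda>x. \<bar>K\<bar> + \<bar>q x\<bar>"])
    show "defect K (- real n) integrable_on {0..1}" for n by (rule defect_integrable)
  next
    show "(\<lambda>x. \<bar>K\<bar> + \<bar>q x\<bar>) integrable_on {0..1}"
      using absolutely_integrable_norm[OF q]
      by (intro integrable_add) (auto simp: absolutely_integrable_on_def o_def)
  next
    fix n x
    have "real n * w x \<ge> 0" using w_pos[of x] by simp
    then show "norm (defect K (- real n) x) \<le> \<bar>K\<bar> + \<bar>q x\<bar>"
      unfolding defect_def by (auto simp: max_def abs_if)
  next
    fix x
    have "\<forall>\<^sub>F n in sequentially. defect K (- real n) x = 0"
      using eventually_ge_at_top[of "nat \<lceil>(K - q x) / w x\<rceil>"]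
    proof eventually_elim
      case (elim n)
      then have "(K - q x) / w x \<le> real n" by linarith
      then have "K - q x \<le> real n * w x" using w_pos[of x] by (simp add: field_simps)
      then show ?case by (simp add: defect_def)
    qed
    then show "(\<lambda>n. defect K (- real n) x) \<longlonglongrightarrow> 0" by (rule tendsto_eventually)
  qed
  then have "\<forall>\<^sub>F n in sequentially. integral {0..1} (defect K (- real n)) < 1"
    by (rule order_tendstoD) simp
  then obtain n where n: "integral {0..1} (defect K (- real n)) < 1"
    using eventually_happens by fastforce
  show thesis
  proof (rule that[of "- real n"])
    fix l assume "l \<le> - real n"
    have "integral {0..1} (defect K l) \<le> integral {0..1} (defect K (- real n))"
    proof (intro integral_le defect_integrable)
      fix x
      have "l * w x \<le> - real n * w x"
        using \<open>l \<le> - real n\<close> w_pos[of x] by (intro mult_right_mono) auto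
      then show "defect K l x \<le> defect K (- real n) x" by (simp add: defect_def max_def)
    qed
    with n show "integral {0..1} (defect K l) \<le> 1" by simp
  qed
qed

lemma integral_defect_bounds:
  assumes "x \<in> {0..1}"
  shows "0 \<le> integral {0..x} (defect K l)" "integral {0..x} (defect K l) \<le> integral {0..1} (defect K l)"
proof -
  have i: "defect K l integrable_on {0..x}"
    using defect_integrable by (rule integrable_on_subinterval) (use assms in auto)
  show "0 \<le> integral {0..x} (defect K l)"
    by (rule integral_nonneg[OF i]) (simp add: defect_def)
  show "integral {0..x} (defect K l) \<le> integral {0..1} (defect K l)"
    using assms by (intro integral_subset_le i defect_integrable) (auto simp: defect_def)
qed

text \<open>
  Let \<open>h > 0\<close> with \<open>h' = - \<nu> h\<close>, where \<open>\<nu>\<close> is an antiderivative of the defect. Then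
  \<open>h'' = (\<nu>\<^sup>2 - defect) h \<le> (K - defect) h \<le> (q - l w) h\<close>, that is, \<open>h\<close> is a supersolution, and hence the Wronskian \<open>h y' - h' y\<close> increases as long as
  \<open>y \<ge> 0\<close>. It equals \<open>h (z + (\<sigma> + \<nu>) y)\<close>; the conclusion is that it stays positive.
  The constant \<open>c\<close> allows \<open>\<nu>\<close> to jump where a delta term makes \<open>z\<close> jump.
\<close>
lemma supersolution_step:
  fixes K c l
  defines "nu \<equiv> \<lambda>x. integral {0..x} (defect K l) + c"
  assumes yz: "quasi_system (sigma l) {a..b} y z" and ab: "0 \<le> a" "a \<le> b" "b \<le> 1"
    and y: "\<And>x. x \<in> {a..b} \<Longrightarrow> y x \<ge> 0"
    and nu: "\<And>x. x \<in> {a..b} \<Longrightarrow> (nu x)\<^sup>2 \<le> K"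
    and pos: "z a + (sigma l a + nu a) * y a > 0"
  shows "z b + (sigma l b + nu b) * y b > 0"
proof -
  have sub: "{a..b} \<subseteq> {0..1}" using ab by auto
  define p where "p x = q x - l * w x + defect K l x" for x
  have p: "p absolutely_integrable_on {0..1}"
    unfolding p_def[abs_def] using q w defect_abs_integrable
    by (intro set_integral_diff set_integral_add absolutely_integrable_scaleR_left) auto
  define tau where "tau x = sigma l x + nu x" for x
  have tau: "tau x = c + integral {0..x} p" if "x \<in> {a..b}" for x
  proof -
    have "{0..x} \<subseteq> {0..1}" using that ab by auto
    then have "q integrable_on {0..x}" "w integrable_on {0..x}" "defect K l integrable_on {0..x}"
      using integrable_on_subinterval q_integrable w_integrable defect_integrable by blast+
    then have "integral {0..x} p = integral {0..x} q - l * integral {0..x} w + integral {0..x} (defect K l)"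
      unfolding p_def[abs_def]
      by (simp add: integral_add integral_diff integrable_diff integrable_on_mult_right)
    then show ?thesis by (simp add: tau_def sigma_def Q_def W_def nu_def)
  qed
  have nuc: "continuous_on {a..b} nu"
    unfolding nu_def
    by (intro continuous_intros continuous_on_subset[OF indefinite_integral_continuous_1[OF defect_integrable] sub])
  define h where "h x = exp (- integral {a..x} nu)" for x
  have h: "(h has_real_derivative - nu x * h x) (at x within {a..b})" if "x \<in> {a..b}" for x
    unfolding h_def using integral_has_real_derivative[OF nuc that]
    by (auto intro!: derivative_eq_intros)
  have hpos: "h x > 0" for x by (simp add: h_def)
  have hc: "continuous_on {a..b} h" using DERIV_continuous_on[OF h] .
  note cont = quasi_system_continuous_on[OF yz] sigma_cont_interval[OF sub] nuc hc
  define g' where "g' x = - nu x * h x * y x + h x * (sigma l x * y x + z x)" for x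
  have 1: "((\<lambda>x. p x * (h x * y x) + tau x * g' x) has_integral tau b * (h b * y b) - tau a * (h a * y a)) {a..b}"
  proof (rule integration_by_parts_abs_cont[OF p ab tau])
    fix x assume x: "x \<in> {a..b}"
    show "((\<lambda>x. h x * y x) has_real_derivative g' x) (at x within {a..b})"
      using DERIV_mult[OF h[OF x] quasi_systemD(1)[OF yz x]] by (simp add: g'_def algebra_simps)
  qed (auto simp: g'_def[abs_def] intro!: continuous_intros cont)
  have 2: "((\<lambda>x. - nu x * h x * z x + h x * (- (sigma l x)\<^sup>2 * y x - sigma l x * z x)) has_integral h b * z b - h a * z a) {a..b}"
  proof (rule fundamental_theorem_of_calculus[OF ab(2)])
    fix x assume x: "x \<in> {a..b}"
    show "((\<lambda>x. h x * z x) has_vector_derivative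
        - nu x * h x * z x + h x * (- (sigma l x)\<^sup>2 * y x - sigma l x * z x)) (at x within {a..b})"
      using DERIV_mult[OF h[OF x] quasi_systemD(2)[OF yz x]]
      by (simp add: algebra_simps has_real_derivative_iff_has_vector_derivative[symmetric])
  qed
  have "0 \<le> (tau b * (h b * y b) - tau a * (h a * y a)) + (h b * z b - h a * z a)"
  proof (rule has_integral_nonneg[OF has_integral_add[OF 1 2]])
    fix x assume x: "x \<in> {a..b}"
    have "p x \<ge> K" by (simp add: p_def defect_def max_def)
    then have "p x - (nu x)\<^sup>2 \<ge> 0" using nu[OF x] by simp
    then have "0 \<le> (p x - (nu x)\<^sup>2) * (h x * y x)" using hpos[of x] y[OF x] by simp
    also have "\<dots> = p x * (h x * y x) + tau x * g' x
        + (- nu x * h x * z x + h x * (- (sigma l x)\<^sup>2 * y x - sigma l x * z x))"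
      by (simp add: tau_def g'_def power2_eq_square algebra_simps)
    finally show "0 \<le> p x * (h x * y x) + tau x * g' x
        + (- nu x * h x * z x + h x * (- (sigma l x)\<^sup>2 * y x - sigma l x * z x))" .
  qed
  then have "h a * (z a + tau a * y a) \<le> h b * (z b + tau b * y b)" by (simp add: algebra_simps)
  moreover have "0 < h a * (z a + tau a * y a)"
    using pos hpos[of a] by (simp add: tau_def)
  ultimately have "0 < h b * (z b + tau b * y b)" by linarith
  then show ?thesis using hpos[of b] by (simp add: tau_def zero_less_mult_iff)
qed

end

section \<open>Shooting across the delta\<close>

lemma has_real_derivative_within_left_nonpos:
  fixes f :: "real \<Rightarrow> real"
  assumes "(f has_real_derivative D) (at b within {a..b})" "a < b"
    and "\<And>x. x \<in> {a..b} \<Longrightarrow> f b \<le> f x"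
  shows "D \<le> 0"
proof (rule ccontr)
  assume "\<not> D \<le> 0"
  then obtain d where d: "d > 0" "\<And>h. 0 < h \<Longrightarrow> b - h \<in> {a..b} \<Longrightarrow> h < d \<Longrightarrow> f (b - h) < f b"
    using has_real_derivative_pos_inc_left[OF assms(1)] by auto
  define h where "h = min (d / 2) (b - a)"
  have "0 < h" "h < d" "b - h \<in> {a..b}" using d(1) assms(2) by (auto simp: h_def min_def)
  then show False using d(2)[of h] assms(3)[of "b - h"] by auto
qed

lemma has_real_derivative_within_right_nonneg:
  fixes f :: "real \<Rightarrow> real"
  assumes "(f has_real_derivative D) (at a within {a..b})" "a < b"
    and "\<And>x. x \<in> {a..b} \<Longrightarrow> f a \<le> f x"
  shows "D \<ge> 0"
proof (rule ccontr)
  assume "\<not> D \<ge> 0"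
  then obtain d where d: "d > 0" "\<And>h. 0 < h \<Longrightarrow> a + h \<in> {a..b} \<Longrightarrow> h < d \<Longrightarrow> f (a + h) < f a"
    using has_real_derivative_neg_dec_right[OF assms(1)] by auto
  define h where "h = min (d / 2) (b - a)"
  have "0 < h" "h < d" "a + h \<in> {a..b}" using d(1) assms(2) by (auto simp: h_def min_def)
  then show False using d(2)[of h] assms(3)[of "a + h"] by auto
qed

locale fundamental_solutions = sturm_liouville +
  fixes phi phi_z theta theta_z :: "real \<Rightarrow> real \<Rightarrow> real"
  assumes init: "\<And>l. phi l 0 = 0" "\<And>l. phi_z l 0 = 1" "\<And>l. theta l 0 = 1" "\<And>l. theta_z l 0 = 0"
    and phi: "\<And>l. quasi_system (sigma l) {0..1} (phi l) (phi_z l)"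
    and theta: "\<And>l. quasi_system (sigma l) {0..1} (theta l) (theta_z l)"
    and cont: "continuous_on (UNIV \<times> {0..1}) (\<lambda>(l, x). phi l x)"
      "continuous_on (UNIV \<times> {0..1}) (\<lambda>(l, x). phi_z l x)"
      "continuous_on (UNIV \<times> {0..1}) (\<lambda>(l, x). theta l x)"
begin

lemma wronskian: "x \<in> {0..1} \<Longrightarrow> theta l x * phi_z l x - theta_z l x * phi l x = 1"
  using quasi_system_wronskian_constant[OF theta phi convex_real_interval(5), of x 0 l] init by simp

text \<open>
  The continuation of \<open>\<phi>\<close> to the right of \<open>t\<close>: the combination of \<open>\<phi>\<close> and \<open>\<theta>\<close> whose value at \<open>t\<close> is \<open>\<phi>(t)\<close> and whose
  quasi-derivative at \<open>t\<close> is smaller than that of \<open>\<phi>\<close> by \<open>r \<phi>(t)\<close>, as the delta term demands.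
\<close>
definition right_sol :: "real \<Rightarrow> real \<Rightarrow> real \<Rightarrow> real \<Rightarrow> real" where
  "right_sol l t r x = (1 - r * phi l t * theta l t) * phi l x + r * (phi l t)\<^sup>2 * theta l x"

definition right_z :: "real \<Rightarrow> real \<Rightarrow> real \<Rightarrow> real \<Rightarrow> real" where
  "right_z l t r x = (1 - r * phi l t * theta l t) * phi_z l x + r * (phi l t)\<^sup>2 * theta_z l x"

definition shoot :: "real \<Rightarrow> real \<Rightarrow> real \<Rightarrow> real \<Rightarrow> real" where
  "shoot l t r x = (if x \<le> t then phi l x else right_sol l t r x)"

lemma right_sol_system: "quasi_system (sigma l) {0..1} (right_sol l t r) (right_z l t r)"
  unfolding right_sol_def[abs_def] right_z_def[abs_def] by (rule quasi_system_lincomb[OF phi theta])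

lemma right_sol_at: "right_sol l t r t = phi l t"
  by (simp add: right_sol_def power2_eq_square algebra_simps)

lemma right_z_at: "t \<in> {0..1} \<Longrightarrow> right_z l t r t = phi_z l t - r * phi l t"
proof -
  assume t: "t \<in> {0..1}"
  have "right_z l t r t = phi_z l t - r * phi l t * (theta l t * phi_z l t - theta_z l t * phi l t)"
    by (simp add: right_z_def power2_eq_square algebra_simps)
  then show ?thesis by (simp add: wronskian[OF t])
qed

lemma shoot_left: "x \<le> t \<Longrightarrow> shoot l t r x = phi l x"
  by (simp add: shoot_def)

lemma shoot_right: "t \<le> x \<Longrightarrow> shoot l t r x = right_sol l t r x"
  using right_sol_at by (auto simp: shoot_def)

lemma shoot_zero: "0 \<le> t \<Longrightarrow> shoot l t r 0 = 0"
  by (simp add: shoot_left init)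

text \<open>
  At \<open>t = 0\<close> the jump \<open>r \<phi>(t)\<close> vanishes, and at \<open>t = 1\<close> nothing is left to its right, so the convention for
  endpoint values of \<open>t\<close> is built into the formula.
\<close>
lemma shoot_trivial:
  assumes "t = 0 \<or> t = 1 \<or> r = 0" "x \<le> 1"
  shows "shoot l t r x = phi l x"
  using assms by (auto simp: shoot_def right_sol_def init)

text \<open>
  The case distinction \<open>x \<le> t\<close> is harmless because the correction by which \<open>right_sol\<close> differs from \<open>\<phi>\<close> vanishes at \<open>t\<close>; it can therefore
  be evaluated at \<open>max x t\<close> for every \<open>x\<close>.
\<close>
lemma shoot_continuous:
  "continuous_on (UNIV \<times> {0..1} \<times> UNIV \<times> {0..1}) (\<lambda>(l, t, r, x). shoot l t r x)"
proof -
  let ?S = "UNIV \<times> {0..1} \<times> UNIV \<times> {0..1} :: (real \<times> real \<times> real \<times> real) set"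
  have c: "continuous_on ?S (\<lambda>p. f (fst p) (g p))"
    if "continuous_on (UNIV \<times> {0..1}) (\<lambda>(l, x). f l x)" "continuous_on ?S g" "g ` ?S \<subseteq> {0..1}" for f :: "real \<Rightarrow> real \<Rightarrow> real" and g
  proof -
    have "continuous_on ?S (\<lambda>p. (\<lambda>(l, x). f l x) (fst p, g p))"
      by (rule continuous_on_compose2[OF that(1)])
        (use that(2,3) in \<open>auto intro!: continuous_intros\<close>)
    then show ?thesis by simp
  qed
  define t where "t p = fst (snd p)" for p :: "real \<times> real \<times> real \<times> real"
  define m where "m p = max (snd (snd (snd p))) (t p)" for p :: "real \<times> real \<times> real \<times> real"
  have tm: "continuous_on ?S t" "t ` ?S \<subseteq> {0..1}" "continuous_on ?S m" "m ` ?S \<subseteq> {0..1}"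
    "continuous_on ?S (\<lambda>p. snd (snd (snd p)))" "(\<lambda>p. snd (snd (snd p))) ` ?S \<subseteq> {0..1}"
    unfolding m_def t_def by (auto intro!: continuous_intros)
  have "continuous_on ?S (\<lambda>p. phi (fst p) (snd (snd (snd p)))
      - fst (snd (snd p)) * phi (fst p) (t p) * (theta (fst p) (t p) * phi (fst p) (m p) - phi (fst p) (t p) * theta (fst p) (m p)))"
    by (intro continuous_intros c[OF cont(1)] c[OF cont(3)] tm)
  moreover have "shoot l t r x = phi l x - r * phi l t * (theta l t * phi l (max x t) - phi l t * theta l (max x t))" for l t r x
    by (auto simp: shoot_def right_sol_def max_def power2_eq_square algebra_simps)
  ultimately show ?thesis by (simp add: case_prod_unfold m_def t_def)
qed

lemma shoot_continuous_on: 
  assumes "t \<in> {0..1}" 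
  shows "continuous_on {0..1} (shoot l t r)"
proof -
  have "continuous_on {0..1} (\<lambda>x. (\<lambda>(l, t, r, x). shoot l t r x) (l, t, r, x))"
    by (rule continuous_on_compose2[OF shoot_continuous]) (use assms in \<open>auto intro!: continuous_intros\<close>)
  then show ?thesis by simp
qed

text \<open>
  At \<open>t\<close> itself this is the value from the left. Arguments at a zero \<open>b\<close> of \<open>shoot\<close> only look to the left of \<open>b\<close>.
\<close>
definition shoot_z :: "real \<Rightarrow> real \<Rightarrow> real \<Rightarrow> real \<Rightarrow> real" where
  "shoot_z l t r x = (if x \<le> t then phi_z l x else right_z l t r x)"

lemma shoot_left_system:
  assumes "t \<in> {0..1}" "b \<in> {0<..1}"
  obtains a where "a \<in> {0..<b}" "quasi_system (sigma l) {a..b} (shoot l t r) (shoot_z l t r)"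
proof (cases "b \<le> t")
  case True
  have "quasi_system (sigma l) {0..b} (phi l) (phi_z l)"
    using phi by (rule quasi_system_subset) (use assms in auto)
  then have "quasi_system (sigma l) {0..b} (shoot l t r) (shoot_z l t r)"
    by (rule quasi_system_cong) (use True in \<open>auto simp: shoot_def shoot_z_def\<close>)
  then show thesis using assms by (intro that[of 0]) auto
next
  case False
  define a where "a = (t + b) / 2"
  have a: "t < a" "a < b" using False by (auto simp: a_def)
  have "quasi_system (sigma l) {a..b} (right_sol l t r) (right_z l t r)"
    using right_sol_system by (rule quasi_system_subset) (use assms a in auto)
  then have "quasi_system (sigma l) {a..b} (shoot l t r) (shoot_z l t r)"
    by (rule quasi_system_cong) (use a in \<open>auto simp: shoot_def shoot_z_def\<close>)
  then show thesis using assms a by (intro that[of a]) auto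
qed

lemma shoot_z_nonpos_at_zero:
  assumes t: "t \<in> {0..1}" and b: "b \<in> {0<..1}" and "shoot l t r b = 0"
    and nn: "\<And>x. x \<in> {0..b} \<Longrightarrow> shoot l t r x \<ge> 0"
  shows "shoot_z l t r b \<le> 0"
proof -
  obtain a where a: "a \<in> {0..<b}" "quasi_system (sigma l) {a..b} (shoot l t r) (shoot_z l t r)"
    using shoot_left_system[OF t b] by blast
  have "(shoot l t r has_real_derivative sigma l b * shoot l t r b + shoot_z l t r b) (at b within {a..b})"
    using quasi_systemD(1)[OF a(2), of b] a(1) by auto
  from has_real_derivative_within_left_nonpos[OF this] show ?thesis
    using a(1) assms(3) nn by auto
qed

text \<open>
  At an interior zero a nonnegative solution has left derivative \<open>\<le> 0\<close> and right derivative \<open>\<ge> 0\<close>. Its value is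
  zero there, so there is no jump even at \<open>t\<close>, and both Cauchy data vanish. This contradicts the
  Wronskian being 1.
\<close>
lemma shoot_positive_inside:
  assumes t: "t \<in> {0..1}" and b: "b \<le> 1" and nn: "\<And>x. x \<in> {0..b} \<Longrightarrow> shoot l t r x \<ge> 0"
    and x: "0 < x" "x < b"
  shows "shoot l t r x > 0"
proof (rule ccontr)
  assume "\<not> shoot l t r x > 0"
  then have ux: "shoot l t r x = 0" using nn[of x] x by auto
  have shoot_z: "shoot_z l t r x \<le> 0"
    by (rule shoot_z_nonpos_at_zero[OF t _ ux]) (use x b nn in auto)
  have x1: "x \<in> {0..1}" using x b by auto
  show False
  proof (cases "x < t")
    case True
    have D: "(phi l has_real_derivative sigma l x * phi l x + phi_z l x) (at x within {x..min t b})"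
      using quasi_systemD(1)[OF phi x1] by (rule has_field_derivative_subset) (use x t in auto)
    have "0 \<le> sigma l x * phi l x + phi_z l x"
    proof (rule has_real_derivative_within_right_nonneg[OF D])
      show "x < min t b" using True x by simp
      fix s assume "s \<in> {x..min t b}"
      then show "phi l x \<le> phi l s"
        using True ux nn[of s] x shoot_left[of s t l r] shoot_left[of x t l r] by auto
    qed
    moreover have "phi l x = 0" "phi_z l x \<le> 0" using ux shoot_z True by (auto simp: shoot_def shoot_z_def)
    ultimately show False using wronskian[OF x1, of l] by simp
  next
    case False
    have D: "(right_sol l t r has_real_derivative sigma l x * right_sol l t r x + right_z l t r x) (at x within {x..b})"
      using quasi_systemD(1)[OF right_sol_system x1] by (rule has_field_derivative_subset) (use x b in auto)
    have right_z0: "0 \<le> sigma l x * right_sol l t r x + right_z l t r x"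
    proof (rule has_real_derivative_within_right_nonneg[OF D x(2)])
      fix s assume "s \<in> {x..b}"
      then show "right_sol l t r x \<le> right_sol l t r s"
        using False ux nn[of s] x shoot_right[of t s l r] shoot_right[of t x l r] by auto
    qed
    have right0: "right_sol l t r x = 0" using ux False by (simp add: shoot_right)
    have right_z1: "right_z l t r x \<le> 0"
    proof (cases "x = t")
      case True
      then show ?thesis using shoot_z right0 right_sol_at[of l t r] right_z_at[OF t, of l r] by (simp add: shoot_z_def)
    qed (use shoot_z False in \<open>simp add: shoot_z_def\<close>)
    have right_z: "right_z l t r x = 0" using right_z0 right_z1 right0 by simp
    \<comment> \<open>A solution with vanishing Cauchy data is trivial, so both coefficients of \<open>right_sol\<close> vanish.\<close>
    have "r * (phi l t)\<^sup>2 * (theta l x * phi_z l x - theta_z l x * phi l x) = right_sol l t r x * phi_z l x - right_z l t r x * phi l x"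
      by (simp add: right_sol_def right_z_def algebra_simps)
    then have be: "r * (phi l t)\<^sup>2 = 0" using wronskian[OF x1, of l] right0 right_z by simp
    have "(1 - r * phi l t * theta l t) * (theta l x * phi_z l x - theta_z l x * phi l x) = right_z l t r x * theta l x - right_sol l t r x * theta_z l x"
      by (simp add: right_sol_def right_z_def algebra_simps)
    then have "1 - r * phi l t * theta l t = 0" using wronskian[OF x1, of l] right0 right_z by simp
    with be show False by auto
  qed
qed

text \<open>
  The slope at the origin is 1 for every parameter, and the derivative \<open>\<sigma> \<phi> + \<phi>_z\<close> is jointly continuous, so
  one neighbourhood of the origin serves all nearby parameters.
\<close>
lemma shoot_positive_near_zero:
  assumes t: "t \<in> {0..1}"
  obtains d e where "0 < d" "d \<le> 1" "0 < e"
    "\<And>l' x. \<bar>l' - l\<bar> < e \<Longrightarrow> 0 < x \<Longrightarrow> x \<le> d \<Longrightarrow> shoot l' t r x > 0"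
proof -
  define c where "c = (if t = 0 then 1 else t)"
  have c: "0 < c" "c \<le> 1" using t by (auto simp: c_def)
  have shoot_phi: "shoot l' t r x = phi l' x" if "x \<le> c" for l' x
    using that t shoot_trivial[of t r x l'] by (auto simp: c_def shoot_left split: if_splits)
  define D where "D = (\<lambda>(l, x). sigma l x * phi l x + phi_z l x)"
  have Dc: "continuous_on (UNIV \<times> {0..1}) D"
    using sigma_cont cont unfolding D_def case_prod_unfold by (intro continuous_intros)
  have "D (l, 0) = 1" by (simp add: D_def init)
  then obtain d where d: "d > 0" "\<And>p. p \<in> UNIV \<times> {0..1} \<Longrightarrow> dist p (l, 0) < d \<Longrightarrow> dist (D p) 1 < 1"
    using Dc unfolding continuous_on_iff by (metis SigmaI UNIV_I atLeastAtMost_iff order_refl zero_less_one zero_le_one)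
  show thesis
  proof (rule that[of "min c (d / 4)" "d / 2"])
    fix l' x assume l': "\<bar>l' - l\<bar> < d / 2" and x: "0 < x" "x \<le> min c (d / 4)"
    have Dp: "D (l', s) > 0" if s: "s \<in> {0..x}" for s
    proof -
      have "dist (l', s) (l, 0) \<le> \<bar>l' - l\<bar> + \<bar>s\<bar>"
        by (simp add: dist_Pair_Pair dist_real_def sqrt_sum_squares_le_sum_abs)
      also have "\<dots> < d" using l' s x d(1) by auto
      finally have "dist (D (l', s)) 1 < 1" using s x c by (intro d(2)) auto
      then show ?thesis by (simp add: dist_real_def abs_if split: if_splits)
    qed
    have "\<exists>s\<in>{0<..<x}. phi l' x - phi l' 0 = D (l', s) * (x - 0)"
    proof (rule mvt_simple[OF x(1)])
      fix s assume "0 \<le> s" "s \<le> x"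
      then have "(phi l' has_real_derivative D (l', s)) (at s within {0..x})"
        using quasi_systemD(1)[OF phi, of s l'] x c
        by (auto simp: D_def intro: has_field_derivative_subset)
      then show "(phi l' has_derivative (*) (D (l', s))) (at s within {0..x})"
        by (simp add: has_field_derivative_def)
    qed
    then obtain s where "s \<in> {0<..<x}" "phi l' x = D (l', s) * x" by (auto simp: init)
    then have "phi l' x > 0" using Dp[of s] x(1) by simp
    then show "shoot l' t r x > 0" using shoot_phi x(2) by simp
  qed (use c d(1) in auto)
qed

lemma shoot_first_zero:
  assumes t: "t \<in> {0..1}" and x0: "0 < x0" "x0 \<le> 1" "shoot l t r x0 \<le> 0"
  obtains b where "0 < b" "b \<le> x0" "shoot l t r b = 0" "\<And>x. x \<in> {0..b} \<Longrightarrow> shoot l t r x \<ge> 0"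
proof -
  obtain d where d: "0 < d" "d \<le> 1" "\<And>x. 0 < x \<Longrightarrow> x \<le> d \<Longrightarrow> shoot l t r x > 0"
    using shoot_positive_near_zero[OF t, of l r] by (metis abs_zero diff_self)
  have shoot_c: "continuous_on {d..x0} (shoot l t r)"
    using shoot_continuous_on[OF t] by (rule continuous_on_subset) (use d x0 in auto)
  have "d < x0" using d(3)[of x0] x0 by force
  define Z where "Z = {x \<in> {d..x0}. shoot l t r x \<le> 0}"
  have "closed Z"
    using continuous_closed_preimage[OF shoot_c, of "{..0}"] by (simp add: Z_def vimage_def Int_def)
  then have "compact Z" unfolding Z_def by (auto simp: compact_eq_bounded_closed intro: bounded_subset[of "{d..x0}"])
  moreover have "x0 \<in> Z" using x0 \<open>d < x0\<close> by (auto simp: Z_def)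
  ultimately obtain b where b: "b \<in> Z" "\<And>x. x \<in> Z \<Longrightarrow> b \<le> x"
    using compact_attains_inf[of Z] by blast
  have bd: "d < b" "b \<le> x0" "shoot l t r b \<le> 0"
    using b(1) d(1) d(3)[of d] by (auto simp: Z_def less_le)
  have before: "shoot l t r x > 0" if "0 < x" "x < b" for x
    using that b(2)[of x] d(3)[of x] bd by (force simp: Z_def)
  have "continuous_on {d..b} (shoot l t r)" using shoot_c by (rule continuous_on_subset) (use bd in auto)
  then obtain c where c: "d \<le> c" "c \<le> b" "shoot l t r c = 0"
    using IVT2'[of "shoot l t r" b 0 d] bd d(3)[of d] d(1) by auto
  then have "c = b" using b(2)[of c] bd by (auto simp: Z_def)
  then have "shoot l t r x \<ge> 0" if "x \<in> {0..b}" for x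
    using that before[of x] c(3) shoot_zero[of t l r] t by (cases "x = 0 \<or> x = b") auto
  then show thesis using that[of b] c(3) \<open>c = b\<close> bd d(1) by auto
qed

lemma wronskian_increasing:
  assumes y: "quasi_system (sigma l) {a..b} y y2" and v: "quasi_system (sigma m) {a..b} v v2"
    and ab: "0 \<le> a" "a < b" "b \<le> 1" and "m < l"
    and nn: "\<And>x. x \<in> {a..b} \<Longrightarrow> y x \<ge> 0" "\<And>x. x \<in> {a..b} \<Longrightarrow> v x \<ge> 0"
    and pos: "\<And>x. x \<in> {a<..<b} \<Longrightarrow> y x > 0" "\<And>x. x \<in> {a<..<b} \<Longrightarrow> v x > 0"
  shows "y a * v2 a - v a * y2 a + (l - m) * W a * y a * v a
    < y b * v2 b - v b * y2 b + (l - m) * W b * y b * v b"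
proof -
  have sub: "{a..b} \<subseteq> {0..1}" using ab by auto
  have i: "integral {a..b} (\<lambda>x. w x * (y x * v x)) > 0"
    by (rule integral_w_times_pos[OF sub])
      (use ab nn pos quasi_system_continuous_on[OF y] quasi_system_continuous_on[OF v] in \<open>auto intro!: continuous_intros\<close>)
  have "integral {a..b} (\<lambda>x. (l - m) * (w x * (y x * v x)))
      = (y b * v2 b - v b * y2 b + (l - m) * W b * y b * v b) - (y a * v2 a - v a * y2 a + (l - m) * W a * y a * v a)"
    by (rule integral_unique[OF sturm_identity[OF y v]]) (use ab in auto)
  moreover have "integral {a..b} (\<lambda>x. (l - m) * (w x * (y x * v x))) > 0"
    using i \<open>m < l\<close> by simp
  ultimately show ?thesis by linarith
qed

section \<open>The first eigenparameter\<close>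

text \<open>
  The Wronskian of the two solutions vanishes at 0. By Sturm's identity it increases strictly on the
  pieces to the left and to the right of \<open>t\<close>, and it is continuous at \<open>t\<close> since both solutions satisfy
  the same jump condition. So it is positive at \<open>b\<close>; but there it equals \<open>shoot l b \<cdot> shoot_z m b \<le> 0\<close>.
\<close>
lemma sturm_comparison:
  assumes t: "t \<in> {0..1}" and b: "b \<in> {0<..1}" and "m < l"
    and nn: "\<And>x. x \<in> {0..b} \<Longrightarrow> shoot l t r x \<ge> 0" "\<And>x. x \<in> {0..b} \<Longrightarrow> shoot m t r x \<ge> 0"
    and ub: "shoot m t r b = 0"
  shows False
proof -
  have b1: "b \<le> 1" "0 < b" using b by auto
  have pos: "shoot l t r x > 0" "shoot m t r x > 0" if "x \<in> {0<..<b}" for x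
    using shoot_positive_inside[OF t b1(1) nn(1)] shoot_positive_inside[OF t b1(1) nn(2)] that by auto
  have shoot_z: "shoot_z m t r b \<le> 0" using shoot_z_nonpos_at_zero[OF t b ub nn(2)] .
  have left: "0 < phi l c * phi_z m c - phi m c * phi_z l c + (l - m) * W c * phi l c * phi m c"
    if c: "0 < c" "c \<le> b" "c \<le> t" for c
  proof -
    have sub: "{0..c} \<subseteq> {0..1}" using c b1 by auto
    have "phi l 0 * phi_z m 0 - phi m 0 * phi_z l 0 + (l - m) * W 0 * phi l 0 * phi m 0
      < phi l c * phi_z m c - phi m c * phi_z l c + (l - m) * W c * phi l c * phi m c"
    proof (rule wronskian_increasing[OF quasi_system_subset[OF phi sub] quasi_system_subset[OF phi sub]])
      fix x assume "x \<in> {0..c}"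
      then show "phi l x \<ge> 0" "phi m x \<ge> 0" using nn[of x] c by (auto simp: shoot_left)
    next
      fix x assume "x \<in> {0<..<c}"
      then show "phi l x > 0" "phi m x > 0" using pos[of x] c by (auto simp: shoot_left)
    qed (use c b1 \<open>m < l\<close> in auto)
    then show ?thesis by (simp add: init)
  qed
  show False
  proof (cases "b \<le> t")
    case True
    have "0 < phi l b * phi_z m b"
      using left[OF b1(2) order_refl True] ub True by (simp add: shoot_left)
    moreover have "phi l b \<ge> 0" "phi_z m b \<le> 0" using nn(1)[of b] b1 shoot_z True by (auto simp: shoot_left shoot_z_def)
    ultimately show False by (metis mult_nonneg_nonpos not_less)
  next
    case False
    have sub: "{t..b} \<subseteq> {0..1}" using t b1 by auto
    have "right_sol l t r t * right_z m t r t - right_sol m t r t * right_z l t r t + (l - m) * W t * right_sol l t r t * right_sol m t r t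
      < right_sol l t r b * right_z m t r b - right_sol m t r b * right_z l t r b + (l - m) * W b * right_sol l t r b * right_sol m t r b"
    proof (rule wronskian_increasing[OF quasi_system_subset[OF right_sol_system sub] quasi_system_subset[OF right_sol_system sub]])
      fix x assume "x \<in> {t..b}"
      then show "right_sol l t r x \<ge> 0" "right_sol m t r x \<ge> 0" using nn[of x] t by (auto simp: shoot_right)
    next
      fix x assume "x \<in> {t<..<b}"
      then show "right_sol l t r x > 0" "right_sol m t r x > 0" using pos[of x] t by (auto simp: shoot_right)
    qed (use t b1 False \<open>m < l\<close> in auto)
    moreover have "0 \<le> right_sol l t r t * right_z m t r t - right_sol m t r t * right_z l t r t + (l - m) * W t * right_sol l t r t * right_sol m t r t"
    proof (cases "t = 0")
      case True
      then show ?thesis by (simp add: right_sol_at init)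
    next
      case False
      then have "0 < phi l t * phi_z m t - phi m t * phi_z l t + (l - m) * W t * phi l t * phi m t"
        using left[of t] t \<open>\<not> b \<le> t\<close> by auto
      then show ?thesis by (simp add: right_sol_at right_z_at[OF t] algebra_simps)
    qed
    moreover have "right_sol m t r b = 0" using ub False by (simp add: shoot_right)
    ultimately have "0 < right_sol l t r b * right_z m t r b" by simp
    moreover have "right_sol l t r b \<ge> 0" "right_z m t r b \<le> 0" using nn(1)[of b] b1 shoot_z False by (auto simp: shoot_right shoot_z_def)
    ultimately show False by (metis mult_nonneg_nonpos not_less)
  qed
qed

text \<open>
  The supersolution has logarithmic derivative \<open>- \<nu>\<close>, where \<open>\<nu>\<close> starts at 0, jumps by \<open>r\<close> at \<open>t\<close> and otherwise grows by
  at most 1 in total. Hence \<open>\<nu>\<^sup>2 \<le> (1 + R)\<^sup>2\<close>, which explains the choice of \<open>K\<close>. At the first zero \<open>b\<close> of the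
  solution the Wronskian with the supersolution would be positive, although at a zero it is a
  positive multiple of the left derivative, which is nonpositive.
\<close>
lemma shoot_positive_for_small_eigenparameter:
  assumes "R \<ge> 0"
  obtains M where "\<And>l t r x. l \<le> M \<Longrightarrow> t \<in> {0..1} \<Longrightarrow> 0 \<le> r \<Longrightarrow> r \<le> R \<Longrightarrow> 0 < x \<Longrightarrow> x \<le> 1 \<Longrightarrow> shoot l t r x > 0"
proof -
  define K where "K = (1 + R)\<^sup>2"
  obtain M where M: "\<And>l. l \<le> M \<Longrightarrow> integral {0..1} (defect K l) \<le> 1"
    using defect_small by blast
  show thesis
  proof (rule that[of M], rule ccontr)
    fix l t r x assume l: "l \<le> M" and t: "t \<in> {0..1}" and r: "0 \<le> r" "r \<le> R" and x: "0 < x" "x \<le> 1"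
      and "\<not> shoot l t r x > 0"
    then obtain b where b: "0 < b" "b \<le> x" "shoot l t r b = 0" "\<And>x. x \<in> {0..b} \<Longrightarrow> shoot l t r x \<ge> 0"
      using shoot_first_zero[OF t x, of l r] by auto
    have b1: "b \<le> 1" using b x by simp
    have shoot_z: "shoot_z l t r b \<le> 0" by (rule shoot_z_nonpos_at_zero[OF t _ b(3,4)]) (use b b1 in auto)
    have nu: "(integral {0..x} (defect K l) + c)\<^sup>2 \<le> K" if "x \<in> {0..1}" "0 \<le> c" "c \<le> R" for x c
    proof -
      have "(integral {0..x} (defect K l) + c)\<^sup>2 \<le> (1 + R)\<^sup>2"
        using integral_defect_bounds[OF that(1), of K l] M[OF l] that by (intro power_mono) auto
      then show ?thesis by (simp only: K_def)
    qed
    have left: "phi_z l c + (sigma l c + (integral {0..c} (defect K l) + 0)) * phi l c > 0"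
      if c: "0 \<le> c" "c \<le> b" "c \<le> t" for c
    proof (rule supersolution_step[where a = 0])
      show "quasi_system (sigma l) {0..c} (phi l) (phi_z l)"
        using phi by (rule quasi_system_subset) (use c b1 in auto)
      fix x assume x: "x \<in> {0..c}"
      show "phi l x \<ge> 0" using b(4)[of x] x c by (simp add: shoot_left)
      show "(integral {0..x} (defect K l) + 0)\<^sup>2 \<le> K" by (rule nu) (use x c b1 \<open>R \<ge> 0\<close> in auto)
    qed (use c b1 in \<open>auto simp: init\<close>)
    show False
    proof (cases "b \<le> t")
      case True
      then show False using left[of b] b(1,3) shoot_z by (auto simp: shoot_left shoot_z_def)
    next
      case False
      have "right_z l t r b + (sigma l b + (integral {0..b} (defect K l) + r)) * right_sol l t r b > 0"
      proof (rule supersolution_step[where a = t])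
        show "quasi_system (sigma l) {t..b} (right_sol l t r) (right_z l t r)"
          using right_sol_system by (rule quasi_system_subset) (use t b1 in auto)
        show "0 < right_z l t r t + (sigma l t + (integral {0..t} (defect K l) + r)) * right_sol l t r t"
          using left[of t] t False by (simp add: right_sol_at right_z_at algebra_simps)
        fix x assume x: "x \<in> {t..b}"
        show "right_sol l t r x \<ge> 0" using b(4)[of x] x t by (simp add: shoot_right)
        show "(integral {0..x} (defect K l) + r)\<^sup>2 \<le> K" by (rule nu) (use x t b1 r in auto)
      qed (use t b1 False in auto)
      then show False using False b(1,3) shoot_z by (auto simp: shoot_right shoot_z_def)
    qed
  qed
qed

lemma first_eigenparameter_le:
  assumes t: "t \<in> {0..1}" and nn: "\<And>x. x \<in> {0..1} \<Longrightarrow> shoot l t r x \<ge> 0" and um: "shoot m t r 1 = 0"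
  shows "l \<le> m"
proof (rule ccontr)
  assume "\<not> l \<le> m"
  obtain b where b: "0 < b" "b \<le> 1" "shoot m t r b = 0" "\<And>x. x \<in> {0..b} \<Longrightarrow> shoot m t r x \<ge> 0"
    using shoot_first_zero[OF t, of 1 m r] um by auto
  show False
    by (rule sturm_comparison[OF t _ _ _ b(4) b(3), of l]) (use b nn \<open>\<not> l \<le> m\<close> in auto)
qed

text \<open>
  The wanted parameter is the maximum of the set \<open>N\<close> of parameters with nonnegative solution. If the
  solution for the maximum \<open>l\<close> did not vanish at 1, it would be positive on \<open>(0,1]\<close>; near the origin positivity persists for
  nearby parameters by \<open>shoot_positive_near_zero\<close>, on the remaining compact interval by uniform continuity.
\<close>
lemma first_eigenparameter_exists:
  assumes t: "t \<in> {0..1}" and r: "r \<ge> 0"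
  obtains l where "\<And>x. x \<in> {0..1} \<Longrightarrow> shoot l t r x \<ge> 0" "shoot l t r 1 = 0"
proof -
  define N where "N = {l. \<forall>x\<in>{0..1}. shoot l t r x \<ge> 0}"
  have shoot_c: "continuous_on UNIV (\<lambda>l. shoot l t r x)" if "x \<in> {0..1}" for x
  proof -
    have "continuous_on UNIV (\<lambda>l. (\<lambda>(l, t, r, x). shoot l t r x) (l, t, r, x))"
      by (rule continuous_on_compose2[OF shoot_continuous]) (use t that in \<open>auto intro!: continuous_intros\<close>)
    then show ?thesis by simp
  qed
  have "N = (\<Inter>x\<in>{0..1}. {l. 0 \<le> shoot l t r x})" by (auto simp: N_def)
  also have "closed \<dots>"
    using shoot_c by (intro closed_INT ballI closed_Collect_le continuous_on_const) auto
  finally have clN: "closed N" .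
  obtain M where "\<And>l t r' x. l \<le> M \<Longrightarrow> t \<in> {0..1} \<Longrightarrow> 0 \<le> r' \<Longrightarrow> r' \<le> r \<Longrightarrow> 0 < x \<Longrightarrow> x \<le> 1 \<Longrightarrow> shoot l t r' x > 0"
    using shoot_positive_for_small_eigenparameter[OF r] by blast
  then have "shoot M t r x \<ge> 0" if "x \<in> {0..1}" for x
    using that t r shoot_zero[of t M r] by (cases "x = 0") (auto intro: less_imp_le)
  then have "M \<in> N" by (simp add: N_def)
  \<comment> \<open>On \<open>[0,c]\<close> the solution is \<open>\<phi>\<close>, so the oscillation lemma applies on its middle third.\<close>
  define c where "c = (if t = 0 then 1 else t)"
  have c: "0 < c" "c \<le> 1" using t by (auto simp: c_def)
  obtain L where L: "\<And>l y z. quasi_system (sigma l) {c/3..2*c/3} y z \<Longrightarrow> (\<And>x. x \<in> {c/3..2*c/3} \<Longrightarrow> y x > 0) \<Longrightarrow> l \<le> L"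
    using oscillation[of "c/3" "2*c/3"] c by auto
  have NL: "l \<le> L" if "l \<in> N" for l
  proof (rule L)
    show "quasi_system (sigma l) {c/3..2*c/3} (phi l) (phi_z l)"
      using phi by (rule quasi_system_subset) (use c in auto)
    fix x assume x: "x \<in> {c/3..2*c/3}"
    then have "shoot l t r x > 0"
      using \<open>l \<in> N\<close> c by (intro shoot_positive_inside[OF t order_refl]) (auto simp: N_def)
    moreover have "shoot l t r x = phi l x"
      using x c shoot_trivial[of t r x l] by (auto simp: c_def shoot_left split: if_splits)
    ultimately show "phi l x > 0" by simp
  qed
  define l where "l = Sup N"
  have "bdd_above N" using NL by (rule bdd_aboveI)
  then have lN: "l \<in> N" and up: "\<And>l'. l' \<in> N \<Longrightarrow> l' \<le> l"
    unfolding l_def using closed_contains_Sup[OF _ _ clN] \<open>M \<in> N\<close> cSup_upper by blast+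
  have nn: "shoot l t r x \<ge> 0" if "x \<in> {0..1}" for x using lN that by (auto simp: N_def)
  have "shoot l t r 1 = 0"
  proof (rule ccontr)
    assume "shoot l t r 1 \<noteq> 0"
    then have pos: "shoot l t r x > 0" if "0 < x" "x \<le> 1" for x
      using shoot_positive_inside[OF t order_refl nn, of x] nn[of 1] that by (cases "x = 1") auto
    obtain d e where de: "0 < d" "d \<le> 1" "0 < e"
      "\<And>l' x. \<bar>l' - l\<bar> < e \<Longrightarrow> 0 < x \<Longrightarrow> x \<le> d \<Longrightarrow> shoot l' t r x > 0"
      using shoot_positive_near_zero[OF t] by blast
    have "continuous_on {d..1} (shoot l t r)"
      using shoot_continuous_on[OF t] by (rule continuous_on_subset) (use de in auto)
    then obtain x0 where x0: "x0 \<in> {d..1}" "\<And>x. x \<in> {d..1} \<Longrightarrow> shoot l t r x0 \<le> shoot l t r x"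
      using continuous_attains_inf[of "{d..1}" "shoot l t r"] de(2) by auto
    define mu where "mu = shoot l t r x0"
    have mu: "mu > 0" using pos[of x0] x0 de by (auto simp: mu_def)
    have "continuous_on ({l..l+1} \<times> {d..1}) (\<lambda>p. (\<lambda>(l, t, r, x). shoot l t r x) (fst p, t, r, snd p))"
      by (rule continuous_on_compose2[OF shoot_continuous]) (use t de in \<open>auto intro!: continuous_intros\<close>)
    then have "uniformly_continuous_on ({l..l+1} \<times> {d..1}) (\<lambda>p. shoot (fst p) t r (snd p))"
      by (intro compact_uniformly_continuous compact_Times) auto
    from this[unfolded uniformly_continuous_on_def, THEN spec, THEN mp, OF mu]
    obtain eta where eta0: "eta > 0" and eta': "\<forall>p\<in>{l..l+1} \<times> {d..1}. \<forall>p'\<in>{l..l+1} \<times> {d..1}.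
        dist p' p < eta \<longrightarrow> dist (shoot (fst p') t r (snd p')) (shoot (fst p) t r (snd p)) < mu"
      by blast
    have eta: "eta > 0" "\<And>p p'. p \<in> {l..l+1} \<times> {d..1} \<Longrightarrow> p' \<in> {l..l+1} \<times> {d..1} \<Longrightarrow>
        dist p' p < eta \<Longrightarrow> dist (shoot (fst p') t r (snd p')) (shoot (fst p) t r (snd p)) < mu"
      using eta0 eta' by blast+
    define l' where "l' = l + Min {1, eta / 2, e / 2}"
    have l': "l < l'" "l' \<le> l + 1" "l' - l < eta" "l' - l < e"
      using eta(1) de(3) by (auto simp: l'_def)
    have "shoot l' t r x \<ge> 0" if x: "x \<in> {0..1}" for x
    proof -
      consider "x = 0" | "0 < x" "x \<le> d" | "x \<in> {d..1}" using x by force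
      then show ?thesis
      proof cases
        case 1
        then show ?thesis using shoot_zero t by simp
      next
        case 2
        then show ?thesis using de(4)[of l' x] l' by simp
      next
        case 3
        have "dist (shoot l' t r x) (shoot l t r x) < mu"
          using eta(2)[of "(l, x)" "(l', x)"] 3 l' by (simp add: dist_Pair_Pair dist_real_def)
        moreover have "mu \<le> shoot l t r x" using x0(2)[OF 3] by (simp add: mu_def)
        ultimately show ?thesis by (simp add: dist_real_def)
      qed
    qed
    then have "l' \<in> N" by (simp add: N_def)
    then show False using up[of l'] l'(1) by simp
  qed
  with nn show thesis using that by blast
qed

end

section \<open>Classical solutions and solutions of the system\<close>

lemma continuous_on_eq_closed_interval:
  fixes f g :: "real \<Rightarrow> real"
  assumes "continuous_on {a..b} f" "continuous_on {a..b} g" "a < b"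
    and "\<And>x. x \<in> {a<..<b} \<Longrightarrow> f x = g x" and "x \<in> {a..b}"
  shows "f x = g x"
proof -
  have "closed {x \<in> {a..b}. f x - g x = 0}"
    using assms by (intro continuous_closed_preimage_constant continuous_intros) auto
  then have "closure {a<..<b} \<subseteq> {x \<in> {a..b}. f x - g x = 0}"
    using assms(4) by (intro closure_minimal) auto
  then show ?thesis using assms(3,5) by auto
qed

context sturm_liouville
begin

lemma sigma_abs_cont: "{a..b} \<subseteq> {0..1} \<Longrightarrow> abs_cont_on (sigma l) {a..b}"
  unfolding sigma_def[abs_def] Q_def[abs_def] W_def[abs_def]
  by (rule abs_cont_on_subset[of _ "{0..1}"])
    (intro abs_cont_on_diff abs_cont_on_cmult abs_cont_on_indefinite_integral q w)

lemma sigma_derivative_ae: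
  obtains N where "negligible N"
    "\<And>x l. x \<in> {0<..<1} - N \<Longrightarrow> (sigma l has_real_derivative q x - l * w x) (at x)"
proof -
  obtain N1 where N1: "negligible N1" "\<And>x. x \<in> {0<..<1} - N1 \<Longrightarrow> (Q has_real_derivative q x) (at x)"
    unfolding Q_def[abs_def] using integral_has_real_derivative_ae[OF q_integrable] by blast
  obtain N2 where N2: "negligible N2" "\<And>x. x \<in> {0<..<1} - N2 \<Longrightarrow> (W has_real_derivative w x) (at x)"
    unfolding W_def[abs_def] using integral_has_real_derivative_ae[OF w_integrable] by blast
  show thesis
  proof (rule that[of "N1 \<union> N2"])
    show "negligible (N1 \<union> N2)" using N1 N2 by simp
    show "(sigma l has_real_derivative q x - l * w x) (at x)" if "x \<in> {0<..<1} - (N1 \<union> N2)" for x l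
      unfolding sigma_def[abs_def] using N1(2)[of x] N2(2)[of x] that
      by (intro DERIV_diff DERIV_cmult) auto
  qed
qed

lemma quasi_system_deriv:
  assumes yz: "quasi_system (sigma l) {a..b} y z" and x: "x \<in> {a<..<b}"
  shows "(y has_real_derivative sigma l x * y x + z x) (at x)" "deriv y x = sigma l x * y x + z x"
proof -
  have "at x within {a..b} = at x" using x by (intro at_within_interior) auto
  then show "(y has_real_derivative sigma l x * y x + z x) (at x)"
    using quasi_systemD(1)[OF yz, of x] x by auto
  then show "deriv y x = sigma l x * y x + z x" by (rule DERIV_imp_deriv)
qed

lemma quasi_system_differentiable_on:
  "quasi_system (sigma l) {a..b} y z \<Longrightarrow> y differentiable_on {a<..<b}"
  unfolding differentiable_on_def
  by (meson differentiable_at_withinI quasi_system_deriv(1) real_differentiable_def)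

lemma quasi_system_abs_cont:
  assumes yz: "quasi_system (sigma l) {a..b} y z" and sub: "{a..b} \<subseteq> {0..1}"
  shows "abs_cont_on y {a..b}" "abs_cont_on z {a..b}" "abs_cont_on (deriv y) {a<..<b}"
proof -
  note c = quasi_system_continuous_on[OF yz] sigma_cont_interval[OF sub]
  show y: "abs_cont_on y {a..b}"
    by (rule abs_cont_on_C1[OF quasi_systemD(1)[OF yz]]) (auto intro!: continuous_intros c)
  show z: "abs_cont_on z {a..b}"
    by (rule abs_cont_on_C1[OF quasi_systemD(2)[OF yz]]) (auto intro!: continuous_intros c)
  have "abs_cont_on (\<lambda>x. sigma l x * y x + z x) {a<..<b}"
    by (rule abs_cont_on_subset[OF abs_cont_on_add[OF abs_cont_on_mult[OF sigma_abs_cont[OF sub] y] z]]) auto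
  then show "abs_cont_on (deriv y) {a<..<b}"
    by (simp only: abs_cont_on_cong[of "{a<..<b}" "deriv y" "\<lambda>x. sigma l x * y x + z x",
          OF quasi_system_deriv(2)[OF yz]])
qed

lemma quasi_system_deriv_limits:
  assumes yz: "quasi_system (sigma l) {a..b} y z" and sub: "{a..b} \<subseteq> {0..1}" and ab: "a < b"
  shows "(deriv y \<longlongrightarrow> sigma l b * y b + z b) (at_left b)" "(deriv y \<longlongrightarrow> sigma l a * y a + z a) (at_right a)"
proof -
  define g where "g x = sigma l x * y x + z x" for x
  have "continuous_on {a..b} g"
    unfolding g_def by (intro continuous_intros quasi_system_continuous_on[OF yz] sigma_cont_interval[OF sub])
  then have "(g \<longlongrightarrow> g b) (at b within {a..b})" "(g \<longlongrightarrow> g a) (at a within {a..b})"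
    using ab by (auto simp: continuous_on_def)
  then have lim: "(g \<longlongrightarrow> g b) (at_left b)" "(g \<longlongrightarrow> g a) (at_right a)"
    using ab by (simp_all add: at_within_Icc_at_left at_within_Icc_at_right)
  have eq: "g x = deriv y x" if "x \<in> {a<..<b}" for x
    using quasi_system_deriv(2)[OF yz that] by (simp add: g_def)
  have "\<forall>\<^sub>F x in at_left b. g x = deriv y x" "\<forall>\<^sub>F x in at_right a. g x = deriv y x"
    using eventually_at_left_real[OF ab] eventually_at_right_real[OF ab]
    by (auto elim!: eventually_mono simp: eq)
  with lim show "(deriv y \<longlongrightarrow> sigma l b * y b + z b) (at_left b)" "(deriv y \<longlongrightarrow> sigma l a * y a + z a) (at_right a)"
    unfolding g_def[symmetric] by (auto intro: Lim_transform_eventually)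
qed

lemma quasi_system_satisfies_ae:
  assumes yz: "quasi_system (sigma l) {a..b} y z" and sub: "{a..b} \<subseteq> {0..1}"
  obtains N where "negligible N"
    "\<And>x. x \<in> {a<..<b} - N \<Longrightarrow> (deriv y has_real_derivative (q x - l * w x) * y x) (at x)"
proof -
  obtain N where N: "negligible N"
    "\<And>x l. x \<in> {0<..<1} - N \<Longrightarrow> (sigma l has_real_derivative q x - l * w x) (at x)"
    using sigma_derivative_ae by blast
  show thesis
  proof (rule that[OF N(1)])
    fix x assume x: "x \<in> {a<..<b} - N"
    then have x1: "x \<in> {a<..<b}" by simp
    have x0: "x \<in> {0<..<1}" using x1 sub
      by (metis greaterThanLessThan_subseteq_atLeastAtMost_iff greaterThanLessThan_iff interior_atLeastAtMost_real interior_mono subsetD)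
    have aw: "at x within {a..b} = at x" using x by (intro at_within_interior) auto
    have D: "(sigma l has_real_derivative q x - l * w x) (at x)" using N(2) x x0 by blast
    have yd: "(y has_real_derivative sigma l x * y x + z x) (at x)"
      and zd: "(z has_real_derivative - (sigma l x)\<^sup>2 * y x - sigma l x * z x) (at x)"
      using quasi_systemD[OF yz, of x] x1 aw by auto
    have "((\<lambda>x. sigma l x * y x + z x) has_real_derivative (q x - l * w x) * y x) (at x)"
      using DERIV_add[OF DERIV_mult[OF D yd] zd] by (simp add: algebra_simps power2_eq_square)
    then show "(deriv y has_real_derivative (q x - l * w x) * y x) (at x)"
      by (rule has_field_derivative_transform_within_open[OF _ open_greaterThanLessThan x1])
        (simp add: quasi_system_deriv(2)[OF yz])
  qed
qed

lemma satisfies_eq_aeI: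
  assumes "negligible N"
    and "\<And>x. x \<in> {0<..<1} - N \<Longrightarrow> (deriv y has_real_derivative (q x - l * w x) * y x) (at x)"
  shows "satisfies_eq_ae q w l y"
proof -
  have "AE x in lebesgue. x \<notin> N"
    using assms(1) by (simp add: negligible_iff_null_sets AE_not_in)
  then show ?thesis
    unfolding satisfies_eq_ae_def
  proof eventually_elim
    case (elim x)
    show ?case
    proof
      assume "x \<in> {0<..<1}"
      with elim have "(deriv y has_real_derivative (q x - l * w x) * y x) (at x)" using assms(2) by blast
      moreover have "- ((q x - l * w x) * y x) + q x * y x = l * w x * y x" by (simp add: algebra_simps)
      ultimately show "\<exists>d. (deriv y has_real_derivative d) (at x) \<and> - d + q x * y x = l * w x * y x" by blast
    qed
  qed
qed

lemma satisfies_eq_aeE: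
  assumes "satisfies_eq_ae q w l y"
  obtains N where "negligible N"
    "\<And>x. x \<in> {0<..<1} - N \<Longrightarrow> (deriv y has_real_derivative (q x - l * w x) * y x) (at x)"
proof -
  obtain N where N: "N \<in> null_sets lebesgue"
    "{x \<in> space lebesgue. \<not> (x \<in> {0<..<1} \<longrightarrow> (\<exists>d. (deriv y has_real_derivative d) (at x) \<and> - d + q x * y x = l * w x * y x))} \<subseteq> N"
    using assms unfolding satisfies_eq_ae_def eventually_ae_filter by blast
  show thesis
  proof (rule that[of N])
    show "negligible N" using N(1) by (simp add: negligible_iff_null_sets)
    fix x assume "x \<in> {0<..<1} - N"
    then obtain d where d: "(deriv y has_real_derivative d) (at x)" "- d + q x * y x = l * w x * y x"
      using N(2) by auto
    then have "d = (q x - l * w x) * y x" by (simp add: algebra_simps)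
    with d(1) show "(deriv y has_real_derivative (q x - l * w x) * y x) (at x)" by simp
  qed
qed

text \<open>
  For a classical solution \<open>y\<close> the function \<open>deriv y - \<sigma> y\<close> is only known to be absolutely continuous, and the
  system holds only almost everywhere. The Wronskian with a solution of the system is then absolutely
  continuous with derivative zero almost everywhere, and hence constant.
\<close>
lemma classical_wronskian_constant:
  assumes ab: "{a<..<b} \<subseteq> {0..1}" and ac: "abs_cont_on y {0..1}" and diff: "y differentiable_on {a<..<b}"
    and acd: "abs_cont_on (deriv y) {a<..<b}" and sat: "satisfies_eq_ae q w l y"
    and p: "quasi_system (sigma l) {0..1} p p2"
  defines "wr \<equiv> \<lambda>x. y x * p2 x - (deriv y x - sigma l x * y x) * p x"
  assumes cd: "c \<in> {a<..<b}" "d \<in> {a<..<b}"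
  shows "wr c = wr d"
proof -
  obtain N1 where N1: "negligible N1"
    "\<And>x. x \<in> {0<..<1} - N1 \<Longrightarrow> (deriv y has_real_derivative (q x - l * w x) * y x) (at x)"
    using satisfies_eq_aeE[OF sat] by blast
  obtain N2 where N2: "negligible N2"
    "\<And>x l. x \<in> {0<..<1} - N2 \<Longrightarrow> (sigma l has_real_derivative q x - l * w x) (at x)"
    using sigma_derivative_ae by blast
  have "wr c = wr d" if cd: "a < c" "c \<le> d" "d < b" for c d
  proof -
    have sub1: "{c..d} \<subseteq> {a<..<b}" using cd by auto
    then have sub: "{c..d} \<subseteq> {a<..<b}" "{c..d} \<subseteq> {0..1}" using ab by blast+
    have cd01: "0 \<le> c" "d \<le> 1" using sub(2) cd(2) by auto
    have p': "quasi_system (sigma l) {c..d} p p2" using p sub(2) by (rule quasi_system_subset)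
    have ac': "abs_cont_on y {c..d}" "abs_cont_on (deriv y) {c..d}"
      using abs_cont_on_subset ac acd sub by blast+
    have "abs_cont_on wr {c..d}"
      unfolding wr_def
      by (intro abs_cont_on_diff abs_cont_on_mult ac' sigma_abs_cont sub(2) quasi_system_abs_cont[OF p' sub(2)])
    then have "((\<lambda>x. 0) has_integral wr d - wr c) {c..d}"
    proof (rule fundamental_theorem_of_calculus_abs_cont[OF cd(2)])
      show "negligible (N1 \<union> N2 \<union> {c, d})" using N1 N2 by (intro negligible_Un) auto
      fix x assume x: "x \<in> {c..d} - (N1 \<union> N2 \<union> {c, d})"
      then have x1: "x \<in> {c<..<d}" "x \<in> {c..d}" and xab: "x \<in> {a<..<b}" using sub by auto
      have x0: "x \<in> {0<..<1}" using x1(1) cd01 by auto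
      have "y differentiable at x"
        using diff xab by (metis at_within_open differentiable_on_def open_greaterThanLessThan)
      then have yd: "(y has_real_derivative deriv y x) (at x within {c..d})"
        by (metis DERIV_deriv_iff_real_differentiable has_field_derivative_at_within)
      have ydd: "(deriv y has_real_derivative (q x - l * w x) * y x) (at x within {c..d})"
        using N1(2) x x0 by (blast intro: has_field_derivative_at_within)
      have sd: "(sigma l has_real_derivative q x - l * w x) (at x within {c..d})"
        using N2(2) x x0 by (blast intro: has_field_derivative_at_within)
      note [derivative_intros] = yd ydd sd quasi_systemD[OF p' x1(2)]
      show "(wr has_real_derivative 0) (at x within {c..d})"
        unfolding wr_def
        by (auto intro!: derivative_eq_intros simp: algebra_simps power2_eq_square)
    qed
    from has_integral_unique[OF this has_integral_0] show ?thesis by simp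
  qed
  note le = this
  show ?thesis
  proof (cases "c \<le> d")
    case True
    then show ?thesis using cd by (intro le) auto
  next
    case False
    then show ?thesis using cd by (intro le[symmetric]) auto
  qed
qed

end

context fundamental_solutions
begin

text \<open>
  The two constant Wronskians with \<open>\<phi>\<close> and \<open>\<theta>\<close> are the coefficients of \<open>y\<close>. The representation holds on the open interval
  first, where \<open>deriv y\<close> is meaningful, and extends to the endpoints by continuity of \<open>y\<close>.
\<close>
lemma classical_solution_representation:
  assumes ab: "{a..b} \<subseteq> {0..1}" "a < b" and ac: "abs_cont_on y {0..1}" and diff: "y differentiable_on {a<..<b}"
    and acd: "abs_cont_on (deriv y) {a<..<b}" and sat: "satisfies_eq_ae q w l y"
  obtains A B where "\<And>x. x \<in> {a..b} \<Longrightarrow> y x = A * phi l x + B * theta l x"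
    "quasi_system (sigma l) {a..b} y (\<lambda>x. A * phi_z l x + B * theta_z l x)"
proof -
  have ab': "{a<..<b} \<subseteq> {0..1}" using ab(1) by (auto simp: subset_iff)
  define z where "z x = deriv y x - sigma l x * y x" for x
  define c where "c = (a + b) / 2"
  have c: "c \<in> {a<..<b}" using ab(2) by (auto simp: c_def)
  define A B where "A = - (y c * theta_z l c - z c * theta l c)" and "B = y c * phi_z l c - z c * phi l c"
  note const = classical_wronskian_constant[OF ab' ac diff acd sat, folded z_def]
  have inner: "y x = A * phi l x + B * theta l x" if x: "x \<in> {a<..<b}" for x
  proof -
    have AB: "A = - (y x * theta_z l x - z x * theta l x)" "B = y x * phi_z l x - z x * phi l x"
      unfolding A_def B_def using const[OF theta c x] const[OF phi c x] by simp_all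
    have "A * phi l x + B * theta l x = y x * (theta l x * phi_z l x - theta_z l x * phi l x)"
      unfolding AB by (simp add: algebra_simps)
    then show ?thesis using wronskian[of x l] x ab' by auto
  qed
  have ycont: "continuous_on {a..b} y"
    using abs_cont_on_imp_continuous_on[OF ac is_interval_cc] ab(1) by (rule continuous_on_subset)
  have sys: "quasi_system (sigma l) {a..b} (\<lambda>x. A * phi l x + B * theta l x) (\<lambda>x. A * phi_z l x + B * theta_z l x)"
    by (rule quasi_system_subset[OF quasi_system_lincomb[OF phi theta] ab(1)])
  have eq: "y x = A * phi l x + B * theta l x" if "x \<in> {a..b}" for x
    by (rule continuous_on_eq_closed_interval[OF ycont quasi_system_continuous_on(1)[OF sys] ab(2) inner that])
  show thesis
    by (rule that[OF eq quasi_system_cong[OF sys eq refl]])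
qed

lemma dirichlet_solution_imp:
  assumes "dirichlet_solution q w l y"
  obtains c where "\<And>x. x \<in> {0..1} \<Longrightarrow> y x = c * phi l x"
proof -
  obtain A B where AB: "\<And>x. x \<in> {0..1} \<Longrightarrow> y x = A * phi l x + B * theta l x"
    using classical_solution_representation[OF order_refl zero_less_one, of y l] assms
    unfolding dirichlet_solution_def by blast
  have "B = 0" using AB[of 0] assms by (simp add: init dirichlet_solution_def)
  then show thesis using AB by (intro that[of A]) simp
qed

text \<open>
  On either side of \<open>t\<close> the solution is a combination of \<open>\<phi>\<close> and \<open>\<theta>\<close>. The boundary condition at 0 leaves a multiple of \<open>\<phi>\<close> on the
  left; continuity and the jump condition at \<open>t\<close> are two linear equations for the coefficients on the
  right, with determinant the Wronskian 1.
\<close>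
lemma delta_solution_imp:
  assumes t: "t \<in> {0<..<1}" and sol: "delta_solution q w t r l y"
  obtains c where "\<And>x. x \<in> {0..1} \<Longrightarrow> y x = c * shoot l t r x"
proof -
  note sol = sol[unfolded delta_solution_def]
  have sub: "{0..t} \<subseteq> {0..1}" "{t..1} \<subseteq> {0..1}" and t1: "t \<in> {0..1}" "0 < t" "t < 1" using t by auto
  obtain A B where L: "\<And>x. x \<in> {0..t} \<Longrightarrow> y x = A * phi l x + B * theta l x"
    "quasi_system (sigma l) {0..t} y (\<lambda>x. A * phi_z l x + B * theta_z l x)"
    using classical_solution_representation[OF sub(1) t1(2), of y l] sol by blast
  obtain A' B' where R: "\<And>x. x \<in> {t..1} \<Longrightarrow> y x = A' * phi l x + B' * theta l x"
    "quasi_system (sigma l) {t..1} y (\<lambda>x. A' * phi_z l x + B' * theta_z l x)"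
    using classical_solution_representation[OF sub(2) t1(3), of y l] sol by blast
  have B: "B = 0" using L(1)[of 0] sol t1 by (simp add: init)
  obtain m n where mn: "(deriv y \<longlongrightarrow> m) (at_left t)" "(deriv y \<longlongrightarrow> n) (at_right t)" "m - n = r * y t"
    using sol by blast
  have "m = sigma l t * y t + (A * phi_z l t + B * theta_z l t)"
    using tendsto_unique[OF _ mn(1) quasi_system_deriv_limits(1)[OF L(2) sub(1) t1(2)]] by simp
  moreover have "n = sigma l t * y t + (A' * phi_z l t + B' * theta_z l t)"
    using tendsto_unique[OF _ mn(2) quasi_system_deriv_limits(2)[OF R(2) sub(2) t1(3)]] by simp
  moreover have yt: "y t = A * phi l t" using L(1)[of t] t1 B by simp
  ultimately have j2: "A' * phi_z l t + B' * theta_z l t = A * phi_z l t - r * A * phi l t"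
    using mn(3) B by simp
  have j1: "A' * phi l t + B' * theta l t = A * phi l t" using R(1)[of t] t1 yt by simp
  have "A' = A' * (theta l t * phi_z l t - theta_z l t * phi l t)" by (simp add: wronskian[OF t1(1)])
  also have "\<dots> = theta l t * (A' * phi_z l t + B' * theta_z l t) - theta_z l t * (A' * phi l t + B' * theta l t)"
    by (simp add: algebra_simps)
  also have "\<dots> = A * (theta l t * phi_z l t - theta_z l t * phi l t) - r * A * phi l t * theta l t"
    unfolding j1 j2 by (simp add: algebra_simps)
  also have "\<dots> = A * (1 - r * phi l t * theta l t)"
    unfolding wronskian[OF t1(1)] by (simp add: algebra_simps)
  finally have A': "A' = A * (1 - r * phi l t * theta l t)" .
  have "B' = B' * (theta l t * phi_z l t - theta_z l t * phi l t)" by (simp add: wronskian[OF t1(1)])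
  also have "\<dots> = phi_z l t * (A' * phi l t + B' * theta l t) - phi l t * (A' * phi_z l t + B' * theta_z l t)"
    by (simp add: algebra_simps)
  also have "\<dots> = A * (r * (phi l t)\<^sup>2)"
    unfolding j1 j2 by (simp add: algebra_simps power2_eq_square)
  finally have B': "B' = A * (r * (phi l t)\<^sup>2)" .
  have "y x = A * shoot l t r x" if x: "x \<in> {0..1}" for x
  proof (cases "x \<le> t")
    case True
    then show ?thesis using L(1)[of x] x B by (simp add: shoot_left)
  next
    case False
    then show ?thesis using R(1)[of x] x A' B' by (simp add: shoot_right right_sol_def algebra_simps)
  qed
  then show thesis using that by blast
qed

lemma dirichlet_solution_phi:
  assumes "phi l 1 = 0"
  shows "dirichlet_solution q w l (phi l)"
proof -
  obtain N where "negligible N"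
    "\<And>x. x \<in> {0<..<1} - N \<Longrightarrow> (deriv (phi l) has_real_derivative (q x - l * w x) * phi l x) (at x)"
    using quasi_system_satisfies_ae[OF phi order_refl] by blast
  then show ?thesis
    unfolding dirichlet_solution_def
    using quasi_system_abs_cont[OF phi order_refl] quasi_system_differentiable_on[OF phi] assms
    by (auto simp: init intro: satisfies_eq_aeI)
qed

lemma delta_solution_shoot:
  assumes t: "t \<in> {0<..<1}" and shoot1: "shoot l t r 1 = 0"
  shows "delta_solution q w t r l (shoot l t r)"
proof -
  have sub: "{0..t} \<subseteq> {0..1}" "{t..1} \<subseteq> {0..1}" and t1: "t \<in> {0..1}" "0 < t" "t < 1" using t by auto
  have L: "quasi_system (sigma l) {0..t} (shoot l t r) (phi_z l)"
    by (rule quasi_system_cong[OF quasi_system_subset[OF phi sub(1)]]) (auto simp: shoot_left)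
  have R: "quasi_system (sigma l) {t..1} (shoot l t r) (right_z l t r)"
    by (rule quasi_system_cong[OF quasi_system_subset[OF right_sol_system sub(2)]]) (auto simp: shoot_right)
  \<comment> \<open>\<open>shoot\<close> is \<open>\<phi>\<close> plus a \<open>C\<^sup>1\<close> function composed with the Lipschitz function \<open>x \<mapsto> max x t\<close>.\<close>
  have ac: "abs_cont_on (shoot l t r) {0..1}"
  proof -
    define s where "s x = right_sol l t r x - phi l x" for x
    have sc: "s x = - 1 * phi l x + 1 * right_sol l t r x" for x by (simp add: s_def)
    have "quasi_system (sigma l) {0..1} s (\<lambda>x. - 1 * phi_z l x + 1 * right_z l t r x)"
      by (rule quasi_system_cong[OF quasi_system_lincomb[OF phi right_sol_system] sc refl])
    then have sd: "\<And>x. x \<in> {0..1} \<Longrightarrow> (s has_real_derivative sigma l x * s x + (- 1 * phi_z l x + 1 * right_z l t r x)) (at x within {0..1})"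
      and s_cont: "continuous_on {0..1} s"
      using quasi_systemD(1) quasi_system_continuous_on(1) by blast+
    have gc: "continuous_on {0..1} (\<lambda>x. sigma l x * s x + (- 1 * phi_z l x + 1 * right_z l t r x))"
      using s_cont
      by (intro continuous_intros sigma_cont_interval quasi_system_continuous_on(2)[OF phi]
          quasi_system_continuous_on(2)[OF right_sol_system] order_refl)
    obtain C where C: "\<And>x x'. x \<in> {0..1} \<Longrightarrow> x' \<in> {0..1} \<Longrightarrow> \<bar>s x' - s x\<bar> \<le> C * \<bar>x' - x\<bar>"
      using C1_Lipschitz[OF sd gc] by blast
    have "abs_cont_on (\<lambda>x. s (max x t)) {0..1}"
    proof (rule abs_cont_on_Lipschitz[where C = "\<bar>C\<bar>"])
      fix x x' :: real assume "x \<in> {0..1}" "x' \<in> {0..1}"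
      then have "\<bar>s (max x' t) - s (max x t)\<bar> \<le> C * \<bar>max x' t - max x t\<bar>"
        using t1 by (intro C) auto
      also have "\<dots> \<le> \<bar>C\<bar> * \<bar>x' - x\<bar>"
        by (rule order_trans[OF mult_right_mono[OF abs_ge_self] mult_left_mono]) auto
      finally show "\<bar>s (max x' t) - s (max x t)\<bar> \<le> \<bar>C\<bar> * \<bar>x' - x\<bar>" .
    qed
    then have "abs_cont_on (\<lambda>x. phi l x + s (max x t)) {0..1}"
      by (rule abs_cont_on_add[OF quasi_system_abs_cont(1)[OF phi order_refl]])
    moreover have "(\<lambda>x. phi l x + s (max x t)) = shoot l t r"
      by (rule ext) (auto simp: s_def shoot_def right_sol_at max_def)
    ultimately show ?thesis by simp
  qed
  obtain N1 where N1: "negligible N1"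
    "\<And>x. x \<in> {0<..<t} - N1 \<Longrightarrow> (deriv (shoot l t r) has_real_derivative (q x - l * w x) * shoot l t r x) (at x)"
    using quasi_system_satisfies_ae[OF L sub(1)] by blast
  obtain N2 where N2: "negligible N2"
    "\<And>x. x \<in> {t<..<1} - N2 \<Longrightarrow> (deriv (shoot l t r) has_real_derivative (q x - l * w x) * shoot l t r x) (at x)"
    using quasi_system_satisfies_ae[OF R sub(2)] by blast
  have sat: "satisfies_eq_ae q w l (shoot l t r)"
  proof (rule satisfies_eq_aeI)
    show "negligible (insert t (N1 \<union> N2))" using N1 N2 by simp
    fix x assume "x \<in> {0<..<1} - insert t (N1 \<union> N2)"
    then have "x \<in> {0<..<t} - N1 \<or> x \<in> {t<..<1} - N2" by auto
    then show "(deriv (shoot l t r) has_real_derivative (q x - l * w x) * shoot l t r x) (at x)"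
      using N1(2) N2(2) by blast
  qed
  have jump: "\<exists>m n. (deriv (shoot l t r) \<longlongrightarrow> m) (at_left t) \<and> (deriv (shoot l t r) \<longlongrightarrow> n) (at_right t) \<and> m - n = r * shoot l t r t"
  proof (intro exI conjI)
    show "(deriv (shoot l t r) \<longlongrightarrow> sigma l t * shoot l t r t + phi_z l t) (at_left t)"
      by (rule quasi_system_deriv_limits(1)[OF L sub(1) t1(2)])
    show "(deriv (shoot l t r) \<longlongrightarrow> sigma l t * shoot l t r t + right_z l t r t) (at_right t)"
      by (rule quasi_system_deriv_limits(2)[OF R sub(2) t1(3)])
  qed (simp add: right_z_at[OF t1(1)] shoot_left)
  show ?thesis
    unfolding delta_solution_def
    by (intro conjI ac quasi_system_differentiable_on[OF L] quasi_system_differentiable_on[OF R]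
      quasi_system_abs_cont(3)[OF L sub(1)] quasi_system_abs_cont(3)[OF R sub(2)] jump sat shoot1 shoot_zero
      less_imp_le[OF t1(2)])
qed

lemma perturbed_eigenfunctionD:
  assumes t: "t \<in> {0..1}" and "perturbed_eigenfunction q w t r l y"
  obtains c where "c \<noteq> 0" "\<And>x. x \<in> {0..1} \<Longrightarrow> y x = c * shoot l t r x" "shoot l t r 1 = 0"
proof -
  have sol: "perturbed_solution q w t r l y" and nt: "nontrivial y"
    using assms(2) by (auto simp: perturbed_eigenfunction_def)
  obtain c where c: "\<And>x. x \<in> {0..1} \<Longrightarrow> y x = c * shoot l t r x"
  proof (cases "t \<in> {0<..<1}")
    case True
    then show thesis using delta_solution_imp[OF True, of r l y] sol that by (auto simp: perturbed_solution_def)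
  next
    case False
    then obtain c where c: "\<And>x. x \<in> {0..1} \<Longrightarrow> y x = c * phi l x"
      using dirichlet_solution_imp[of l y] sol unfolding perturbed_solution_def by auto
    show thesis using False t c shoot_trivial[of t r _ l] by (intro that[of c]) auto
  qed
  have "y 1 = 0"
    using sol by (auto simp: perturbed_solution_def delta_solution_def dirichlet_solution_def split: if_splits)
  moreover have "c \<noteq> 0" using nt c by (auto simp: nontrivial_def)
  ultimately show thesis using that[of c] c c[of 1] by auto
qed

lemma nontrivial_shoot:
  assumes "t \<in> {0..1}"
  shows "nontrivial (shoot l t r)"
proof -
  obtain d where "0 < d" "d \<le> 1" "shoot l t r d > 0"
    using shoot_positive_near_zero[OF assms, of l r] by (metis abs_zero diff_self order_refl)
  then show ?thesis unfolding nontrivial_def by (intro bexI[of _ d]) auto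
qed

section \<open>The first eigenvalue function\<close>

lemma perturbed_eigenvalues_eq:
  assumes t: "t \<in> {0..1}"
  shows "perturbed_eigenvalues q w t r = {l. shoot l t r 1 = 0}"
proof -
  have "\<exists>y. perturbed_eigenfunction q w t r l y" if shoot1: "shoot l t r 1 = 0" for l
  proof (cases "t \<in> {0<..<1}")
    case True
    then show ?thesis
      using delta_solution_shoot[OF True shoot1] nontrivial_shoot[OF t, of l r]
      unfolding perturbed_eigenfunction_def perturbed_solution_def by auto
  next
    case False
    then have "shoot l t r x = phi l x" if "x \<le> 1" for x using t that by (intro shoot_trivial) auto
    then have "phi l 1 = 0" "nontrivial (phi l)" using shoot1 nontrivial_shoot[OF t, of l r] by (auto simp: nontrivial_def)
    then show ?thesis
      using dirichlet_solution_phi[of l] False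
      unfolding perturbed_eigenfunction_def perturbed_solution_def by auto
  qed
  then show ?thesis
    using perturbed_eigenfunctionD[OF t] unfolding perturbed_eigenvalues_def by blast
qed

lemma first_eigenvalue_eqI:
  assumes t: "t \<in> {0..1}" and nn: "\<And>x. x \<in> {0..1} \<Longrightarrow> shoot l t r x \<ge> 0" and shoot1: "shoot l t r 1 = 0"
  shows "first_eigenvalue q w t r = l"
  unfolding first_eigenvalue_def perturbed_eigenvalues_eq[OF t]
  using first_eigenparameter_le[OF t nn] shoot1 by (intro Least_equality) auto

lemma first_eigenvalue_props:
  assumes t: "t \<in> {0..1}" and r: "r \<ge> 0"
  defines "l \<equiv> first_eigenvalue q w t r"
  shows "\<And>x. x \<in> {0..1} \<Longrightarrow> shoot l t r x \<ge> 0" "shoot l t r 1 = 0"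
    and "\<And>m. shoot m t r 1 = 0 \<Longrightarrow> l \<le> m"
proof -
  obtain l' where l': "\<And>x. x \<in> {0..1} \<Longrightarrow> shoot l' t r x \<ge> 0" "shoot l' t r 1 = 0"
    using first_eigenparameter_exists[OF t r] by blast
  have "l = l'" unfolding l_def by (rule first_eigenvalue_eqI[OF t l'])
  with l' show "\<And>x. x \<in> {0..1} \<Longrightarrow> shoot l t r x \<ge> 0" "shoot l t r 1 = 0" by auto
  then show "\<And>m. shoot m t r 1 = 0 \<Longrightarrow> l \<le> m" using first_eigenparameter_le[OF t] by blast
qed

lemma first_eigenvalue_trivial:
  assumes t: "t \<in> {0..1}" and tr: "t = 0 \<or> t = 1 \<or> r = 0"
  shows "first_eigenvalue q w t r = first_dirichlet_eigenvalue q w"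
proof -
  have "perturbed_eigenvalues q w t r = perturbed_eigenvalues q w 0 r"
    using perturbed_eigenvalues_eq[OF t, of r] perturbed_eigenvalues_eq[of 0 r] shoot_trivial[OF tr] shoot_trivial[of 0 r]
    by simp
  also have "\<dots> = dirichlet_eigenvalues q w"
    by (simp add: perturbed_eigenvalues_def perturbed_eigenfunction_def perturbed_solution_def dirichlet_eigenvalues_def)
  finally show ?thesis by (simp add: first_eigenvalue_def first_dirichlet_eigenvalue_def)
qed

text \<open>
  The value at 1 compares the Dirichlet problem with its perturbations: for \<open>r \<ge> 0\<close> it is nonpositive, and it is
  negative if \<open>r > 0\<close> and \<open>t\<close> is an inner point. The sign of \<open>\<theta>(1)\<close> comes from the Wronskian, which reduces to \<open>\<theta>(1) \<phi>_z(1) = 1\<close> because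
  \<open>\<phi>(1) = 0\<close>, and from \<open>\<phi>\<close> reaching 0 from above.
\<close>
lemma shoot_at_dirichlet_eigenvalue:
  defines "l1 \<equiv> first_dirichlet_eigenvalue q w"
  shows "\<And>x. x \<in> {0<..<1} \<Longrightarrow> phi l1 x > 0" "theta l1 1 < 0"
    and "\<And>t r. t \<in> {0..1} \<Longrightarrow> shoot l1 t r 1 = r * (phi l1 t)\<^sup>2 * theta l1 1"
proof -
  have zero: "(0 :: real) \<in> {0..1}" and one: "(1 :: real) \<in> {0..1}" by auto
  have l1: "first_eigenvalue q w 0 0 = l1"
    unfolding l1_def by (rule first_eigenvalue_trivial) auto
  have phi_shoot: "shoot l1 0 0 x = phi l1 x" if "x \<in> {0..1}" for x using that by (intro shoot_trivial) auto
  have nn: "\<And>x. x \<in> {0..1} \<Longrightarrow> shoot l1 0 0 x \<ge> 0" and shoot1: "shoot l1 0 0 1 = 0"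
    using first_eigenvalue_props(1,2)[of 0 0] l1 by auto
  have phi1: "phi l1 1 = 0" using shoot1 phi_shoot[OF one] by simp
  show "phi l1 x > 0" if "x \<in> {0<..<1}" for x
    using shoot_positive_inside[OF zero order_refl nn, of x] phi_shoot[of x] that by auto
  show "theta l1 1 < 0"
  proof -
    have "theta l1 1 * phi_z l1 1 = 1" using wronskian[OF one, of l1] phi1 by simp
    moreover have "phi_z l1 1 \<le> 0"
    proof (rule has_real_derivative_within_left_nonpos)
      show "(phi l1 has_real_derivative phi_z l1 1) (at 1 within {0..1})"
        using quasi_systemD(1)[OF phi one, of l1] phi1 by simp
      show "phi l1 1 \<le> phi l1 x" if "x \<in> {0..1}" for x
        using nn[OF that] phi_shoot[OF that] phi1 by simp
    qed simp
    ultimately show ?thesis by (metis linorder_not_le mult_nonneg_nonpos not_one_le_zero)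
  qed
  show "shoot l1 t r 1 = r * (phi l1 t)\<^sup>2 * theta l1 1" if "t \<in> {0..1}" for t r
    using that phi1 by (simp add: shoot_right right_sol_def)
qed

lemma first_eigenvalue_lower_bound:
  assumes "R \<ge> 0"
  shows "\<exists>M. \<forall>t\<in>{0..1}. \<forall>r\<in>{0..R}. M < first_eigenvalue q w t r"
proof -
  obtain M where M: "\<And>l t r x. l \<le> M \<Longrightarrow> t \<in> {0..1} \<Longrightarrow> 0 \<le> r \<Longrightarrow> r \<le> R \<Longrightarrow> 0 < x \<Longrightarrow> x \<le> 1 \<Longrightarrow> shoot l t r x > 0"
    using shoot_positive_for_small_eigenparameter[OF assms] by blast
  have "M < first_eigenvalue q w t r" if t: "t \<in> {0..1}" and r: "r \<in> {0..R}" for t r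
    using M[OF _ t, of "first_eigenvalue q w t r" r 1] first_eigenvalue_props(2)[OF t, of r] r by force
  then show ?thesis by blast
qed

text \<open>
  Between a very negative parameter, where \<open>shoot l t r 1 > 0\<close>, and the Dirichlet eigenvalue, where it is nonpositive,
  there is a zero.
\<close>
lemma first_eigenvalue_le_dirichlet:
  assumes t: "t \<in> {0..1}" and r: "r \<ge> 0"
  shows "first_eigenvalue q w t r \<le> first_dirichlet_eigenvalue q w"
proof -
  let ?l1 = "first_dirichlet_eigenvalue q w"
  obtain M where M: "\<And>l t r' x. l \<le> M \<Longrightarrow> t \<in> {0..1} \<Longrightarrow> 0 \<le> r' \<Longrightarrow> r' \<le> r \<Longrightarrow> 0 < x \<Longrightarrow> x \<le> 1 \<Longrightarrow> shoot l t r' x > 0"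
    using shoot_positive_for_small_eigenparameter[OF r] by blast
  have "shoot ?l1 t r 1 \<le> 0"
    unfolding shoot_at_dirichlet_eigenvalue(3)[OF t] using shoot_at_dirichlet_eigenvalue(2) r
    by (simp add: mult_nonneg_nonpos)
  moreover have "0 \<le> shoot M t r 1" using M[OF order_refl t r order_refl, of 1] by simp
  moreover have "M \<le> ?l1"
  proof (rule ccontr)
    assume "\<not> M \<le> ?l1"
    then have "shoot ?l1 t r 1 > 0" using M[OF _ t r order_refl, of ?l1 1] by simp
    with \<open>shoot ?l1 t r 1 \<le> 0\<close> show False by simp
  qed
  moreover have "continuous_on {M..?l1} (\<lambda>l. (\<lambda>(l, t, r, x). shoot l t r x) (l, t, r, 1))"
    by (rule continuous_on_compose2[OF shoot_continuous]) (use t in \<open>auto intro!: continuous_intros\<close>)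
  ultimately obtain m where "m \<le> ?l1" "shoot m t r 1 = 0"
    using IVT2'[of "\<lambda>l. shoot l t r 1" ?l1 0 M] by auto
  then show ?thesis using first_eigenvalue_props(3)[OF t r] by force
qed

lemma first_eigenvalue_less_dirichlet:
  assumes t: "t \<in> {0<..<1}" and r: "r > 0"
  shows "first_eigenvalue q w t r < first_dirichlet_eigenvalue q w"
proof -
  let ?l1 = "first_dirichlet_eigenvalue q w"
  have t1: "t \<in> {0..1}" using t by auto
  have "shoot ?l1 t r 1 < 0"
    unfolding shoot_at_dirichlet_eigenvalue(3)[OF t1]
    using shoot_at_dirichlet_eigenvalue(1)[OF t] shoot_at_dirichlet_eigenvalue(2) r by (simp add: mult_pos_neg)
  then have "first_eigenvalue q w t r \<noteq> ?l1"
    using first_eigenvalue_props(2)[OF t1, of r] r by auto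
  then show ?thesis using first_eigenvalue_le_dirichlet[OF t1, of r] r by simp
qed

text \<open>
  For \<open>r \<le> R\<close> the values lie in a compact interval and the graph is the closed set of all \<open>((t, r), l)\<close> with
  \<open>shoot l t r \<ge> 0\<close> on the unit interval and \<open>shoot l t r 1 = 0\<close>.
\<close>
lemma first_eigenvalue_continuous:
  "continuous_on ({0..1} \<times> {0..}) (\<lambda>(t, r). first_eigenvalue q w t r)"
proof -
  define f where "f = (\<lambda>(t :: real, r :: real). first_eigenvalue q w t r)"
  have cR: "continuous_on ({0..1} \<times> {0..R}) f" if R: "R \<ge> 0" for R
  proof -
    let ?S = "{0..1} \<times> {0..R} :: (real \<times> real) set"
    obtain M where M: "\<forall>t\<in>{0..1}. \<forall>r\<in>{0..R}. M < first_eigenvalue q w t r"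
      using first_eigenvalue_lower_bound[OF R] by blast
    define v where "v x z = shoot (snd z) (fst (fst z)) (snd (fst z)) x" for x and z :: "(real \<times> real) \<times> real"
    have vc: "continuous_on (?S \<times> UNIV) (v x)" if "x \<in> {0..1}" for x
    proof -
      have "continuous_on (?S \<times> UNIV) (\<lambda>z. (\<lambda>(l, t, r, x). shoot l t r x) (snd z, fst (fst z), snd (fst z), x))"
        by (rule continuous_on_compose2[OF shoot_continuous]) (use that in \<open>auto intro!: continuous_intros\<close>)
      then show ?thesis by (simp add: v_def[abs_def])
    qed
    have graph: "(\<forall>x\<in>{0..1}. shoot l t r x \<ge> 0) \<and> shoot l t r 1 = 0 \<longleftrightarrow> l = first_eigenvalue q w t r"
      if t: "t \<in> {0..1}" and r: "r \<in> {0..R}" for t r l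
    proof
      assume "(\<forall>x\<in>{0..1}. shoot l t r x \<ge> 0) \<and> shoot l t r 1 = 0"
      then show "l = first_eigenvalue q w t r" using first_eigenvalue_eqI[OF t, of l r] by simp
    next
      assume "l = first_eigenvalue q w t r"
      then show "(\<forall>x\<in>{0..1}. shoot l t r x \<ge> 0) \<and> shoot l t r 1 = 0"
        using first_eigenvalue_props(1,2)[OF t, of r] r by simp
    qed
    have Sc: "closed (?S \<times> (UNIV :: real set))" by (intro closed_Times) auto
    have "(\<lambda>p. (p, f p)) ` ?S = (\<Inter>x\<in>{0..1}. {z \<in> ?S \<times> UNIV. v x z \<in> {0..}}) \<inter> {z \<in> ?S \<times> UNIV. v 1 z \<in> {0}}"
      (is "?G = ?C")
    proof (rule set_eqI)
      fix z :: "(real \<times> real) \<times> real"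
      obtain t r l where z: "z = ((t, r), l)" by (metis surj_pair)
      have "z \<in> ?C \<longleftrightarrow> t \<in> {0..1} \<and> r \<in> {0..R} \<and> (\<forall>x\<in>{0..1}. shoot l t r x \<ge> 0) \<and> shoot l t r 1 = 0"
        by (auto simp: z v_def)
      also have "\<dots> \<longleftrightarrow> t \<in> {0..1} \<and> r \<in> {0..R} \<and> l = first_eigenvalue q w t r"
        by (intro conj_cong refl graph) auto
      also have "\<dots> \<longleftrightarrow> z \<in> ?G" by (auto simp: z f_def)
      finally show "z \<in> ?G \<longleftrightarrow> z \<in> ?C" by simp
    qed
    moreover have "closed ?C"
      using vc Sc by (intro closed_Int closed_INT ballI continuous_closed_preimage[unfolded vimage_def Int_def, simplified]) auto
    ultimately have "closed ((\<lambda>p. (p, f p)) ` ?S)" by simp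
    moreover have "f \<in> ?S \<rightarrow> {M..first_dirichlet_eigenvalue q w}"
      using M first_eigenvalue_le_dirichlet by (auto simp: f_def less_imp_le)
    ultimately show ?thesis by (intro continuous_from_closed_graph[of "{M..first_dirichlet_eigenvalue q w}"]) auto
  qed
  have "continuous_on ({0..1} \<times> {0..}) f"
    unfolding continuous_on_eq_continuous_within
  proof
    fix p :: "real \<times> real" assume p: "p \<in> {0..1} \<times> {0..}"
    define R where "R = snd p + 1"
    have R: "R \<ge> 0" "p \<in> {0..1} \<times> {0..R}" using p by (auto simp: R_def)
    then have "continuous (at p within {0..1} \<times> {0..R}) f"
      using cR[OF R(1)] by (simp only: continuous_on_eq_continuous_within)
    moreover have "at p within {0..1} \<times> {0..R} = at p within {0..1} \<times> {0..}"
    proof (rule at_within_nhd[of _ "UNIV \<times> {..<R}"])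
      show "open ((UNIV :: real set) \<times> {..<R})" by (intro open_Times) auto
    qed (auto simp: R_def mem_Times_iff)
    ultimately show "continuous (at p within {0..1} \<times> {0..}) f" by (simp add: continuous_within)
  qed
  then show ?thesis by (simp add: f_def)
qed

lemma first_eigenfunction_sign:
  assumes t: "t \<in> {0..1}" and r: "r \<ge> 0"
    and ef: "perturbed_eigenfunction q w t r (first_eigenvalue q w t r) y"
  shows "(\<forall>x\<in>{0<..<1}. y x > 0) \<or> (\<forall>x\<in>{0<..<1}. y x < 0)"
proof -
  let ?l = "first_eigenvalue q w t r"
  obtain c where c: "c \<noteq> 0" "\<And>x. x \<in> {0..1} \<Longrightarrow> y x = c * shoot ?l t r x"
    using perturbed_eigenfunctionD[OF t ef] by blast
  have "shoot ?l t r x > 0" if "x \<in> {0<..<1}" for x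
    using shoot_positive_inside[OF t order_refl first_eigenvalue_props(1)[OF t r], of x] that by auto
  then show ?thesis
    using c by (cases "c > 0") (auto simp: mult_pos_pos mult_neg_pos)
qed

end

lemma (in sturm_liouville) fundamental_solutions_exist:
  obtains phi phi_z theta theta_z where "fundamental_solutions q w phi phi_z theta theta_z"
proof -
  obtain phi phi_z where phi: "\<And>l. phi l 0 = 0" "\<And>l. phi_z l 0 = 1" "\<And>l. quasi_system (sigma l) {0..1} (phi l) (phi_z l)"
    "continuous_on (UNIV \<times> {0..1}) (\<lambda>(l, x). phi l x)" "continuous_on (UNIV \<times> {0..1}) (\<lambda>(l, x). phi_z l x)"
    by (rule quasi_system_exists[OF sigma_cont, where c = 0 and d = 1]) blast
  obtain theta theta_z where theta: "\<And>l. theta l 0 = 1" "\<And>l. theta_z l 0 = 0" "\<And>l. quasi_system (sigma l) {0..1} (theta l) (theta_z l)"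
    "continuous_on (UNIV \<times> {0..1}) (\<lambda>(l, x). theta l x)" "continuous_on (UNIV \<times> {0..1}) (\<lambda>(l, x). theta_z l x)"
    by (rule quasi_system_exists[OF sigma_cont, where c = 1 and d = 0]) blast
  show thesis
    by (rule that, unfold_locales) (fact phi theta)+
qed

lemma satisfies_eq_ae_weight_cong:
  assumes "AE x in lebesgue. x \<in> {0<..<1} \<longrightarrow> w' x = w x"
  shows "satisfies_eq_ae q w' = satisfies_eq_ae q w"
proof (intro ext)
  fix m y
  have "(AE x in lebesgue. x \<in> {0<..<1} \<longrightarrow> (\<exists>d. (deriv y has_real_derivative d) (at x) \<and> - d + q x * y x = m * w' x * y x))
    \<longleftrightarrow> (AE x in lebesgue. x \<in> {0<..<1} \<longrightarrow> (\<exists>d. (deriv y has_real_derivative d) (at x) \<and> - d + q x * y x = m * w x * y x))"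
    by (rule eventually_subst) (use assms in \<open>eventually_elim, auto\<close>)
  then show "satisfies_eq_ae q w' m y = satisfies_eq_ae q w m y" by (simp only: satisfies_eq_ae_def)
qed

theorem theorem3p2:
  fixes q w :: "real \<Rightarrow> real"
  assumes "q absolutely_integrable_on {0..1}"
    and "w absolutely_integrable_on {0..1}"
    and "AE x in lebesgue. x \<in> {0<..<1} \<longrightarrow> w x > 0"
  shows "(\<forall>t\<in>{0..1}. \<forall>r\<ge>0.
            first_eigenvalue q w t r \<in> perturbed_eigenvalues q w t r \<and>
            (\<forall>\<mu>\<in>perturbed_eigenvalues q w t r. first_eigenvalue q w t r \<le> \<mu>))
       \<and> continuous_on ({0..1} \<times> {0..}) (\<lambda>(t, r). first_eigenvalue q w t r)
       \<and> (\<forall>t\<in>{0..1}. \<forall>r\<ge>0. \<forall>\<Phi>. perturbed_eigenfunction q w t r (first_eigenvalue q w t r) \<Phi> \<longrightarrow>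
            (\<forall>x\<in>{0<..<1}. \<Phi> x > 0) \<or> (\<forall>x\<in>{0<..<1}. \<Phi> x < 0))
       \<and> (\<forall>t\<in>{0<..<1}. \<forall>r>0.
            first_eigenvalue q w t r < first_eigenvalue q w 0 r \<and>
            first_eigenvalue q w 0 r = first_eigenvalue q w 1 r \<and>
            first_eigenvalue q w 1 r = first_eigenvalue q w t 0 \<and>
            first_eigenvalue q w t 0 = first_dirichlet_eigenvalue q w)"
proof -
  define w' where "w' x = (if w x > 0 then w x else 1)" for x
  have ae: "AE x in lebesgue. x \<in> {0<..<1} \<longrightarrow> w' x = w x"
    using assms(3) by eventually_elim (simp add: w'_def)
  obtain N where N: "N \<in> null_sets lebesgue" "{x \<in> space lebesgue. \<not> (x \<in> {0<..<1} \<longrightarrow> w' x = w x)} \<subseteq> N"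
    using ae unfolding eventually_ae_filter by blast
  have "w' absolutely_integrable_on {0..1}"
  proof (rule absolutely_integrable_spike[OF assms(2)])
    show "negligible (N \<union> {0, 1})" using N(1) by (intro negligible_Un) (auto simp: negligible_iff_null_sets)
    show "w' x = w x" if "x \<in> {0..1} - (N \<union> {0, 1})" for x
      using that N(2) by (auto simp: less_le)
  qed
  then interpret sturm_liouville q w'
    using assms(1) by unfold_locales (auto simp: w'_def)
  obtain phi phi_z theta theta_z where "fundamental_solutions q w' phi phi_z theta theta_z"
    using fundamental_solutions_exist by blast
  then interpret fundamental_solutions q w' phi phi_z theta theta_z .
  have sat: "satisfies_eq_ae q w = satisfies_eq_ae q w'"
    using satisfies_eq_ae_weight_cong[OF ae] by simp
  have dir: "dirichlet_solution q w = dirichlet_solution q w'"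
    by (intro ext) (simp add: dirichlet_solution_def sat)
  have del: "delta_solution q w = delta_solution q w'"
    by (intro ext) (simp add: delta_solution_def sat)
  have ef: "perturbed_eigenfunction q w = perturbed_eigenfunction q w'"
    by (intro ext) (simp add: perturbed_eigenfunction_def perturbed_solution_def dir del)
  have ev: "perturbed_eigenvalues q w = perturbed_eigenvalues q w'"
    by (intro ext) (simp add: perturbed_eigenvalues_def ef)
  have fe: "first_eigenvalue q w = first_eigenvalue q w'"
    by (intro ext) (simp add: first_eigenvalue_def ev)
  have fd: "first_dirichlet_eigenvalue q w = first_dirichlet_eigenvalue q w'"
    by (simp add: first_dirichlet_eigenvalue_def dirichlet_eigenvalues_def dir)
  show ?thesis
    unfolding fe fd ef ev
  proof (intro conjI ballI allI impI)
    fix t r :: real assume t: "t \<in> {0..1}" and r: "0 \<le> r"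
    show "first_eigenvalue q w' t r \<in> perturbed_eigenvalues q w' t r"
      using first_eigenvalue_props(2)[OF t r] by (simp add: perturbed_eigenvalues_eq[OF t])
    show "first_eigenvalue q w' t r \<le> m" if "m \<in> perturbed_eigenvalues q w' t r" for m
      using first_eigenvalue_props(3)[OF t r] that by (simp add: perturbed_eigenvalues_eq[OF t])
    show "(\<forall>x\<in>{0<..<1}. \<Phi> x > 0) \<or> (\<forall>x\<in>{0<..<1}. \<Phi> x < 0)"
      if "perturbed_eigenfunction q w' t r (first_eigenvalue q w' t r) \<Phi>" for \<Phi>
      by (rule first_eigenfunction_sign[OF t r that])
  next
    show "continuous_on ({0..1} \<times> {0..}) (\<lambda>(t, r). first_eigenvalue q w' t r)"
      by (rule first_eigenvalue_continuous)
  next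
    fix t r :: real assume t: "t \<in> {0<..<1}" and r: "r > 0"
    have eqs: "first_eigenvalue q w' 0 r = first_dirichlet_eigenvalue q w'"
      "first_eigenvalue q w' 1 r = first_dirichlet_eigenvalue q w'"
      "first_eigenvalue q w' t 0 = first_dirichlet_eigenvalue q w'"
      using t by (auto intro!: first_eigenvalue_trivial)
    show "first_eigenvalue q w' t r < first_eigenvalue q w' 0 r"
      unfolding eqs using t r by (rule first_eigenvalue_less_dirichlet)
    show "first_eigenvalue q w' 0 r = first_eigenvalue q w' 1 r"
      "first_eigenvalue q w' 1 r = first_eigenvalue q w' t 0"
      "first_eigenvalue q w' t 0 = first_dirichlet_eigenvalue q w'"
      by (simp_all add: eqs)
  qed
qed

end
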